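(* Let $m\geq 1$ and let $A$ be an $\mathcal R_m$-algebra. Let $t,q \geq 1$ be integers such that $q$ divides $t$. Then for all integers $p,r\geq 0$ such that $rt<mq$ the inclusion $$SG_q(A) \to \mathrm{Aff}_{p,q}^{SG}(A),\quad M \mapsto \begin{pmatrix} M & 0\\ 0 & 1_p\end{pmatrix}$$ induces an isomorphism of $\bar{A}^*$-modules $$H_r(SG_q(A)) \cong s_{m,-t}^{-1}\, H_r(\mathrm{Aff}_{p,q}^{SG}(A)).$$
   Context: $\mathcal R_m=\mathbb Z[X_1,\dots,X_m][\Sigma^{-1}]$, where $\Sigma=\{X_J:\emptyset\neq J\subset\{1,\dots,m\}\}$ and $X_J=\sum_{j\in J}X_j$. An $\mathcal R_m$-algebra is a (not necessarily commutative) associative unital ring $A$ with a ring homomorphism from $\mathcal R_m$ to its center $Z(A)$. $\det:GL_q(A)\to K_1(A)=GL(A)^{ab}$ is the map induced by the inclusions $GL_q(A)\subset GL(A)$, $M\mapsto\begin{pmatrix} M & 0 \\ 0 & 1 \end{pmatrix}$. $\bar A^*\subset K_1(A)$ is the image of $Z(A)^*\subset GL_1(A)\to K_1(A)$. $G_q(A)=\{T\in GL_q(A):\det T\in\bar A^*\}$ and $SG_q(A)=\ker(\det:GL_q(A)\to K_1(A))$. Inside $GL_{p+q}(A)$, $$\mathrm{Aff}^{G}_{p,q}(A)=\begin{pmatrix} G_q(A) & 0 \\ M_{p,q}(A) & 1_p \end{pmatrix},\qquad \mathrm{Aff}^{SG}_{p,q}(A)=\begin{pmatrix} SG_q(A)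 & 0 \\ M_{p,q}(A) & 1_p \end{pmatrix}.$$ There are exact sequences $1\to SG_q(A)\to G_q(A)\xrightarrow{\det}\bar A^*\to1$ and $1\to \mathrm{Aff}^{SG}_{p,q}(A)\to \mathrm{Aff}^{G}_{p,q}(A)\xrightarrow{\det}\bar A^*\to1$, which make the integral homology groups $H_r(SG_q(A))$ and $H_r(\mathrm{Aff}^{SG}_{p,q}(A))$ into $\bar A^*$-modules by conjugation. For $t\in\mathbb Z$, $s_{m,t}=-\sum_{\emptyset\ne J\subset\{1,\dots,m\}}(-1)^{|J|}\langle (X_J)^t\rangle\in\mathbb Z[\mathcal R_m^*]$, where $\langle g\rangle$ denotes the basis element of the group ring corresponding to $g$; its image in $\mathbb Z[\bar A^*]$ under the map induced by $\mathcal R_m^*\to Z(A)^*\to\bar A^*$ is also denoted $s_{m,t}$. $s^{-1}M$ denotes the localization of a $\mathbb Z[\bar A^*]$-module $M$ at $s$. *)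

theory Defs
  imports
    "HOL-Algebra.Generated_Groups"
    "HOL-Algebra.Free_Abelian_Groups"
    "HOL-Computational_Algebra.Fraction_Field"
    "Jordan_Normal_Form.Matrix"
    "HOL-Algebra.Module"
begin

hide_const (open) Multiset.mult


section \<open>The ring of coefficients\<close>

text \<open>
  Polynomials over the integers in countably many variables (a monomial is a finitely supported
  exponent function) form an integral domain, so the localization of
  $\mathbf{Z}[X_1,\dots,X_m]$ at $\Sigma$ is taken inside the field of fractions.
\<close>

type_synonym int_mpoly = "(nat \<Rightarrow>\<^sub>0 nat) \<Rightarrow>\<^sub>0 int"

definition Xvar :: "nat \<Rightarrow> int_mpoly" where
  "Xvar j = Poly_Mapping.single (Poly_Mapping.single j 1) 1"

definition Xsum :: "nat set \<Rightarrow> int_mpoly" where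
  "Xsum J = (\<Sum>j\<in>J. Xvar j)"

definition int_polys :: "nat \<Rightarrow> int_mpoly set" where
  "int_polys m = {f. \<forall>e\<in>Poly_Mapping.keys f. Poly_Mapping.keys e \<subseteq> {1..m}}"

definition nonempty_subsets :: "nat \<Rightarrow> nat set set" where
  "nonempty_subsets m = Pow {1..m} - {{}}"

definition Sigma_products :: "nat \<Rightarrow> int_mpoly set" where
  "Sigma_products m = {\<Prod>J\<in>nonempty_subsets m. Xsum J ^ e J | e. True}"

definition Rm :: "nat \<Rightarrow> int_mpoly fract ring" where
  "Rm m = \<lparr>carrier = {Fract f g | f g. f \<in> int_polys m \<and> g \<in> Sigma_products m},
           mult = (*), one = 1, zero = 0, add = (+)\<rparr>"

text \<open>
  The element $s_{m,t}$ of the group ring of the units of \<open>Rm m\<close>; elements of integral group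
  rings are finitely supported integer-valued functions, \<open>frag_of g\<close> being the basis element
  of \<open>g\<close>.
\<close>

definition s_elem :: "nat \<Rightarrow> int \<Rightarrow> int_mpoly fract \<Rightarrow>\<^sub>0 int" where
  "s_elem m t =
     - (\<Sum>J\<in>nonempty_subsets m. frag_cmul ((-1) ^ card J) (frag_of (Fract (Xsum J) 1 powi t)))"


section \<open>General linear groups and \<open>K\<^sub>1\<close>\<close>

text \<open>
  The sort \<open>{ring, monoid_mult}\<close> is that of associative unital rings, not necessarily
  commutative; unlike \<open>ring_1\<close> it also admits the zero ring.
\<close>

definition center_ring :: "'a::{ring,monoid_mult} ring" where
  "center_ring = \<lparr>carrier = {z. \<forall>a. z * a = a * z}, mult = (*), one = 1, zero = 0, add = (+)\<rparr>"

definition GL :: "nat \<Rightarrow> 'a::{ring,monoid_mult} mat monoid" where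
  "GL n = units_of \<lparr>carrier = carrier_mat n n, mult = (*), one = 1\<^sub>m n\<rparr>"

text \<open>
  The stable group is realised by infinite matrices which differ from the identity matrix only
  in an invertible finite upper left block. In the product, row \<open>i\<close> of \<open>f\<close> has finite support.
\<close>

definition stabilize :: "'a::{ring,monoid_mult} mat \<Rightarrow> nat \<Rightarrow> nat \<Rightarrow> 'a" where
  "stabilize M = (\<lambda>i j. if i < dim_row M \<and> j < dim_row M then M $$ (i, j)
                        else if i = j then 1 else 0)"

definition GL_stable :: "(nat \<Rightarrow> nat \<Rightarrow> 'a::{ring,monoid_mult}) monoid" where
  "GL_stable = \<lparr>carrier = (\<Union>n. stabilize ` carrier (GL n)),
                mult = (\<lambda>f g i j. \<Sum>k | f i k \<noteq> 0. f i k * g k j),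
                one = (\<lambda>i j. if i = j then 1 else 0)\<rparr>"

definition K1 :: "(nat \<Rightarrow> nat \<Rightarrow> 'a::{ring,monoid_mult}) set monoid" where
  "K1 = GL_stable Mod derived GL_stable (carrier GL_stable)"

definition K1_det :: "'a::{ring,monoid_mult} mat \<Rightarrow> (nat \<Rightarrow> nat \<Rightarrow> 'a) set" where
  "K1_det M = derived GL_stable (carrier GL_stable) #>\<^bsub>GL_stable\<^esub> stabilize M"

definition K1_scalar :: "'a::{ring,monoid_mult} \<Rightarrow> (nat \<Rightarrow> nat \<Rightarrow> 'a) set" where
  "K1_scalar z = K1_det (mat 1 1 (\<lambda>_. z))"

definition bar_units :: "(nat \<Rightarrow> nat \<Rightarrow> 'a::{ring,monoid_mult}) set monoid" where
  "bar_units = K1\<lparr>carrier := K1_scalar ` Units center_ring\<rparr>"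

definition G_grp :: "nat \<Rightarrow> 'a::{ring,monoid_mult} mat monoid" where
  "G_grp q = (GL q)\<lparr>carrier := {T \<in> carrier (GL q). K1_det T \<in> carrier bar_units}\<rparr>"

definition SG_grp :: "nat \<Rightarrow> 'a::{ring,monoid_mult} mat monoid" where
  "SG_grp q = (GL q)\<lparr>carrier := kernel (GL q) K1 K1_det\<rparr>"

definition Aff_grp ::
    "nat \<Rightarrow> nat \<Rightarrow> 'a::{ring,monoid_mult} mat monoid \<Rightarrow> 'a mat monoid" where
  "Aff_grp p q H = (GL (q + p))\<lparr>carrier :=
     {four_block_mat T (0\<^sub>m q p) N (1\<^sub>m p) | T N. T \<in> carrier H \<and> N \<in> carrier_mat p q}\<rparr>"

definition AffG_grp :: "nat \<Rightarrow> nat \<Rightarrow> 'a::{ring,monoid_mult} mat monoid" where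
  "AffG_grp p q = Aff_grp p q (G_grp q)"

definition AffSG_grp :: "nat \<Rightarrow> nat \<Rightarrow> 'a::{ring,monoid_mult} mat monoid" where
  "AffSG_grp p q = Aff_grp p q (SG_grp q)"

definition SG_to_Aff :: "nat \<Rightarrow> nat \<Rightarrow> 'a::{ring,monoid_mult} mat \<Rightarrow> 'a mat" where
  "SG_to_Aff p q M = four_block_mat M (0\<^sub>m q p) (0\<^sub>m p q) (1\<^sub>m p)"


section \<open>Integral group homology\<close>

text \<open>
  Homology of the inhomogeneous bar complex: the \<open>r\<close>-chains are the free abelian group on lists
  $[g_1|\dots|g_r]$, and
  $\partial[g_1|\dots|g_r] = [g_2|\dots|g_r]
     + \sum_{i=1}^{r-1} (-1)^i [g_1|\dots|g_i g_{i+1}|\dots|g_r] + (-1)^r [g_1|\dots|g_{r-1}]$.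
  List positions are counted from 0.
\<close>

definition bar_chains :: "nat \<Rightarrow> ('g, 'b) monoid_scheme \<Rightarrow> ('g list \<Rightarrow>\<^sub>0 int) monoid" where
  "bar_chains r G = free_Abelian_group {gs. length gs = r \<and> set gs \<subseteq> carrier G}"

definition bar_face :: "('g, 'b) monoid_scheme \<Rightarrow> 'g list \<Rightarrow> nat \<Rightarrow> 'g list" where
  "bar_face G gs i = take (i - 1) gs @ [gs ! (i - 1) \<otimes>\<^bsub>G\<^esub> gs ! i] @ drop (i + 1) gs"

definition bar_boundary ::
    "('g, 'b) monoid_scheme \<Rightarrow> ('g list \<Rightarrow>\<^sub>0 int) \<Rightarrow> ('g list \<Rightarrow>\<^sub>0 int)" where
  "bar_boundary G = frag_extend (\<lambda>gs. if gs = [] then 0 else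
     frag_of (tl gs)
     + (\<Sum>i = 1..<length gs. frag_cmul ((-1) ^ i) (frag_of (bar_face G gs i)))
     + frag_cmul ((-1) ^ length gs) (frag_of (butlast gs)))"

definition bar_cycles :: "nat \<Rightarrow> ('g, 'b) monoid_scheme \<Rightarrow> ('g list \<Rightarrow>\<^sub>0 int) monoid" where
  "bar_cycles r G = (bar_chains r G)\<lparr>carrier := {c \<in> carrier (bar_chains r G). bar_boundary G c = 0}\<rparr>"

definition bar_boundaries :: "nat \<Rightarrow> ('g, 'b) monoid_scheme \<Rightarrow> ('g list \<Rightarrow>\<^sub>0 int) set" where
  "bar_boundaries r G = bar_boundary G ` carrier (bar_chains (Suc r) G)"

definition homology :: "nat \<Rightarrow> ('g, 'b) monoid_scheme \<Rightarrow> ('g list \<Rightarrow>\<^sub>0 int) set monoid" where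
  "homology r G = bar_cycles r G Mod bar_boundaries r G"

text \<open>
  A homology class is a coset of cycles. The union below runs over all representatives \<open>z\<close> of the
  class \<open>c\<close>; when \<open>f\<close> is a homomorphism they all yield the same coset. The unions in later
  definitions are to be read in the same way.
\<close>

definition homology_map ::
    "nat \<Rightarrow> ('h, 'c) monoid_scheme \<Rightarrow> ('g \<Rightarrow> 'h) \<Rightarrow> ('g list \<Rightarrow>\<^sub>0 int) set \<Rightarrow> ('h list \<Rightarrow>\<^sub>0 int) set"
  where "homology_map r H f c =
     (\<Union>z\<in>c. bar_boundaries r H #>\<^bsub>bar_cycles r H\<^esub> frag_extend (\<lambda>gs. frag_of (map f gs)) z)"

text \<open>
  For an exact sequence $1 \to N \to E \stackrel{d}{\to} Q \to 1$, the element \<open>a\<close> of \<open>Q\<close> acts on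
  the homology of \<open>N\<close> by the map induced by $n \mapsto T n T^{-1}$, for any \<open>T\<close> with \<open>d T = a\<close>.
\<close>

definition conj_action ::
    "nat \<Rightarrow> ('g, 'b) monoid_scheme \<Rightarrow> ('g, 'c) monoid_scheme \<Rightarrow> ('g \<Rightarrow> 'q)
     \<Rightarrow> 'q \<Rightarrow> ('g list \<Rightarrow>\<^sub>0 int) set \<Rightarrow> ('g list \<Rightarrow>\<^sub>0 int) set" where
  "conj_action r N E d a x =
     (\<Union>T\<in>{T \<in> carrier E. d T = a}. homology_map r N (\<lambda>n. T \<otimes>\<^bsub>E\<^esub> n \<otimes>\<^bsub>E\<^esub> inv\<^bsub>E\<^esub> T) x)"


section \<open>Modules over group rings, and localization\<close>

text \<open>
  The library's module record extends the ring record; the multiplicative part is irrelevant for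
  modules and is left undefined.
\<close>

definition group_ring :: "('q, 'b) monoid_scheme \<Rightarrow> ('q \<Rightarrow>\<^sub>0 int) ring" where
  "group_ring Q = \<lparr>carrier = {c. Poly_Mapping.keys c \<subseteq> carrier Q},
     mult = (\<lambda>c d. frag_extend (\<lambda>g. frag_extend (\<lambda>h. frag_of (g \<otimes>\<^bsub>Q\<^esub> h)) d) c),
     one = frag_of \<one>\<^bsub>Q\<^esub>, zero = 0, add = (+)\<rparr>"

definition action_module ::
    "('x, 'b) monoid_scheme \<Rightarrow> ('q \<Rightarrow> 'x \<Rightarrow> 'x) \<Rightarrow> ('q \<Rightarrow>\<^sub>0 int, 'x) module" where
  "action_module M act = \<lparr>carrier = carrier M, mult = undefined, one = undefined,
     zero = \<one>\<^bsub>M\<^esub>, add = mult M,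
     smult = (\<lambda>c x. \<Otimes>\<^bsub>M\<^esub>a\<in>Poly_Mapping.keys c. act a x [^]\<^bsub>M\<^esub> Poly_Mapping.lookup c a)\<rparr>"

text \<open>
  The localization at the powers of \<open>s\<close>: the pair \<open>(x, n)\<close> represents the fraction $x / s^n$.
\<close>

definition frac_rel ::
    "('r, 'b) ring_scheme \<Rightarrow> ('r, 'x, 'c) module_scheme \<Rightarrow> 'r \<Rightarrow> (('x \<times> nat) \<times> ('x \<times> nat)) set" where
  "frac_rel R M s = {((x, n), (y, k)). x \<in> carrier M \<and> y \<in> carrier M \<and>
     (\<exists>l. (s [^]\<^bsub>R\<^esub> (l + k)) \<odot>\<^bsub>M\<^esub> x = (s [^]\<^bsub>R\<^esub> (l + n)) \<odot>\<^bsub>M\<^esub> y)}"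

definition localization ::
    "('r, 'b) ring_scheme \<Rightarrow> 'r \<Rightarrow> ('r, 'x, 'c) module_scheme \<Rightarrow> ('r, ('x \<times> nat) set) module" where
  "localization R s M = \<lparr>carrier = (carrier M \<times> UNIV) // frac_rel R M s,
     mult = undefined, one = undefined,
     zero = frac_rel R M s `` {(\<zero>\<^bsub>M\<^esub>, 0)},
     add = (\<lambda>U V. \<Union>(x, n)\<in>U. \<Union>(y, k)\<in>V.
       frac_rel R M s `` {((s [^]\<^bsub>R\<^esub> k) \<odot>\<^bsub>M\<^esub> x \<oplus>\<^bsub>M\<^esub> (s [^]\<^bsub>R\<^esub> n) \<odot>\<^bsub>M\<^esub> y, n + k)}),
     smult = (\<lambda>c U. \<Union>(x, n)\<in>U. frac_rel R M s `` {(c \<odot>\<^bsub>M\<^esub> x, n)})\<rparr>"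

definition to_localization ::
    "('r, 'b) ring_scheme \<Rightarrow> 'r \<Rightarrow> ('r, 'x, 'c) module_scheme \<Rightarrow> 'x \<Rightarrow> ('x \<times> nat) set" where
  "to_localization R s M x = frac_rel R M s `` {(x, 0)}"

definition module_iso ::
    "('r, 'b) ring_scheme \<Rightarrow> ('r, 'x, 'c) module_scheme \<Rightarrow> ('r, 'y, 'd) module_scheme
     \<Rightarrow> ('x \<Rightarrow> 'y) \<Rightarrow> bool" where
  "module_iso R M N f \<longleftrightarrow> module R M \<and> module R N \<and> f \<in> iso (add_monoid M) (add_monoid N) \<and>
     (\<forall>c\<in>carrier R. \<forall>x\<in>carrier M. f (c \<odot>\<^bsub>M\<^esub> x) = c \<odot>\<^bsub>N\<^esub> f x)"


section \<open>The modules at hand\<close>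

type_synonym 'a K1_ring_elem = "(nat \<Rightarrow> nat \<Rightarrow> 'a) set \<Rightarrow>\<^sub>0 int"

type_synonym 'a homology_module = "('a K1_ring_elem, ('a mat list \<Rightarrow>\<^sub>0 int) set) module"

definition H_SG :: "nat \<Rightarrow> nat \<Rightarrow> 'a::{ring,monoid_mult} homology_module" where
  "H_SG r q = action_module (homology r (SG_grp q)) (conj_action r (SG_grp q) (G_grp q) K1_det)"

definition H_AffSG :: "nat \<Rightarrow> nat \<Rightarrow> nat \<Rightarrow> 'a::{ring,monoid_mult} homology_module" where
  "H_AffSG r p q =
     action_module (homology r (AffSG_grp p q)) (conj_action r (AffSG_grp p q) (AffG_grp p q) K1_det)"

definition s_image ::
    "(int_mpoly fract \<Rightarrow> 'a::{ring,monoid_mult}) \<Rightarrow> nat \<Rightarrow> int \<Rightarrow> 'a K1_ring_elem" where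
  "s_image \<phi> m t = frag_extend (\<lambda>u. frag_of (K1_scalar (\<phi> u))) (s_elem m t)"

end

theory Submission
  imports Defs "HOL-Library.Function_Algebras"
begin

text \<open>
  Let \<open>l = t / q\<close>. Write elements of the affine group as pairs \<open>(T, N)\<close>, and let \<open>\<psi>\<^sub>u (T, N) = (T, u N)\<close>
  for central \<open>u\<close>. Conjugation by the scalar matrix \<open>u\<^bsup>-l\<^esup>\<close>, which lifts the class of \<open>u\<^bsup>-t\<^esup>\<close>, is \<open>\<psi>\<close> at \<open>u\<^sup>l\<close>,
  so \<open>s\<close> acts on the homology of the affine group as the alternating sum of the maps induced by \<open>\<psi>\<close> at
  \<open>X\<^sub>J\<^sup>l\<close>, \<open>J \<noteq> \<emptyset>\<close>. On \<open>H\<^sub>r\<close> the operation \<open>u \<mapsto> \<psi>\<^sub>u\<close> is polynomial of degree at most \<open>r\<close>, because the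
  \<open>k\<close>-th cross effect of \<open>V \<mapsto> H\<^sub>r (V \<rtimes> S)\<close> vanishes for \<open>r < k\<close>; hence \<open>J \<mapsto> \<psi> (X\<^sub>J\<^sup>l)\<close> has degree at most
  \<open>r l < m\<close> and its alternating sum over all subsets \<open>J\<close> is zero. The term \<open>J = \<emptyset>\<close> is \<open>\<psi>\<^sub>0\<close>, the projection
  \<open>i \<circ> \<pi>\<close> onto the linear part. So \<open>s\<close> acts exactly as the idempotent \<open>i \<circ> \<pi>\<close>, and inverting it leaves
  the image of \<open>i\<close>.
\<close>

text \<open>Degrees are counted in the vanishing of the cross effect, which comes from a dimension
  shift. The pieces \<open>V\<^sub>b\<close> of \<open>V\<close> carry affine actions of
  \<open>V \<rtimes> S\<close>. Homology with coefficients in \<open>\<int>[V\<^sub>b]\<close> is,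
  by Shapiro's lemma, that of a stabilizer in which \<open>V\<^sub>b\<close> is absent, so killing
  \<open>V\<^sub>b\<close> acts on it as the identity and \<open>1 - proj {b}\<close> acts as zero.
  The sequence \<open>0 \<rightarrow> K\<^sub>b \<rightarrow> \<int>[V\<^sub>b] \<rightarrow> \<int>
  \<rightarrow> 0\<close> therefore trades one factor \<open>1 - proj {b}\<close> for one
  homological degree, the coefficients becoming \<open>K\<^sub>b\<close>, and more than
  \<open>r\<close> factors exhaust the degree. All of this is carried out on chains: an explicit
  homotopy replaces Shapiro's lemma, a lift and its boundary replace the connecting homomorphism,
  and tensor products of the \<open>K\<^sub>b\<close> are avoided by working in
  \<open>\<int>[V]\<close> and asking several augmentations to vanish at once.\<close>

type_synonym 'a K1_monoid = "(nat \<Rightarrow> nat \<Rightarrow> 'a) set monoid"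

abbreviation "keys \<equiv> Poly_Mapping.keys"
abbreviation "lookup \<equiv> Poly_Mapping.lookup"

section \<open>Bar complexes with coefficients in a permutation module\<close>

definition chain_map :: "('a \<Rightarrow> 'b) \<Rightarrow> ('a \<Rightarrow>\<^sub>0 int) \<Rightarrow> ('b \<Rightarrow>\<^sub>0 int)" where
  "chain_map f = frag_extend (\<lambda>x. frag_of (f x))"

lemma chain_map_of [simp]: "chain_map f (frag_of x) = frag_of (f x)"
  and chain_map_0 [simp]: "chain_map f 0 = 0"
  and chain_map_add: "chain_map f (a + b) = chain_map f a + chain_map f b"
  and chain_map_diff: "chain_map f (a - b) = chain_map f a - chain_map f b"
  and chain_map_minus: "chain_map f (- a) = - chain_map f a"
  and chain_map_cmul: "chain_map f (frag_cmul n a) = frag_cmul n (chain_map f a)"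
  by (simp_all add: chain_map_def frag_extend_add frag_extend_diff frag_extend_minus frag_extend_cmul)

lemma chain_map_sum: "chain_map f (sum g I) = (\<Sum>i\<in>I. chain_map f (g i))"
  by (induction I rule: infinite_finite_induct) (simp_all add: chain_map_add)

lemma keys_chain_map: "keys (chain_map f c) \<subseteq> f ` keys c"
  unfolding chain_map_def using keys_frag_extend[of "\<lambda>x. frag_of (f x)" c]
  by (auto simp: keys_frag_of)

text \<open>Basis elements generate all chains under subtraction, so compatibility with differences
  is enough, and it also gives the value at 0. Most chain identities below are reduced to basis
  elements in this way.\<close>

lemma frag_linear_eq:
  fixes F G :: "('a \<Rightarrow>\<^sub>0 int) \<Rightarrow> 'b::ab_group_add"
  assumes "keys c \<subseteq> S"
    and "\<And>a b. F (a - b) = F a - F b" and "\<And>a b. G (a - b) = G a - G b"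
    and "\<And>x. x \<in> S \<Longrightarrow> F (frag_of x) = G (frag_of x)"
  shows "F c = G c"
  using assms(1)
proof (induction c rule: frag_induction)
  case zero
  show ?case using assms(2)[of 0 0] assms(3)[of 0 0] by simp
qed (simp_all add: assms)

lemma chain_map_compose: "chain_map f (chain_map g c) = chain_map (\<lambda>x. f (g x)) c"
  by (rule frag_linear_eq[of c UNIV]) (simp_all add: chain_map_diff)

lemma chain_map_cong:
  "(\<And>x. x \<in> keys c \<Longrightarrow> f x = g x) \<Longrightarrow> chain_map f c = chain_map g c"
  unfolding chain_map_def by (rule frag_extend_eq) simp

lemma chain_map_id: "(\<And>x. x \<in> keys c \<Longrightarrow> f x = x) \<Longrightarrow> chain_map f c = c"
  using chain_map_cong[of c f "\<lambda>x. x"] frag_expansion[of c] by (simp add: chain_map_def)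

lemma keys_diff_subset:
  "keys a \<subseteq> S \<Longrightarrow> keys b \<subseteq> S \<Longrightarrow> keys (a - b) \<subseteq> S"
  using keys_diff[of a b] by blast

lemma keys_add_subset:
  "keys a \<subseteq> S \<Longrightarrow> keys b \<subseteq> S \<Longrightarrow> keys (a + b) \<subseteq> S"
  using Poly_Mapping.keys_add[of a b] by blast

lemma keys_frag_extend_subset:
  assumes "\<And>x. x \<in> keys c \<Longrightarrow> keys (f x) \<subseteq> S"
  shows "keys (frag_extend f c) \<subseteq> S"
  using keys_frag_extend[of f c] assms by blast

lemma keys_chain_map_subset:
  assumes "keys c \<subseteq> S" "f ` S \<subseteq> S'"
  shows "keys (chain_map f c) \<subseteq> S'"
  using keys_chain_map[of f c] assms by blast

text \<open>
  All faces of \<open>[g\<^sub>1|\<dots>|g\<^sub>r]\<close> except the first one, the sign being such that the bar boundary is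
  \<open>[g\<^sub>2|\<dots>|g\<^sub>r]\<close> minus this chain.
\<close>

fun inner_boundary :: "('g \<Rightarrow> 'g \<Rightarrow> 'g) \<Rightarrow> 'g list \<Rightarrow> ('g list \<Rightarrow>\<^sub>0 int)" where
  "inner_boundary m [] = 0"
| "inner_boundary m [g] = frag_of []"
| "inner_boundary m (g # h # gs) =
     frag_of (m g h # gs) - chain_map ((#) g) (inner_boundary m (h # gs))"

lemma keys_inner_boundary:
  assumes "\<And>g h. g \<in> C \<Longrightarrow> h \<in> C \<Longrightarrow> m g h \<in> C" and "set gs \<subseteq> C"
  shows "keys (inner_boundary m gs) \<subseteq> {hs. length hs = length gs - 1 \<and> set hs \<subseteq> C}"
  using assms(2)
proof (induction gs rule: induct_list012)
  case (3 g h gs)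
  have "keys (chain_map ((#) g) (inner_boundary m (h # gs)))
      \<subseteq> {hs. length hs = length (g # h # gs) - 1 \<and> set hs \<subseteq> C}"
    by (rule keys_chain_map_subset[OF "3.IH"(2)]) (use 3 in auto)
  then show ?case
    unfolding inner_boundary.simps
    by (intro keys_diff_subset) (use 3 assms(1) in \<open>auto simp: keys_frag_of\<close>)
qed (auto simp: keys_frag_of)

lemma inner_boundary_hom:
  assumes "\<And>g h. g \<in> C \<Longrightarrow> h \<in> C \<Longrightarrow> f (m g h) = m' (f g) (f h)" and "set gs \<subseteq> C"
  shows "inner_boundary m' (map f gs) = chain_map (map f) (inner_boundary m gs)"
  using assms(2)
  by (induction gs rule: induct_list012)
     (use assms(1) in \<open>auto simp: chain_map_diff chain_map_compose\<close>)

text \<open>Merging the first two entries commutes with all faces of the tail; associativity settles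
  the one face that involves all three leading entries.\<close>

lemma inner_boundary_merge:
  assumes "m g1 (m g2 g3) = m (m g1 g2) g3"
  shows "inner_boundary m (m g1 g2 # g3 # gs) =
    chain_map (\<lambda>l. m g1 (hd l) # tl l) (inner_boundary m (g2 # g3 # gs))"
  using assms by (simp add: chain_map_diff chain_map_compose)

text \<open>The recursion of \<open>inner_boundary\<close> for a whole chain of tails:
  \<open>hd\<close> and \<open>tl\<close> merge \<open>g\<close> into the first entry, which exists
  by the assumption on \<open>c\<close>.\<close>

lemma inner_boundary_Cons:
  assumes "keys c \<subseteq> {l. l \<noteq> []}"
  shows "frag_extend (inner_boundary m) (chain_map ((#) g) c) =
    chain_map (\<lambda>l. m g (hd l) # tl l) c - chain_map ((#) g) (frag_extend (inner_boundary m) c)"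
  by (rule frag_linear_eq[OF assms])
     (auto simp: chain_map_diff frag_extend_diff neq_Nil_conv)

text \<open>Merging \<open>g\<close> into the front of \<open>inner_boundary m (h # gs)\<close>
  occurs twice with opposite signs, once through \<open>inner_boundary_merge\<close> and once
  through \<open>inner_boundary_Cons\<close>. What remains is the induction hypothesis.\<close>

lemma inner_boundary_inner_boundary:
  assumes assoc: "\<And>g h k. g \<in> C \<Longrightarrow> h \<in> C \<Longrightarrow> k \<in> C \<Longrightarrow> m g (m h k) = m (m g h) k"
    and closed: "\<And>g h. g \<in> C \<Longrightarrow> h \<in> C \<Longrightarrow> m g h \<in> C"
    and "set gs \<subseteq> C"
  shows "frag_extend (inner_boundary m) (inner_boundary m gs) = 0"
  using assms(3)
proof (induction gs rule: induct_list012)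
  case (3 g h gs)
  show ?case
  proof (cases gs)
    case Nil
    then show ?thesis by (simp add: frag_extend_diff)
  next
    case (Cons k t)
    have "keys (inner_boundary m (h # gs)) \<subseteq> {l. l \<noteq> []}"
      using keys_inner_boundary[of C m "h # gs", OF closed] 3 Cons by auto
    from inner_boundary_Cons[OF this, of m g] inner_boundary_merge[of m g h k t] assoc 3 Cons
    show ?thesis
      by (simp add: frag_extend_diff del: inner_boundary.simps)
         (simp add: frag_extend_diff)
  qed
qed simp_all

text \<open>The bar complex with coefficients in the permutation module of a right action, that is,
  chains on the nerve of the action groupoid: \<open>(x, gs)\<close> is the path that starts at
  \<open>x\<close>, and dropping its first step moves the start to \<open>act x g\<close>.\<close>

definition act_boundary ::
    "('g \<Rightarrow> 'g \<Rightarrow> 'g) \<Rightarrow> ('x \<Rightarrow> 'g \<Rightarrow> 'x) \<Rightarrow> ('x \<times> 'g list \<Rightarrow>\<^sub>0 int) \<Rightarrow> ('x \<times> 'g list \<Rightarrow>\<^sub>0 int)" where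
  "act_boundary m act = frag_extend (\<lambda>(x, gs). case gs of [] \<Rightarrow> 0
     | g # hs \<Rightarrow> frag_of (act x g, hs) - chain_map (Pair x) (inner_boundary m gs))"

lemma act_boundary_Nil [simp]: "act_boundary m act (frag_of (x, [])) = 0"
  and act_boundary_of_Cons: "act_boundary m act (frag_of (x, g # gs)) =
    frag_of (act x g, gs) - chain_map (Pair x) (inner_boundary m (g # gs))"
  and act_boundary_diff: "act_boundary m act (a - b) = act_boundary m act a - act_boundary m act b"
  and act_boundary_0 [simp]: "act_boundary m act 0 = 0"
  by (simp_all add: act_boundary_def frag_extend_diff)

lemma act_boundary_Cons:
  "act_boundary m act (chain_map (Pair x) (chain_map ((#) g) c)) =
     chain_map (Pair (act x g)) c
     - chain_map (Pair x) (frag_extend (inner_boundary m) (chain_map ((#) g) c))"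
  by (rule frag_linear_eq[of c UNIV])
     (simp_all add: chain_map_diff frag_extend_diff act_boundary_diff act_boundary_of_Cons)

definition act_chains :: "'g set \<Rightarrow> nat \<Rightarrow> ('x \<times> 'g list \<Rightarrow>\<^sub>0 int) set" where
  "act_chains C r = {c. keys c \<subseteq> UNIV \<times> {gs. length gs = r \<and> set gs \<subseteq> C}}"

lemma act_chains_diff: "a \<in> act_chains C r \<Longrightarrow> b \<in> act_chains C r \<Longrightarrow> a - b \<in> act_chains C r"
  unfolding act_chains_def using keys_diff_subset by blast

lemma act_chains_0 [simp]: "0 \<in> act_chains C r"
  by (simp add: act_chains_def)

lemma act_chainsD: "c \<in> act_chains C r \<Longrightarrow> keys c \<subseteq> UNIV \<times> {gs. set gs \<subseteq> C}"
  unfolding act_chains_def by blast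

lemma act_chains_minus: "a \<in> act_chains C r \<Longrightarrow> - a \<in> act_chains C r"
  by (simp add: act_chains_def)

lemma act_chains_map:
  fixes c :: "'x \<times> 'g list \<Rightarrow>\<^sub>0 int" and f :: "'x \<times> 'g list \<Rightarrow> 'y \<times> 'h list"
  assumes "c \<in> act_chains C r" "\<And>x gs. length gs = r \<Longrightarrow> set gs \<subseteq> C \<Longrightarrow>
    length (snd (f (x, gs))) = s \<and> set (snd (f (x, gs))) \<subseteq> C'"
  shows "chain_map f c \<in> act_chains C' s"
  unfolding act_chains_def mem_Collect_eq
proof (rule keys_chain_map_subset)
  show "keys c \<subseteq> UNIV \<times> {gs. length gs = r \<and> set gs \<subseteq> C}"
    using assms(1) by (simp add: act_chains_def)
  show "f ` (UNIV \<times> {gs. length gs = r \<and> set gs \<subseteq> C}) \<subseteq> UNIV \<times> {gs. length gs = s \<and> set gs \<subseteq> C'}"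
  proof (rule image_subsetI)
    fix y :: "'x \<times> 'g list" assume "y \<in> UNIV \<times> {gs. length gs = r \<and> set gs \<subseteq> C}"
    then have "length (snd (f y)) = s \<and> set (snd (f y)) \<subseteq> C'"
      using assms(2)[of "snd y" "fst y"] by (simp add: mem_Times_iff)
    then show "f y \<in> UNIV \<times> {gs. length gs = s \<and> set gs \<subseteq> C'}"
      by (simp add: mem_Times_iff)
  qed
qed

lemma act_boundary_in_chains:
  assumes closed: "\<And>g h. g \<in> C \<Longrightarrow> h \<in> C \<Longrightarrow> m g h \<in> C" and c: "c \<in> act_chains C (Suc r)"
  shows "act_boundary m act c \<in> act_chains C r"
  unfolding act_boundary_def act_chains_def mem_Collect_eq
proof (rule keys_frag_extend_subset)
  fix y assume "y \<in> keys c"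
  then obtain x g gs where y: "y = (x, g # gs)" "length gs = r" "set (g # gs) \<subseteq> C"
    using c unfolding act_chains_def by (auto simp: length_Suc_conv)
  have "keys (chain_map (Pair x) (inner_boundary m (g # gs)))
      \<subseteq> UNIV \<times> {hs. length hs = r \<and> set hs \<subseteq> C}"
    by (rule keys_chain_map_subset[OF keys_inner_boundary[OF closed y(3)]]) (use y in auto)
  then show "keys (case y of (x, gs) \<Rightarrow> (case gs of [] \<Rightarrow> 0
       | g # hs \<Rightarrow> frag_of (act x g, hs) - chain_map (Pair x) (inner_boundary m gs)))
     \<subseteq> UNIV \<times> {hs. length hs = r \<and> set hs \<subseteq> C}"
    using y by (simp del: inner_boundary.simps)
      (intro keys_diff_subset, auto simp: keys_frag_of)
qed

lemma act_boundary_degree_0: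
  assumes "c \<in> act_chains C 0"
  shows "act_boundary m act c = 0"
  unfolding act_boundary_def
  by (rule frag_extend_eq_0) (use assms in \<open>auto simp: act_chains_def\<close>)

lemma act_boundary_act_boundary:
  fixes act :: "'b \<Rightarrow> 'a \<Rightarrow> 'b"
  assumes assoc: "\<And>g h k. g \<in> C \<Longrightarrow> h \<in> C \<Longrightarrow> k \<in> C \<Longrightarrow> m g (m h k) = m (m g h) k"
    and closed: "\<And>g h. g \<in> C \<Longrightarrow> h \<in> C \<Longrightarrow> m g h \<in> C"
    and act: "\<And>x g h. g \<in> C \<Longrightarrow> h \<in> C \<Longrightarrow> act x (m g h) = act (act x g) h"
    and c: "c \<in> act_chains C r"
  shows "act_boundary m act (act_boundary m act c) = 0"
proof (rule frag_linear_eq[of c "UNIV \<times> {gs. set gs \<subseteq> C}"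
    "\<lambda>c. act_boundary m act (act_boundary m act c)" "\<lambda>_. 0"])
  show "keys c \<subseteq> UNIV \<times> {gs. set gs \<subseteq> C}"
    using c by (auto simp: act_chains_def)
next
  fix y :: "'b \<times> 'a list" assume "y \<in> UNIV \<times> {gs. set gs \<subseteq> C}"
  then obtain x gs where y: "y = (x, gs)" "set gs \<subseteq> C" by blast
  consider "gs = []" | g where "gs = [g]" | g h t where "gs = g # h # t"
    by (cases gs rule: remdups_adj.cases) auto
  then show "act_boundary m act (act_boundary m act (frag_of y)) = 0"
  proof cases
    case (2 g)
    then show ?thesis by (simp add: y act_boundary_of_Cons act_boundary_diff)
  next
    case (3 g h t)
    have "frag_extend (inner_boundary m) (inner_boundary m (g # h # t)) = 0"
      by (rule inner_boundary_inner_boundary[OF assoc closed]) (use y 3 in auto)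
    \<comment> \<open>This solves the vanishing of the double inner boundary for the merged list;
      the terms with a moved point then cancel because \<open>act\<close> is an action.\<close>
    then have eq: "chain_map (Pair x) (inner_boundary m (m g h # t)) =
        chain_map (Pair x) (frag_extend (inner_boundary m) (chain_map ((#) g) (inner_boundary m (h # t))))"
      by (simp add: frag_extend_diff)
    have "act x (m g h) = act (act x g) h"
      using act y 3 by simp
    then show ?thesis
      unfolding y 3
      by (simp add: act_boundary_of_Cons act_boundary_diff act_boundary_Cons chain_map_diff eq)
  qed (simp add: y)
qed (simp_all add: act_boundary_diff)

text \<open>The map \<open>\<phi>\<close> on points is equivariant along the homomorphism
  \<open>f\<close>. Functoriality of the bar complex and the compatibility of \<open>forget\<close>
  and \<open>proj\<close> with boundaries are all instances.\<close>

lemma act_boundary_natural: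
  assumes hom: "\<And>g h. g \<in> C \<Longrightarrow> h \<in> C \<Longrightarrow> f (m g h) = m' (f g) (f h)"
    and equiv: "\<And>x g. x \<in> X \<Longrightarrow> g \<in> C \<Longrightarrow> \<phi> (act x g) = act' (\<phi> x) (f g)"
    and c: "keys c \<subseteq> X \<times> {gs. set gs \<subseteq> C}"
  shows "act_boundary m' act' (chain_map (map_prod \<phi> (map f)) c) =
    chain_map (map_prod \<phi> (map f)) (act_boundary m act c)"
proof (rule frag_linear_eq[OF c,
      of "\<lambda>c. act_boundary m' act' (chain_map (map_prod \<phi> (map f)) c)"
        "\<lambda>c. chain_map (map_prod \<phi> (map f)) (act_boundary m act c)"])
  fix y assume "y \<in> X \<times> {gs. set gs \<subseteq> C}"
  then obtain x gs where y: "y = (x, gs)" "x \<in> X" "set gs \<subseteq> C" by blast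
  show "act_boundary m' act' (chain_map (map_prod \<phi> (map f)) (frag_of y)) =
    chain_map (map_prod \<phi> (map f)) (act_boundary m act (frag_of y))"
  proof (cases gs)
    case (Cons g hs)
    have "inner_boundary m' (map f (g # hs)) = chain_map (map f) (inner_boundary m (g # hs))"
      by (rule inner_boundary_hom[where C = C]) (use hom y Cons in auto)
    then have I: "inner_boundary m' (f g # map f hs) = chain_map (map f) (inner_boundary m (g # hs))"
      by simp
    have "\<phi> (act x g) = act' (\<phi> x) (f g)"
      using equiv y Cons by simp
    then show ?thesis
      unfolding y Cons
      by (simp only: chain_map_of map_prod_simp list.map(2) act_boundary_of_Cons chain_map_diff
          chain_map_compose I)
  qed (simp add: y)
qed (simp_all add: chain_map_diff act_boundary_diff)

text \<open>
  The paths \<open>x, xg\<^sub>1, xg\<^sub>1g\<^sub>2, \<dots>\<close> are mapped by \<open>f\<close> to paths starting from \<open>x \<tau> x\<close>, and \<open>\<tau>\<close> is a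
  natural transformation between the two.
\<close>

fun prism_list :: "('x \<Rightarrow> 'g \<Rightarrow> 'x) \<Rightarrow> ('x \<Rightarrow> 'g) \<Rightarrow> ('g \<Rightarrow> 'g) \<Rightarrow> 'x \<Rightarrow> 'g list \<Rightarrow> ('g list \<Rightarrow>\<^sub>0 int)" where
  "prism_list act \<tau> f x [] = frag_of [\<tau> x]"
| "prism_list act \<tau> f x (g # gs) =
     frag_of (\<tau> x # f g # map f gs) - chain_map ((#) g) (prism_list act \<tau> f (act x g) gs)"

lemma keys_prism_list:
  assumes "\<And>x. \<tau> x \<in> C" "f ` C \<subseteq> C" "set gs \<subseteq> C"
  shows "keys (prism_list act \<tau> f x gs)
    \<subseteq> {hs. length hs = Suc (length gs) \<and> set hs \<subseteq> C}"
  using assms(3)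
proof (induction gs arbitrary: x)
  case (Cons g gs)
  have "keys (chain_map ((#) g) (prism_list act \<tau> f (act x g) gs))
      \<subseteq> {hs. length hs = Suc (length (g # gs)) \<and> set hs \<subseteq> C}"
    by (rule keys_chain_map_subset[OF Cons.IH]) (use Cons in auto)
  then show ?case
    unfolding prism_list.simps
    by (intro keys_diff_subset) (use Cons assms in \<open>auto simp: keys_frag_of image_subset_iff\<close>)
qed (use assms in \<open>auto simp: keys_frag_of\<close>)

lemma frag_extend_prism_list_Cons:
  "frag_extend (prism_list act \<tau> f x) (chain_map ((#) g) c) =
     chain_map (\<lambda>l. \<tau> x # f g # map f l) c
     - chain_map ((#) g) (frag_extend (prism_list act \<tau> f (act x g)) c)"
  by (rule frag_linear_eq[of c UNIV]) (simp_all add: chain_map_diff frag_extend_diff)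

text \<open>The homotopy between the identity and \<open>f\<close> with all first faces left out, so
  only one end appears on the right. The hypothesis \<open>nat\<close> is the naturality square of
  \<open>\<tau>\<close>: it identifies the face shared by two consecutive simplices of the
  prism.\<close>

lemma prism_list_homotopy:
  assumes closed: "\<And>g h. g \<in> C \<Longrightarrow> h \<in> C \<Longrightarrow> m g h \<in> C"
    and hom: "\<And>g h. g \<in> C \<Longrightarrow> h \<in> C \<Longrightarrow> f (m g h) = m (f g) (f h)"
    and act: "\<And>x g h. g \<in> C \<Longrightarrow> h \<in> C \<Longrightarrow> act x (m g h) = act (act x g) h"
    and nat: "\<And>x g. g \<in> C \<Longrightarrow> m g (\<tau> (act x g)) = m (\<tau> x) (f g)"
    and "set gs \<subseteq> C"
  shows "frag_extend (inner_boundary m) (prism_list act \<tau> f x gs)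
    + frag_extend (prism_list act \<tau> f x) (inner_boundary m gs) = frag_of gs"
  using assms(5)
proof (induction gs arbitrary: x rule: induct_list012)
  case (2 g)
  then show ?case
    using nat[of g x] by (simp add: frag_extend_diff)
next
  case (3 g h t)
  let ?P = "prism_list act \<tau> f" and ?I = "inner_boundary m"
  have hom_gs: "?I (map f (g # h # t)) = chain_map (map f) (?I (g # h # t))"
    by (rule inner_boundary_hom[where C = C]) (use hom 3 in auto)
  have "\<tau> y # zs \<noteq> []" for y zs by simp
  have ne: "keys (?P y zs) \<subseteq> {l. l \<noteq> []}" for y zs
  proof (cases zs)
    case (Cons a list)
    then show ?thesis
      unfolding prism_list.simps Cons
      by (intro keys_diff_subset) (auto simp: keys_frag_of dest!: subsetD[OF keys_chain_map])
  qed (simp add: keys_frag_of)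
  \<comment> \<open>Four expansions at the front of the list. By B the merged face in A cancels and
    leaves a term that cancels in C, D removes the terms starting with \<open>\<tau> x\<close>, and
    the rest is the induction hypothesis with \<open>g\<close> put in front.\<close>
  have A: "frag_extend ?I (?P x (g # h # t)) =
      frag_of (m (\<tau> x) (f g) # f h # map f t) - chain_map ((#) (\<tau> x)) (?I (map f (g # h # t)))
      - (chain_map (\<lambda>l. m g (hd l) # tl l) (?P (act x g) (h # t))
         - chain_map ((#) g) (frag_extend ?I (?P (act x g) (h # t))))"
    using inner_boundary_Cons[OF ne, of m g "act x g" "h # t"]
    by (simp add: frag_extend_diff del: prism_list.simps(2)
        add: prism_list.simps(2)[of act \<tau> f x g "h # t"])
  have B: "chain_map (\<lambda>l. m g (hd l) # tl l) (?P (act x g) (h # t)) =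
      frag_of (m (\<tau> x) (f g) # f h # map f t) - chain_map ((#) (m g h)) (?P (act x (m g h)) t)"
    using nat[of g x] act[of g h x] 3 by (simp add: chain_map_diff chain_map_compose)
  have C: "frag_extend (?P x) (?I (g # h # t)) =
      frag_of (\<tau> x # f (m g h) # map f t) - chain_map ((#) (m g h)) (?P (act x (m g h)) t)
      - (chain_map (\<lambda>l. \<tau> x # f g # map f l) (?I (h # t))
         - chain_map ((#) g) (frag_extend (?P (act x g)) (?I (h # t))))"
    by (simp add: frag_extend_diff frag_extend_prism_list_Cons)
  have D: "chain_map ((#) (\<tau> x)) (?I (map f (g # h # t))) =
      frag_of (\<tau> x # f (m g h) # map f t) - chain_map (\<lambda>l. \<tau> x # f g # map f l) (?I (h # t))"
    unfolding hom_gs by (simp add: chain_map_diff chain_map_compose)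
  have IH: "chain_map ((#) g) (frag_extend ?I (?P (act x g) (h # t)))
      + chain_map ((#) g) (frag_extend (?P (act x g)) (?I (h # t))) = frag_of (g # h # t)"
    using "3.IH"(2)[of "act x g"] 3(3) by (simp flip: chain_map_add)
  show ?case
    unfolding A B C D IH[symmetric] by simp
qed simp

definition prism :: "('x \<Rightarrow> 'g \<Rightarrow> 'x) \<Rightarrow> ('x \<Rightarrow> 'g) \<Rightarrow> ('g \<Rightarrow> 'g) \<Rightarrow> ('x \<times> 'g list \<Rightarrow>\<^sub>0 int) \<Rightarrow> ('x \<times> 'g list \<Rightarrow>\<^sub>0 int)" where
  "prism act \<tau> f = frag_extend (\<lambda>(x, gs). chain_map (Pair x) (prism_list act \<tau> f x gs))"

lemma prism_diff: "prism act \<tau> f (a - b) = prism act \<tau> f a - prism act \<tau> f b"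
  and prism_0 [simp]: "prism act \<tau> f 0 = 0"
  and prism_of: "prism act \<tau> f (frag_of (x, gs)) = chain_map (Pair x) (prism_list act \<tau> f x gs)"
  by (simp_all add: prism_def frag_extend_diff)

lemma prism_Pair: "prism act \<tau> f (chain_map (Pair x) c) = chain_map (Pair x) (frag_extend (prism_list act \<tau> f x) c)"
  by (rule frag_linear_eq[of c UNIV]) (simp_all add: chain_map_diff frag_extend_diff prism_diff prism_of)

lemma prism_in_chains:
  assumes "\<And>x. \<tau> x \<in> C" "f ` C \<subseteq> C" "c \<in> act_chains C r"
  shows "prism act \<tau> f c \<in> act_chains C (Suc r)"
  unfolding prism_def act_chains_def mem_Collect_eq
proof (rule keys_frag_extend_subset)
  fix y assume "y \<in> keys c"
  then obtain x gs where y: "y = (x, gs)" "length gs = r" "set gs \<subseteq> C"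
    using assms(3) unfolding act_chains_def by auto
  show "keys (case y of (x, gs) \<Rightarrow> chain_map (Pair x) (prism_list act \<tau> f x gs))
     \<subseteq> UNIV \<times> {gs. length gs = Suc r \<and> set gs \<subseteq> C}"
    unfolding y prod.case
    by (rule keys_chain_map_subset[OF keys_prism_list[OF assms(1,2) y(3)]]) (use y in auto)
qed

text \<open>First faces are added to \<open>prism_list_homotopy\<close>: that of the leading simplex
  is the path carried over by \<open>\<tau>\<close> and \<open>f\<close>, and those of the other
  simplices form the prism over the first face, which cancels.\<close>

lemma prism_homotopy:
  fixes c :: "'x \<times> 'g list \<Rightarrow>\<^sub>0 int"
  assumes closed: "\<And>g h. g \<in> C \<Longrightarrow> h \<in> C \<Longrightarrow> m g h \<in> C"
    and hom: "\<And>g h. g \<in> C \<Longrightarrow> h \<in> C \<Longrightarrow> f (m g h) = m (f g) (f h)"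
    and act: "\<And>x g h. g \<in> C \<Longrightarrow> h \<in> C \<Longrightarrow> act x (m g h) = act (act x g) h"
    and nat: "\<And>x g. g \<in> C \<Longrightarrow> m g (\<tau> (act x g)) = m (\<tau> x) (f g)"
    and c: "c \<in> act_chains C r"
  shows "act_boundary m act (prism act \<tau> f c) + prism act \<tau> f (act_boundary m act c) =
    chain_map (\<lambda>(x, gs). (act x (\<tau> x), map f gs)) c - c"
proof (rule frag_linear_eq[of c "UNIV \<times> {gs. set gs \<subseteq> C}"
    "\<lambda>c. act_boundary m act (prism act \<tau> f c) + prism act \<tau> f (act_boundary m act c)"
    "\<lambda>c. chain_map (\<lambda>(x, gs). (act x (\<tau> x), map f gs)) c - c"])
  show "keys c \<subseteq> UNIV \<times> {gs. set gs \<subseteq> C}"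
    using c by (auto simp: act_chains_def)
next
  fix y :: "'x \<times> 'g list" assume "y \<in> UNIV \<times> {gs. set gs \<subseteq> C}"
  then obtain x gs where y: "y = (x, gs)" "set gs \<subseteq> C" by blast
  let ?P = "prism_list act \<tau> f" and ?I = "inner_boundary m"
  have homot: "frag_extend ?I (?P x gs) + frag_extend (?P x) (?I gs) = frag_of gs"
    by (rule prism_list_homotopy[OF closed hom act nat y(2)])
  show "act_boundary m act (prism act \<tau> f (frag_of y)) + prism act \<tau> f (act_boundary m act (frag_of y)) =
    chain_map (\<lambda>(x, gs). (act x (\<tau> x), map f gs)) (frag_of y) - frag_of y"
  proof (cases gs)
    case Nil
    then show ?thesis
      by (simp add: y prism_of act_boundary_of_Cons)
  next
    case (Cons g hs)
    have "act_boundary m act (prism act \<tau> f (frag_of y)) =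
        frag_of (act x (\<tau> x), map f (g # hs)) - chain_map (Pair (act x g)) (?P (act x g) hs)
        - chain_map (Pair x) (frag_extend ?I (?P x (g # hs)))"
      by (simp add: y Cons prism_of chain_map_diff frag_extend_diff act_boundary_diff act_boundary_Cons
          act_boundary_of_Cons)
    moreover have "prism act \<tau> f (act_boundary m act (frag_of y)) =
        chain_map (Pair (act x g)) (?P (act x g) hs) - chain_map (Pair x) (frag_extend (?P x) (?I (g # hs)))"
      by (simp only: y Cons act_boundary_of_Cons prism_diff prism_of prism_Pair)
    ultimately have "act_boundary m act (prism act \<tau> f (frag_of y)) + prism act \<tau> f (act_boundary m act (frag_of y)) =
        frag_of (act x (\<tau> x), map f (g # hs))
        - chain_map (Pair x) (frag_extend ?I (?P x (g # hs)) + frag_extend (?P x) (?I (g # hs)))"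
      by (simp only: chain_map_add) (simp only: algebra_simps)
    then show ?thesis
      using homot by (simp only: Cons y chain_map_of) simp
  qed
qed (simp_all add: chain_map_diff prism_diff act_boundary_diff)

text \<open>The bar complex of a group is the case of a one-point set.\<close>

lemma bar_face_Cons: "i \<ge> 1 \<Longrightarrow> bar_face G (g # gs) (Suc i) = g # bar_face G gs i"
  by (cases i) (simp_all add: bar_face_def)

text \<open>Links the recursion, which suits induction, to the alternating sum in
  \<open>bar_boundary\<close>; putting an entry in front shifts the face index by one and flips the
  sign.\<close>

lemma inner_boundary_alternating:
  "inner_boundary (mult G) (g # gs) =
    - (\<Sum>i = 1..<length (g # gs). frag_cmul ((-1) ^ i) (frag_of (bar_face G (g # gs) i)))
    - frag_cmul ((-1) ^ length (g # gs)) (frag_of (butlast (g # gs)))"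
proof (induction gs arbitrary: g)
  case (Cons h gs)
  have "(\<Sum>i = 1..<length (g # h # gs). frag_cmul ((-1) ^ i) (frag_of (bar_face G (g # h # gs) i))) =
      - frag_of (bar_face G (g # h # gs) 1)
      + (\<Sum>i = 1..<length (h # gs). frag_cmul ((-1) ^ Suc i) (frag_of (bar_face G (g # h # gs) (Suc i))))"
    by (simp add: sum.atLeast_Suc_lessThan sum.shift_bounds_Suc_ivl del: sum.op_ivl_Suc)
  also have "(\<Sum>i = 1..<length (h # gs). frag_cmul ((-1) ^ Suc i) (frag_of (bar_face G (g # h # gs) (Suc i)))) =
      - chain_map ((#) g) (\<Sum>i = 1..<length (h # gs). frag_cmul ((-1) ^ i) (frag_of (bar_face G (h # gs) i)))"
    unfolding chain_map_sum sum_negf[symmetric]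
    by (rule sum.cong) (simp_all add: chain_map_cmul bar_face_Cons)
  finally show ?case
    by (simp add: Cons.IH chain_map_minus chain_map_diff chain_map_cmul bar_face_def del: sum.op_ivl_Suc)
qed simp

text \<open>\<open>snd\<close> is the augmentation of the coefficients. The action enters the
  boundary only through the component that is dropped here.\<close>

lemma bar_boundary_snd:
  fixes c :: "'x \<times> 'g list \<Rightarrow>\<^sub>0 int"
  shows "bar_boundary G (chain_map snd c) = chain_map snd (act_boundary (mult G) act c)"
proof (rule frag_linear_eq[of c UNIV "\<lambda>c. bar_boundary G (chain_map snd c)"
      "\<lambda>c. chain_map snd (act_boundary (mult G) act c)"])
  fix y :: "'x \<times> 'g list"
  obtain x gs where y: "y = (x, gs)" by fastforce
  show "bar_boundary G (chain_map snd (frag_of y)) = chain_map snd (act_boundary (mult G) act (frag_of y))"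
  proof (cases gs)
    case Nil
    then show ?thesis by (simp add: y bar_boundary_def)
  next
    case (Cons g hs)
    show ?thesis
      unfolding y Cons
      by (simp only: act_boundary_of_Cons chain_map_of chain_map_diff chain_map_compose snd_conv
           inner_boundary_alternating)
         (simp add: bar_boundary_def chain_map_id del: sum.op_ivl_Suc)
  qed
qed (simp_all add: chain_map_diff bar_boundary_def frag_extend_diff act_boundary_diff)

lemma bar_boundary_diff: "bar_boundary G (a - b) = bar_boundary G a - bar_boundary G b"
  and bar_boundary_add: "bar_boundary G (a + b) = bar_boundary G a + bar_boundary G b"
  and bar_boundary_0 [simp]: "bar_boundary G 0 = 0"
  and bar_boundary_minus: "bar_boundary G (- a) = - bar_boundary G a"
  and bar_boundary_cmul: "bar_boundary G (frag_cmul n a) = frag_cmul n (bar_boundary G a)"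
  by (simp_all add: bar_boundary_def frag_extend_diff frag_extend_add frag_extend_minus frag_extend_cmul)

text \<open>A fixed point spans a trivial coefficient module; ordinary chains enter the complexes
  with coefficients in this way.\<close>

lemma act_boundary_Pair:
  assumes "\<And>g. g \<in> C \<Longrightarrow> act x g = x" and "keys c \<subseteq> {gs. set gs \<subseteq> C}"
  shows "act_boundary (mult G) act (chain_map (Pair x) c) = chain_map (Pair x) (bar_boundary G c)"
proof (rule frag_linear_eq[OF assms(2),
      of "\<lambda>c. act_boundary (mult G) act (chain_map (Pair x) c)"
        "\<lambda>c. chain_map (Pair x) (bar_boundary G c)"])
  fix gs assume "gs \<in> {gs. set gs \<subseteq> C}"
  have "bar_boundary G (frag_of gs) = chain_map snd (act_boundary (mult G) act (frag_of (x, gs)))"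
    using bar_boundary_snd[of G "frag_of (x, gs)"] by simp
  moreover have "chain_map (Pair x) (chain_map snd (act_boundary (mult G) act (frag_of (x, gs)))) =
      act_boundary (mult G) act (frag_of (x, gs))"
  proof (cases gs)
    case (Cons g hs)
    then show ?thesis
      using \<open>gs \<in> _\<close> assms(1)
      by (simp del: inner_boundary.simps add: act_boundary_of_Cons chain_map_diff chain_map_compose)
  qed simp
  ultimately show "act_boundary (mult G) act (chain_map (Pair x) (frag_of gs)) = chain_map (Pair x) (bar_boundary G (frag_of gs))"
    by simp
qed (simp_all add: chain_map_diff bar_boundary_diff act_boundary_diff)

section \<open>Cross effects of the homology of a semidirect product\<close>

lemma sum_Pow_insert:
  assumes "finite B" "b \<notin> B"
  shows "sum f (Pow (insert b B)) = sum f (Pow B) + (\<Sum>J\<in>Pow B. f (insert b J))"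
proof -
  have "inj_on (insert b) (Pow B)"
    using assms(2) unfolding inj_on_def by (auto simp: set_eq_iff)
  moreover have "Pow B \<inter> insert b ` Pow B = {}"
    using assms(2) by auto
  ultimately show ?thesis
    unfolding Pow_insert using assms(1) by (simp add: sum.union_disjoint sum.reindex)
qed

text \<open>The \<open>Pi i\<close> are orthogonal equivariant idempotents that cut out the pieces
  of the translation module. The action is on the right so that the product below matches the lower
  left block \<open>N * T' + N'\<close> of a product of affine matrices.\<close>

locale semidirect =
  fixes S :: "('s, 'c) monoid_scheme" (structure)
    and act :: "'v::ab_group_add \<Rightarrow> 's \<Rightarrow> 'v"
    and Pi :: "'i \<Rightarrow> 'v \<Rightarrow> 'v"
  assumes monoid_S: "monoid S"
    and act_add: "s \<in> carrier S \<Longrightarrow> act (v + w) s = act v s + act w s"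
    and act_mult: "s \<in> carrier S \<Longrightarrow> s' \<in> carrier S \<Longrightarrow> act v (s \<otimes> s') = act (act v s) s'"
    and act_one: "act v \<one> = v"
    and Pi_add: "Pi i (v + w) = Pi i v + Pi i w"
    and Pi_Pi: "Pi i (Pi j v) = (if i = j then Pi j v else 0)"
    and Pi_act: "s \<in> carrier S \<Longrightarrow> Pi i (act v s) = act (Pi i v) s"
begin

interpretation S: monoid S by (rule monoid_S)

definition semidirect_product :: "('s \<times> 'v) monoid" where
  "semidirect_product = \<lparr>carrier = carrier S \<times> UNIV,
     mult = (\<lambda>(s, v) (s', v'). (s \<otimes> s', act v s' + v')), one = (\<one>, 0)\<rparr>"

abbreviation (input) "C \<equiv> carrier semidirect_product"
abbreviation (input) "m \<equiv> mult semidirect_product"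

definition Pis :: "'i set \<Rightarrow> 'v \<Rightarrow> 'v" where "Pis A v = (\<Sum>i\<in>A. Pi i v)"

definition kill :: "'i set \<Rightarrow> 'v \<Rightarrow> 'v" where "kill A v = v - Pis A v"

text \<open>Translations move only the coordinates in \<open>A\<close>. All of \<open>V\<close> is
  the set of points for every \<open>A\<close>, so enlarging \<open>A\<close> changes the boundary
  operator but not the chains.\<close>

definition affine :: "'i set \<Rightarrow> 'v \<Rightarrow> 's \<times> 'v \<Rightarrow> 'v" where
  "affine A x g = act x (fst g) + Pis A (snd g)"

definition kill_group :: "'i set \<Rightarrow> 's \<times> 'v \<Rightarrow> 's \<times> 'v" where
  "kill_group A g = (fst g, kill A (snd g))"

text \<open>The augmentation in coordinate \<open>i\<close>: chains with
  \<open>forget i c = 0\<close> have coefficients in its kernel, chains with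
  \<open>forget i c = c\<close> have no coordinate \<open>i\<close>. Writing \<open>map id\<close>
  makes it an instance of \<open>act_boundary_natural\<close>.\<close>

definition forget :: "'i \<Rightarrow> ('v \<times> ('s \<times> 'v) list \<Rightarrow>\<^sub>0 int) \<Rightarrow> ('v \<times> ('s \<times> 'v) list \<Rightarrow>\<^sub>0 int)" where
  "forget i = chain_map (map_prod (kill {i}) (map id))"

definition proj :: "'i set \<Rightarrow> ('v \<times> ('s \<times> 'v) list \<Rightarrow>\<^sub>0 int) \<Rightarrow> ('v \<times> ('s \<times> 'v) list \<Rightarrow>\<^sub>0 int)" where
  "proj J = chain_map (map_prod (kill J) (map (kill_group J)))"

text \<open>The product of the operators \<open>1 - proj {b}\<close> for \<open>b \<in> B\<close>,
  multiplied out; \<open>cross_insert\<close> recovers the factors.\<close>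

definition cross :: "'i set \<Rightarrow> ('v \<times> ('s \<times> 'v) list \<Rightarrow>\<^sub>0 int) \<Rightarrow> ('v \<times> ('s \<times> 'v) list \<Rightarrow>\<^sub>0 int)" where
  "cross B z = (\<Sum>J\<in>Pow B. frag_cmul ((-1) ^ card J) (proj J z))"

abbreviation "bd A \<equiv> act_boundary m (affine A)"

lemma mult_def': "m g h = (fst g \<otimes> fst h, act (snd g) (fst h) + snd h)"
  by (simp add: semidirect_product_def case_prod_unfold)

lemma C_iff: "g \<in> C \<longleftrightarrow> fst g \<in> carrier S"
  by (auto simp: semidirect_product_def mem_Times_iff)

lemma Pi_0 [simp]: "Pi i 0 = 0"
  using Pi_add[of i 0 0] by simp

lemma Pi_minus: "Pi i (- v) = - Pi i v"
  using Pi_add[of i v "- v"] by (simp add: eq_neg_iff_add_eq_0 add.commute)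

lemma Pi_diff: "Pi i (v - w) = Pi i v - Pi i w"
  using Pi_add[of i v "- w"] by (simp add: Pi_minus)

lemma act_0: "s \<in> carrier S \<Longrightarrow> act 0 s = 0"
  using act_add[of s 0 0] by simp

lemma act_minus: "s \<in> carrier S \<Longrightarrow> act (- v) s = - act v s"
  using act_add[of s v "- v"] by (simp add: act_0 eq_neg_iff_add_eq_0 add.commute)

lemma act_diff: "s \<in> carrier S \<Longrightarrow> act (v - w) s = act v s - act w s"
  using act_add[of s v "- w"] by (simp add: act_minus)

lemma act_sum: "s \<in> carrier S \<Longrightarrow> act (sum f A) s = (\<Sum>i\<in>A. act (f i) s)"
  by (induction A rule: infinite_finite_induct) (simp_all add: act_0 act_add)

lemma Pis_empty [simp]: "Pis {} v = 0"
  by (simp add: Pis_def)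

lemma Pis_add: "Pis A (v + w) = Pis A v + Pis A w"
  and Pis_minus: "Pis A (- v) = - Pis A v"
  and Pis_diff: "Pis A (v - w) = Pis A v - Pis A w"
  by (simp_all add: Pis_def Pi_add Pi_diff Pi_minus sum.distrib sum_subtractf sum_negf)

lemma Pi_sum: "Pi i (sum f A) = (\<Sum>j\<in>A. Pi i (f j))"
  by (induction A rule: infinite_finite_induct) (simp_all add: Pi_add)

lemma Pi_Pis: "finite A \<Longrightarrow> Pi i (Pis A v) = (if i \<in> A then Pi i v else 0)"
  by (simp add: Pis_def Pi_sum Pi_Pi)

lemma Pis_Pi: "finite A \<Longrightarrow> Pis A (Pi i v) = (if i \<in> A then Pi i v else 0)"
  by (simp add: Pis_def Pi_Pi)

lemma Pis_Pis: "finite A \<Longrightarrow> finite B \<Longrightarrow> Pis A (Pis B v) = Pis (A \<inter> B) v"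
  by (simp add: Pis_def[of A "Pis B v"] Pi_Pis Pis_def[of "A \<inter> B"] sum.inter_restrict)

lemma Pis_act: "s \<in> carrier S \<Longrightarrow> Pis A (act v s) = act (Pis A v) s"
  by (simp add: Pis_def Pi_act act_sum)

lemma kill_act: "s \<in> carrier S \<Longrightarrow> kill A (act v s) = act (kill A v) s"
  by (simp add: kill_def Pis_act act_diff)

lemma kill_add: "kill A (v + w) = kill A v + kill A w"
  by (simp add: kill_def Pis_add)

lemma kill_kill:
  assumes "finite A" "finite B"
  shows "kill A (kill B v) = kill (A \<union> B) v"
proof -
  have "Pis (A \<union> B) v + Pis (A \<inter> B) v = Pis A v + Pis B v"
    unfolding Pis_def by (rule sum.union_inter[OF assms])
  then show ?thesis
    using assms by (simp add: kill_def Pis_diff Pis_Pis) (simp add: algebra_simps)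
qed

lemma kill_Pis_commute: "finite A \<Longrightarrow> finite B \<Longrightarrow> kill A (Pis B v) = Pis B (kill A v)"
  by (simp add: kill_def Pis_diff Pis_Pis Int_commute)

lemma kill_Pis_singleton: "finite A \<Longrightarrow> kill {i} (Pis A v) = Pis (A - {i}) v"
  by (simp add: kill_def Pis_Pis) (auto simp: Pis_def sum_diff1)

lemma closed: "g \<in> C \<Longrightarrow> h \<in> C \<Longrightarrow> m g h \<in> C"
  by (simp add: C_iff mult_def')

lemma assoc: "g \<in> C \<Longrightarrow> h \<in> C \<Longrightarrow> k \<in> C \<Longrightarrow> m g (m h k) = m (m g h) k"
  by (simp add: C_iff mult_def' S.m_assoc act_mult act_add add.assoc)

lemma affine_mult: "g \<in> C \<Longrightarrow> h \<in> C \<Longrightarrow> affine A x (m g h) = affine A (affine A x g) h"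
  by (simp add: C_iff mult_def' affine_def act_mult act_add Pis_add Pis_act add.assoc)

lemma kill_group_hom: "g \<in> C \<Longrightarrow> h \<in> C \<Longrightarrow> kill_group A (m g h) = m (kill_group A g) (kill_group A h)"
  by (simp add: C_iff mult_def' kill_group_def kill_add kill_act)

lemma kill_group_C: "kill_group A ` C \<subseteq> C"
  by (auto simp: C_iff kill_group_def)

lemma bd_bd: "c \<in> act_chains C r \<Longrightarrow> bd A (bd A c) = 0"
  by (rule act_boundary_act_boundary[where C = C]) (simp_all add: assoc closed affine_mult)

text \<open>Once coordinate \<open>i\<close> of the point is set to zero, translations must not move
  it again, so the action changes from \<open>affine A\<close> to
  \<open>affine (A - {i})\<close>.\<close>

lemma forget_bd:
  assumes "finite A" "c \<in> act_chains C r"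
  shows "forget i (bd A c) = bd (A - {i}) (forget i c)"
  unfolding forget_def
proof (rule act_boundary_natural[where C = C and X = UNIV, symmetric])
  show "kill {i} (affine A x g) = affine (A - {i}) (kill {i} x) (id g)" if "g \<in> C" for x g
    using that assms(1) by (simp add: C_iff affine_def kill_add kill_act kill_Pis_singleton)
qed (use assms(2) in \<open>auto simp: act_chains_def\<close>)

lemma proj_bd:
  assumes "finite A" "finite J" "c \<in> act_chains C r"
  shows "proj J (bd A c) = bd A (proj J c)"
  unfolding proj_def
proof (rule act_boundary_natural[where C = C and X = UNIV, symmetric])
  show "kill J (affine A x g) = affine A (kill J x) (kill_group J g)" if "g \<in> C" for x g
    using that assms by (simp add: C_iff affine_def kill_add kill_act kill_Pis_commute kill_group_def)
qed (use assms(3) in \<open>auto simp: act_chains_def kill_group_hom\<close>)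

lemma forget_diff: "forget i (a - b) = forget i a - forget i b"
  and forget_minus: "forget i (- a) = - forget i a"
  and forget_0 [simp]: "forget i 0 = 0"
  by (simp_all add: forget_def chain_map_diff chain_map_minus)

lemma proj_0 [simp]: "proj J 0 = 0"
  by (simp add: proj_def)

lemma forget_proj: "finite J \<Longrightarrow> forget i (proj J c) = proj J (forget i c)"
  unfolding forget_def proj_def chain_map_compose
  by (rule chain_map_cong) (auto simp: kill_kill)

lemma proj_proj: "finite J \<Longrightarrow> proj {b} (proj J c) = proj (insert b J) c"
  unfolding proj_def chain_map_compose
  by (rule chain_map_cong) (auto simp: kill_kill kill_group_def)

lemma cross_0 [simp]: "cross B 0 = 0"
  by (simp add: cross_def)

lemma cross_insert:
  assumes "finite B" "b \<notin> B"
  shows "cross (insert b B) z = cross B z - proj {b} (cross B z)"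
proof -
  have "frag_cmul ((-1) ^ card (insert b J)) (proj (insert b J) z) =
      - proj {b} (frag_cmul ((-1) ^ card J) (proj J z))" if "J \<in> Pow B" for J
  proof -
    have "finite J" "b \<notin> J" using that assms finite_subset by auto
    then show ?thesis
      using proj_proj[of J b z] by (simp add: proj_def chain_map_cmul)
  qed
  then show ?thesis
    unfolding cross_def using assms
    by (simp add: sum_Pow_insert sum_negf proj_def chain_map_sum)
qed

lemma forget_cross:
  assumes "finite B"
  shows "forget i (cross B z) = cross B (forget i z)"
proof -
  have "forget i (cross B z) = (\<Sum>J\<in>Pow B. frag_cmul ((-1) ^ card J) (forget i (proj J z)))"
    by (simp add: cross_def forget_def chain_map_sum chain_map_cmul)
  also have "\<dots> = cross B (forget i z)"
    unfolding cross_def using assms by (intro sum.cong) (auto simp: forget_proj finite_subset)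
  finally show ?thesis .
qed

lemma proj_in_chains: "c \<in> act_chains C r \<Longrightarrow> proj J c \<in> act_chains C r"
  unfolding proj_def by (rule act_chains_map) (use kill_group_C in auto)

lemma forget_in_chains: "c \<in> act_chains C r \<Longrightarrow> forget i c \<in> act_chains C r"
  unfolding forget_def by (rule act_chains_map) auto

lemma cross_in_chains:
  assumes "finite B" "c \<in> act_chains C r" shows "cross B c \<in> act_chains C r"
  using assms(1)
  by (induction B rule: finite_induct)
     (use assms(2) proj_in_chains[of c r "{}"] in
       \<open>simp_all add: cross_insert act_chains_diff proj_in_chains, simp add: cross_def\<close>)

lemma cross_bd:
  assumes "finite A" "finite B" "c \<in> act_chains C r"
  shows "cross B (bd A c) = bd A (cross B c)"
  using assms(2)
proof (induction B rule: finite_induct)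
  case empty
  show ?case using proj_bd[OF assms(1) _ assms(3), of "{}"] by (simp add: cross_def)
next
  case (insert b B)
  then show ?case
    using proj_bd[OF assms(1) _ cross_in_chains[OF _ assms(3)], of "{b}" B]
    by (simp add: cross_insert act_boundary_diff)
qed

text \<open>
  The translation by \<open>- Pi b x\<close> moves \<open>x\<close> to \<open>kill {b} x\<close>; these translations form a natural
  transformation from the identity to \<open>kill_group {b}\<close>.
\<close>

definition contraction ::
    "'i set \<Rightarrow> 'i \<Rightarrow> ('v \<times> ('s \<times> 'v) list \<Rightarrow>\<^sub>0 int) \<Rightarrow> ('v \<times> ('s \<times> 'v) list \<Rightarrow>\<^sub>0 int)" where
  "contraction A b = prism (affine A) (\<lambda>x. (\<one>, - Pi b x)) (kill_group {b})"

lemma contraction_in_chains: "c \<in> act_chains C r \<Longrightarrow> contraction A b c \<in> act_chains C (Suc r)"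
  unfolding contraction_def by (rule prism_in_chains) (simp_all add: C_iff kill_group_C)

lemma contraction_homotopy:
  assumes "finite A" "b \<in> A" "c \<in> act_chains C r"
  shows "bd A (contraction A b c) + contraction A b (bd A c) = proj {b} c - c"
proof -
  have "bd A (contraction A b c) + contraction A b (bd A c) =
      chain_map (\<lambda>(x, gs). (affine A x (\<one>, - Pi b x), map (kill_group {b}) gs)) c - c"
    unfolding contraction_def
  proof (rule prism_homotopy[OF closed kill_group_hom affine_mult _ assms(3)])
    \<comment> \<open>Naturality: moving by \<open>g\<close> and then removing the coordinate
      \<open>b\<close> just acquired equals removing it first and then moving by \<open>g\<close>
      without its \<open>b\<close>-translation.\<close>
    show "m g (\<one>, - Pi b (affine A x g)) = m (\<one>, - Pi b x) (kill_group {b} g)" if "g \<in> C" for x g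
      using that assms
      by (simp add: C_iff mult_def' affine_def kill_group_def kill_def Pis_def[of "{b}"] Pi_add Pi_act
          Pi_Pis act_one act_minus)
  qed auto
  also have "chain_map (\<lambda>(x, gs). (affine A x (\<one>, - Pi b x), map (kill_group {b}) gs)) c = proj {b} c"
    unfolding proj_def
    by (rule chain_map_cong)
       (use assms in \<open>auto simp: affine_def act_one Pis_minus Pis_Pi kill_def Pis_def[of "{b}"]\<close>)
  finally show ?thesis .
qed

text \<open>The translations inserted along a path depend only on coordinate \<open>b\<close> of its
  vertices, and this coordinate evolves independently of the others.\<close>

lemma prism_list_affine_cong:
  assumes "finite A" "Pi b x = Pi b y" "set gs \<subseteq> C"
  shows "prism_list (affine A) (\<lambda>x. (\<one>, - Pi b x)) f x gs = prism_list (affine A) (\<lambda>x. (\<one>, - Pi b x)) f y gs"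
  using assms(2,3)
proof (induction gs arbitrary: x y)
  case (Cons g gs)
  have "Pi b (affine A x g) = Pi b (affine A y g)"
    using Cons.prems by (simp add: affine_def Pi_add Pi_act C_iff)
  from Cons.IH[OF this] Cons.prems show ?case by simp
qed simp

text \<open>Deleting coordinate \<open>i \<noteq> b\<close> leaves coordinate \<open>b\<close>
  unchanged along the path. The action \<open>affine A\<close> can stay on both sides because the
  prism sees it only through coordinate \<open>b\<close>.\<close>

lemma forget_contraction:
  assumes "finite A" "i \<noteq> b" "c \<in> act_chains C r"
  shows "forget i (contraction A b c) = contraction A b (forget i c)"
proof (rule frag_linear_eq[of c "UNIV \<times> {gs. set gs \<subseteq> C}"
    "\<lambda>c. forget i (contraction A b c)" "\<lambda>c. contraction A b (forget i c)"])
  fix y :: "'v \<times> ('s \<times> 'v) list" assume "y \<in> UNIV \<times> {gs. set gs \<subseteq> C}"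
  then obtain x gs where y: "y = (x, gs)" "set gs \<subseteq> C" by blast
  have "Pi b (kill {i} x) = Pi b x"
    using assms(2) by (simp add: kill_def Pis_def Pi_diff Pi_Pi)
  from prism_list_affine_cong[OF assms(1) this y(2)]
  show "forget i (contraction A b (frag_of y)) = contraction A b (forget i (frag_of y))"
    by (simp add: y forget_def contraction_def prism_of chain_map_compose)
qed (use assms(3) in \<open>auto simp: act_chains_def forget_diff contraction_def prism_diff\<close>)

text \<open>
  The induction shifts degrees along the sequence \<open>0 \<rightarrow> K \<rightarrow> \<int>[X] \<rightarrow> \<int> \<rightarrow> 0\<close>, where \<open>X\<close> is the image of
  \<open>Pi b\<close> with its affine action: \<open>proj {b}\<close> acts as the identity on the homology with coefficients
  in \<open>\<int>[X]\<close>. The conditions on \<open>forget\<close> encode tensor powers of such kernels.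
\<close>

lemma cross_is_boundary:
  assumes "finite B" "finite A" "A \<inter> B = {}"
    and "z \<in> act_chains C r" "bd A z = 0"
    and "\<And>i. i \<in> A \<Longrightarrow> forget i z = 0" "\<And>i. i \<in> B \<Longrightarrow> forget i z = z"
    and "r < card B"
  shows "\<exists>v \<in> act_chains C (Suc r). (\<forall>i\<in>A. forget i v = 0) \<and> bd A v = cross B z"
  using assms
proof (induction B arbitrary: A z r rule: finite_induct)
  case (insert b B)
  let ?A = "insert b A"
  \<comment> \<open>Connecting homomorphism: \<open>z\<close> has no coordinate \<open>b\<close>, so
    it is its own lift along the augmentation. Its boundary for the larger action is a cycle with
    coefficients in the kernel, one degree lower.\<close>
  define y where "y = bd ?A z"
  have A: "finite ?A" "?A - {b} = A" using insert.prems(1,2) by auto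
  have "\<exists>w \<in> act_chains C r. (\<forall>i\<in>?A. forget i w = 0) \<and> bd ?A w = cross B y"
  proof (cases r)
    case 0
    then have "y = 0"
      using act_boundary_degree_0 insert.prems(3) unfolding y_def by blast
    then show ?thesis by (intro bexI[of _ 0]) auto
  next
    case (Suc r')
    have "\<exists>w \<in> act_chains C (Suc r'). (\<forall>i\<in>?A. forget i w = 0) \<and> bd ?A w = cross B y"
    proof (rule insert.IH)
      show "finite ?A" "?A \<inter> B = {}" using insert by auto
      show "y \<in> act_chains C r'"
        unfolding y_def by (rule act_boundary_in_chains[OF closed]) (use insert.prems(3) Suc in auto)
      show "bd ?A y = 0"
        unfolding y_def by (rule bd_bd[OF insert.prems(3)])
      show "forget i y = 0" if "i \<in> ?A" for i
      proof (cases "i = b")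
        case True
        then show ?thesis
          unfolding y_def using forget_bd[OF A(1) insert.prems(3), of b] A(2) insert.prems(4,6) by simp
      next
        case False
        then show ?thesis
          unfolding y_def using that forget_bd[OF A(1) insert.prems(3), of i] insert.prems(5) by simp
      qed
      show "forget i y = y" if "i \<in> B" for i
      proof -
        have "?A - {i} = ?A" using that insert.prems(2) insert.hyps(2) by auto
        then show ?thesis
          unfolding y_def using that forget_bd[OF A(1) insert.prems(3), of i] insert.prems(6) by simp
      qed
      show "r' < card B" using insert Suc by simp
    qed
    then show ?thesis using Suc by simp
  qed
  then obtain w where w: "w \<in> act_chains C r" "\<And>i. i \<in> ?A \<Longrightarrow> forget i w = 0" "bd ?A w = cross B y"
    by blast
  \<comment> \<open>The lift of \<open>cross B z\<close>, corrected by \<open>w\<close> to a cycle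
    for the larger action; \<open>w\<close> lies in the kernel of \<open>forget b\<close>, so
    \<open>u\<close> still lifts \<open>cross B z\<close>.\<close>
  define u where "u = cross B z - w"
  have u: "u \<in> act_chains C r"
    unfolding u_def by (intro act_chains_diff cross_in_chains) (use insert w in auto)
  have bd_u: "bd ?A u = 0"
    unfolding u_def act_boundary_diff w(3) y_def
    using cross_bd[OF A(1) insert.hyps(1) insert.prems(3)] by simp
  have forget_u: "forget i u = 0" if "i \<in> A" for i
    using that insert by (simp add: u_def forget_diff w(2) forget_cross)
  have forget_b_u: "forget b u = cross B z"
    using insert by (simp add: u_def forget_diff w(2) forget_cross)
  \<comment> \<open>The boundary of the contraction of the cycle \<open>u\<close> is
    \<open>proj {b} u - u\<close>. Augmenting turns \<open>u\<close> back into
    \<open>cross B z\<close>, and the sign produces the missing factor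
    \<open>1 - proj {b}\<close>.\<close>
  define v where "v = - forget b (contraction ?A b u)"
  have "v \<in> act_chains C (Suc r)"
    unfolding v_def by (intro act_chains_minus forget_in_chains contraction_in_chains u)
  moreover have "forget i v = 0" if "i \<in> A" for i
  proof -
    have "i \<noteq> b" using that insert by auto
    have "forget i (forget b (contraction ?A b u)) = forget b (forget i (contraction ?A b u))"
      unfolding forget_def chain_map_compose by (rule chain_map_cong) (auto simp: kill_kill insert_commute)
    also have "\<dots> = 0"
      using forget_contraction[OF A(1) \<open>i \<noteq> b\<close> u] forget_u[OF that]
      by (simp add: contraction_def)
    finally show ?thesis unfolding v_def by (simp add: forget_minus)
  qed
  moreover have "bd A v = cross (insert b B) z"
  proof -
    have "bd A v = - forget b (bd ?A (contraction ?A b u))"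
      unfolding v_def using forget_bd[OF A(1) contraction_in_chains[OF u], of b ?A b] A(2)
        act_boundary_diff[of m "affine A" 0] by simp
    also have "bd ?A (contraction ?A b u) = proj {b} u - u"
      using contraction_homotopy[OF A(1) _ u, of b] bd_u by (simp add: contraction_def)
    also have "- forget b (proj {b} u - u) = cross B z - proj {b} (cross B z)"
      by (simp add: forget_diff forget_proj forget_b_u)
    finally show ?thesis using insert.hyps by (simp add: cross_insert)
  qed
  ultimately show ?case by blast
qed simp

theorem cross_effect_vanishes:
  assumes B: "finite B" "r < card B"
    and z: "z \<in> carrier (bar_cycles r semidirect_product)"
  shows "(\<Sum>J\<in>Pow B. frag_cmul ((-1) ^ card J) (chain_map (map (kill_group J)) z))
    \<in> bar_boundaries r semidirect_product"
proof -
  \<comment> \<open>The point 0 is fixed by \<open>affine {}\<close> and has no nonzero coordinates,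
    so \<open>?z\<close> is a cycle fixed by every \<open>forget i\<close>, as
    \<open>cross_is_boundary\<close> requires for \<open>A = {}\<close>.\<close>
  let ?z = "chain_map (Pair 0) z"
  have keys_z: "keys z \<subseteq> {gs. length gs = r \<and> set gs \<subseteq> C}" "bar_boundary semidirect_product z = 0"
    using z by (auto simp: bar_cycles_def bar_chains_def)
  have z': "?z \<in> act_chains C r"
    unfolding act_chains_def mem_Collect_eq
    by (rule keys_chain_map_subset[OF keys_z(1)]) auto
  have "bd {} ?z = 0"
    using act_boundary_Pair[of C "affine {}" 0 z semidirect_product] keys_z
    by (auto simp: affine_def C_iff act_0)
  moreover have "forget i ?z = ?z" for i
    unfolding forget_def chain_map_compose
    by (rule chain_map_cong) (simp add: kill_def Pis_def)
  ultimately obtain v where v: "v \<in> act_chains C (Suc r)" "bd {} v = cross B ?z"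
    using cross_is_boundary[OF B(1) _ _ z' _ _ _ B(2), of "{}"] by auto
  have "(\<Sum>J\<in>Pow B. frag_cmul ((-1) ^ card J) (chain_map (map (kill_group J)) z)) = chain_map snd (cross B ?z)"
    by (simp add: cross_def proj_def chain_map_sum chain_map_cmul chain_map_compose)
  also have "\<dots> = bar_boundary semidirect_product (chain_map snd v)"
    unfolding bar_boundary_snd[of semidirect_product v "affine {}"] v(2) ..
  also have "\<dots> \<in> bar_boundaries r semidirect_product"
  proof -
    have "keys (chain_map snd v) \<subseteq> {gs. length gs = Suc r \<and> set gs \<subseteq> C}"
      by (rule keys_chain_map_subset) (use v(1) in \<open>auto simp: act_chains_def\<close>)
    then show ?thesis
      unfolding bar_boundaries_def bar_chains_def by auto
  qed
  finally show ?thesis .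
qed

end

section \<open>Functoriality of group homology\<close>

definition bar_class :: "nat \<Rightarrow> ('g, 'b) monoid_scheme \<Rightarrow> ('g list \<Rightarrow>\<^sub>0 int) \<Rightarrow> ('g list \<Rightarrow>\<^sub>0 int) set" where
  "bar_class r G z = bar_boundaries r G #>\<^bsub>bar_cycles r G\<^esub> z"

lemma bar_chains_iff:
  "c \<in> carrier (bar_chains r G) \<longleftrightarrow> keys c \<subseteq> {gs. length gs = r \<and> set gs \<subseteq> carrier G}"
  by (simp add: bar_chains_def)

lemma bar_cycles_iff:
  "c \<in> carrier (bar_cycles r G) \<longleftrightarrow> c \<in> carrier (bar_chains r G) \<and> bar_boundary G c = 0"
  by (simp add: bar_cycles_def)

lemma mult_bar_cycles [simp]: "mult (bar_cycles r G) a b = a + b"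
  and one_bar_cycles [simp]: "\<one>\<^bsub>bar_cycles r G\<^esub> = 0"
  by (simp_all add: bar_cycles_def bar_chains_def)

lemma mult_bar_chains: "mult (bar_chains r G) a b = a + b"
  by (simp add: bar_chains_def)

lemma bar_chains_add: "a \<in> carrier (bar_chains r G) \<Longrightarrow> b \<in> carrier (bar_chains r G) \<Longrightarrow> a + b \<in> carrier (bar_chains r G)"
  and bar_chains_minus: "a \<in> carrier (bar_chains r G) \<Longrightarrow> - a \<in> carrier (bar_chains r G)"
  and bar_chains_0: "0 \<in> carrier (bar_chains r G)"
  by (simp_all add: bar_chains_iff keys_add_subset)

lemma bar_chains_map:
  assumes "f \<in> carrier G \<rightarrow> carrier H" "c \<in> carrier (bar_chains r G)"
  shows "chain_map (map f) c \<in> carrier (bar_chains r H)"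
  unfolding bar_chains_iff
  by (rule keys_chain_map_subset) (use assms in \<open>auto simp: bar_chains_iff Pi_iff subset_iff\<close>)

lemma Pair_bar_chains:
  "c \<in> carrier (bar_chains r G) \<Longrightarrow> chain_map (Pair x) c \<in> act_chains (carrier G) r"
  unfolding act_chains_def mem_Collect_eq bar_chains_iff
  by (rule keys_chain_map_subset) auto

lemma snd_act_chains:
  "c \<in> act_chains (carrier G) r \<Longrightarrow> chain_map snd c \<in> carrier (bar_chains r G)"
  unfolding act_chains_def mem_Collect_eq bar_chains_iff
  by (rule keys_chain_map_subset) auto

lemma snd_Pair [simp]: "chain_map snd (chain_map (Pair x) c) = c"
  by (simp add: chain_map_compose chain_map_id)

lemma bar_boundary_eq:
  "bar_boundary G c = chain_map snd (act_boundary (mult G) (\<lambda>_ _. ()) (chain_map (Pair ()) c))"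
  using bar_boundary_snd[of G "chain_map (Pair ()) c" "\<lambda>_ _. ()"] by simp

lemma bar_boundary_natural:
  assumes f: "f \<in> hom G H" and c: "c \<in> carrier (bar_chains r G)"
  shows "bar_boundary H (chain_map (map f) c) = chain_map (map f) (bar_boundary G c)"
proof -
  have "act_boundary (mult H) (\<lambda>_ _. ()) (chain_map (map_prod id (map f)) (chain_map (Pair ()) c)) =
      chain_map (map_prod id (map f)) (act_boundary (mult G) (\<lambda>_ _. ()) (chain_map (Pair ()) c))"
    by (rule act_boundary_natural[where C = "carrier G" and X = UNIV])
       (use f act_chainsD[OF Pair_bar_chains[OF c, of "()"]] in \<open>simp_all add: hom_mult\<close>)
  then have "chain_map snd (act_boundary (mult H) (\<lambda>_ _. ()) (chain_map (Pair ()) (chain_map (map f) c))) =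
      chain_map snd (chain_map (map_prod id (map f)) (act_boundary (mult G) (\<lambda>_ _. ()) (chain_map (Pair ()) c)))"
    by (simp add: chain_map_compose)
  then show ?thesis
    unfolding bar_boundary_eq by (simp add: chain_map_compose)
qed

lemma (in comm_group) comm_group_subgroup:
  assumes "subgroup H G"
  shows "comm_group (G\<lparr>carrier := H\<rparr>)"
  by (rule group.group_comm_groupI[OF subgroup_imp_group[OF assms]])
     (use subgroup.mem_carrier[OF assms] in \<open>auto intro: m_comm\<close>)

context group begin

lemma bar_boundary_in_chains:
  "c \<in> carrier (bar_chains (Suc r) G) \<Longrightarrow> bar_boundary G c \<in> carrier (bar_chains r G)"
  unfolding bar_boundary_eq
  by (intro snd_act_chains act_boundary_in_chains Pair_bar_chains) auto

lemma bar_boundary_bar_boundary: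
  assumes "c \<in> carrier (bar_chains r G)"
  shows "bar_boundary G (bar_boundary G c) = 0"
proof -
  have "act_boundary (\<otimes>) (\<lambda>_ _. ()) (act_boundary (\<otimes>) (\<lambda>_ _. ()) (chain_map (Pair ()) c)) = 0"
    by (rule act_boundary_act_boundary[where C = "carrier G"])
       (use Pair_bar_chains[OF assms] in \<open>auto simp: m_assoc\<close>)
  moreover have "chain_map (Pair ()) (chain_map snd d) = d" for d :: "unit \<times> 'a list \<Rightarrow>\<^sub>0 int"
    unfolding chain_map_compose by (rule chain_map_id) auto
  ultimately show ?thesis
    by (simp add: bar_boundary_eq)
qed

lemma comm_group_bar_cycles: "comm_group (bar_cycles r G)"
proof -
  interpret A: comm_group "bar_chains r G"
    unfolding bar_chains_def by (rule abelian_free_Abelian_group)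
  have inv: "inv\<^bsub>bar_chains r G\<^esub> c = - c" if "c \<in> carrier (bar_chains r G)" for c
    using that by (simp add: bar_chains_def)
  have "0 \<in> {c \<in> carrier (bar_chains r G). bar_boundary G c = 0}"
    by (simp add: bar_chains_0)
  then have "subgroup {c \<in> carrier (bar_chains r G). bar_boundary G c = 0} (bar_chains r G)"
    by (intro A.subgroupI)
      (auto simp: inv bar_chains_minus bar_boundary_minus bar_chains_add bar_boundary_add mult_bar_chains)
  then show ?thesis
    unfolding bar_cycles_def by (intro A.comm_group_subgroup)
qed

lemma inv_bar_cycles: "c \<in> carrier (bar_cycles r G) \<Longrightarrow> inv\<^bsub>bar_cycles r G\<^esub> c = - c"
proof -
  assume c: "c \<in> carrier (bar_cycles r G)"
  interpret A: comm_group "bar_cycles r G" by (rule comm_group_bar_cycles)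
  show ?thesis
    by (rule A.inv_equality)
       (use c in \<open>auto simp: bar_cycles_iff bar_chains_minus bar_boundary_minus\<close>)
qed

lemma subgroup_bar_boundaries: "subgroup (bar_boundaries r G) (bar_cycles r G)"
proof -
  interpret A: comm_group "bar_cycles r G" by (rule comm_group_bar_cycles)
  have sub: "bar_boundaries r G \<subseteq> carrier (bar_cycles r G)"
    unfolding bar_boundaries_def
    by (auto simp: bar_cycles_iff bar_boundary_in_chains bar_boundary_bar_boundary)
  show ?thesis
  proof (rule A.subgroupI[OF sub])
    show "bar_boundaries r G \<noteq> {}"
      unfolding bar_boundaries_def using bar_chains_0 by blast
  next
    fix a assume a: "a \<in> bar_boundaries r G"
    then obtain c where c: "c \<in> carrier (bar_chains (Suc r) G)" "a = bar_boundary G c"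
      unfolding bar_boundaries_def by blast
    have "inv\<^bsub>bar_cycles r G\<^esub> a = bar_boundary G (- c)"
      using inv_bar_cycles[of a r] a sub c(2) by (simp add: bar_boundary_minus subset_iff)
    then show "inv\<^bsub>bar_cycles r G\<^esub> a \<in> bar_boundaries r G"
      unfolding bar_boundaries_def using bar_chains_minus[OF c(1)] by simp
    fix b assume "b \<in> bar_boundaries r G"
    then obtain d where d: "d \<in> carrier (bar_chains (Suc r) G)" "b = bar_boundary G d"
      unfolding bar_boundaries_def by blast
    have "a \<otimes>\<^bsub>bar_cycles r G\<^esub> b = bar_boundary G (c + d)"
      by (simp add: bar_boundary_add c(2) d(2))
    then show "a \<otimes>\<^bsub>bar_cycles r G\<^esub> b \<in> bar_boundaries r G"
      unfolding bar_boundaries_def using bar_chains_add[OF c(1) d(1)] by simp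
  qed
qed

lemma bar_boundaries_in_cycles: "b \<in> bar_boundaries r G \<Longrightarrow> b \<in> carrier (bar_cycles r G)"
  using subgroup.mem_carrier[OF subgroup_bar_boundaries] .

lemma bar_boundaries_0: "0 \<in> bar_boundaries r G"
  using subgroup.one_closed[OF subgroup_bar_boundaries] by simp

lemma bar_boundaries_minus: "a \<in> bar_boundaries r G \<Longrightarrow> - a \<in> bar_boundaries r G"
  using subgroup.m_inv_closed[OF subgroup_bar_boundaries, of a r] inv_bar_cycles bar_boundaries_in_cycles
  by simp

lemma bar_boundaries_add: "a \<in> bar_boundaries r G \<Longrightarrow> b \<in> bar_boundaries r G \<Longrightarrow> a + b \<in> bar_boundaries r G"
  using subgroup.m_closed[OF subgroup_bar_boundaries, of a r b] by simp

lemma bar_boundaries_cmul: "a \<in> bar_boundaries r G \<Longrightarrow> frag_cmul n a \<in> bar_boundaries r G"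
  by (rule frag_closure_minus_cmul)
     (use bar_boundaries_0 bar_boundaries_add bar_boundaries_minus in \<open>force simp: diff_conv_add_uminus simp del: add_uminus_conv_diff\<close>)+

lemma bar_boundaries_sum: "(\<And>i. i \<in> I \<Longrightarrow> f i \<in> bar_boundaries r G) \<Longrightarrow> sum f I \<in> bar_boundaries r G"
  by (induction I rule: infinite_finite_induct) (simp_all add: bar_boundaries_0 bar_boundaries_add)

lemma comm_group_homology: "comm_group (homology r G)"
  unfolding homology_def
  by (rule comm_group.abelian_FactGroup[OF comm_group_bar_cycles subgroup_bar_boundaries])

lemma bar_class_in_homology: "z \<in> carrier (bar_cycles r G) \<Longrightarrow> bar_class r G z \<in> carrier (homology r G)"
  unfolding homology_def bar_class_def by (auto simp: carrier_FactGroup)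

lemma homology_cases:
  assumes "x \<in> carrier (homology r G)"
  obtains z where "z \<in> carrier (bar_cycles r G)" "x = bar_class r G z"
  using assms unfolding homology_def bar_class_def by (auto simp: carrier_FactGroup)

lemma bar_class_def': "bar_class r G z = (\<lambda>b. b + z) ` bar_boundaries r G"
  unfolding bar_class_def r_coset_def by auto

lemma bar_class_eq_iff: "bar_class r G z = bar_class r G z' \<longleftrightarrow> z - z' \<in> bar_boundaries r G"
proof
  assume "bar_class r G z = bar_class r G z'"
  then have "0 + z \<in> bar_class r G z'"
    using bar_boundaries_0 unfolding bar_class_def' by blast
  then show "z - z' \<in> bar_boundaries r G"
    unfolding bar_class_def' by auto
next
  assume d: "z - z' \<in> bar_boundaries r G"
  have "b + z \<in> bar_class r G z'" if "b \<in> bar_boundaries r G" for b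
    using bar_boundaries_add[OF that d] unfolding bar_class_def' image_iff
    by (auto intro!: bexI[of _ "b + (z - z')"])
  moreover have "b + z' \<in> bar_class r G z" if "b \<in> bar_boundaries r G" for b
    using bar_boundaries_add[OF that bar_boundaries_minus[OF d]] unfolding bar_class_def' image_iff
    by (auto intro!: bexI[of _ "b + (z' - z)"])
  ultimately show "bar_class r G z = bar_class r G z'"
    unfolding bar_class_def'[of r z] bar_class_def'[of r z'] by blast
qed

lemma mult_bar_class:
  assumes "z \<in> carrier (bar_cycles r G)" "z' \<in> carrier (bar_cycles r G)"
  shows "bar_class r G z \<otimes>\<^bsub>homology r G\<^esub> bar_class r G z' = bar_class r G (z + z')"
proof -
  interpret A: comm_group "bar_cycles r G" by (rule comm_group_bar_cycles)
  have "bar_boundaries r G \<lhd> bar_cycles r G"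
    by (rule A.subgroup_imp_normal[OF subgroup_bar_boundaries])
  from normal.rcos_sum[OF this assms] show ?thesis
    by (simp add: homology_def FactGroup_def bar_class_def)
qed

lemma one_homology: "\<one>\<^bsub>homology r G\<^esub> = bar_class r G 0"
  by (simp add: homology_def FactGroup_def bar_class_def')

end

lemma bar_boundaries_map:
  assumes f: "f \<in> hom G H" and b: "b \<in> bar_boundaries r G"
  shows "chain_map (map f) b \<in> bar_boundaries r H"
proof -
  obtain c where c: "c \<in> carrier (bar_chains (Suc r) G)" "b = bar_boundary G c"
    using b unfolding bar_boundaries_def by blast
  show ?thesis
    unfolding bar_boundaries_def c bar_boundary_natural[OF f c(1), symmetric]
    by (rule imageI, rule bar_chains_map[OF _ c(1)]) (use f in \<open>auto simp: hom_def\<close>)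
qed

text \<open>Boundaries go to boundaries, so all representatives give the same coset and the union in
  \<open>homology_map\<close> is taken over equal sets.\<close>

lemma homology_map_bar_class:
  assumes "group G" "group H" and f: "f \<in> hom G H" and z: "z \<in> carrier (bar_cycles r G)"
  shows "homology_map r H f (bar_class r G z) = bar_class r H (chain_map (map f) z)"
proof -
  interpret G: group G by fact
  interpret H: group H by fact
  have "bar_boundaries r H #>\<^bsub>bar_cycles r H\<^esub> chain_map (map f) (b + z) = bar_class r H (chain_map (map f) z)"
    if b: "b \<in> bar_boundaries r G" for b
  proof -
    from bar_boundaries_map[OF f b] have "chain_map (map f) b \<in> bar_boundaries r H" .
    then show ?thesis
      by (simp add: H.bar_class_eq_iff chain_map_add flip: bar_class_def)
  qed
  moreover have "bar_class r G z \<noteq> {}"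
    using G.bar_boundaries_0 unfolding G.bar_class_def' by blast
  ultimately show ?thesis
    unfolding homology_map_def chain_map_def[symmetric] by (auto simp: G.bar_class_def')
qed

lemma bar_cycles_map:
  assumes "f \<in> hom G H" and z: "z \<in> carrier (bar_cycles r G)"
  shows "chain_map (map f) z \<in> carrier (bar_cycles r H)"
  using bar_chains_map[of f G H z r] bar_boundary_natural[of f G H z r] assms
  by (auto simp: bar_cycles_iff hom_def)

lemma homology_map_hom:
  assumes "group G" "group H" and f: "f \<in> hom G H"
  shows "homology_map r H f \<in> hom (homology r G) (homology r H)"
proof -
  interpret G: group G by fact
  interpret H: group H by fact
  interpret A: comm_group "bar_cycles r G" by (rule G.comm_group_bar_cycles)
  show ?thesis
  proof (rule homI)
    fix x assume "x \<in> carrier (homology r G)"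
    then show "homology_map r H f x \<in> carrier (homology r H)"
      by (elim G.homology_cases)
         (simp add: homology_map_bar_class[OF assms] H.bar_class_in_homology bar_cycles_map[OF f])
  next
    fix x y assume "x \<in> carrier (homology r G)" "y \<in> carrier (homology r G)"
    then obtain z w where zw: "z \<in> carrier (bar_cycles r G)" "x = bar_class r G z"
        "w \<in> carrier (bar_cycles r G)" "y = bar_class r G w"
      by (metis G.homology_cases)
    have "z + w \<in> carrier (bar_cycles r G)"
      using A.m_closed[OF zw(1,3)] by simp
    with zw show "homology_map r H f (x \<otimes>\<^bsub>homology r G\<^esub> y) =
        homology_map r H f x \<otimes>\<^bsub>homology r H\<^esub> homology_map r H f y"
      by (simp add: G.mult_bar_class H.mult_bar_class homology_map_bar_class[OF assms]
          bar_cycles_map[OF f] chain_map_add)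
  qed
qed

lemma homology_map_compose:
  assumes "group G" "group H" "group K" and f: "f \<in> hom G H" and g: "g \<in> hom H K"
    and x: "x \<in> carrier (homology r G)"
  shows "homology_map r K g (homology_map r H f x) = homology_map r K (\<lambda>n. g (f n)) x"
proof -
  have gf: "(\<lambda>n. g (f n)) \<in> hom G K"
    using f g by (auto simp: hom_def Pi_iff)
  from x obtain z where z: "z \<in> carrier (bar_cycles r G)" "x = bar_class r G z"
    by (rule group.homology_cases[OF assms(1)])
  then show ?thesis
    by (simp add: homology_map_bar_class assms(1-5) gf bar_cycles_map[OF f] chain_map_compose comp_def)
qed

lemma homology_map_cong:
  assumes "group G" "group H" and f: "f \<in> hom G H" "\<And>g. g \<in> carrier G \<Longrightarrow> f g = f' g"
    and x: "x \<in> carrier (homology r G)"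
  shows "homology_map r H f x = homology_map r H f' x"
proof -
  have f': "f' \<in> hom G H"
  proof -
    interpret group G by fact
    show ?thesis using f by (auto simp: hom_def Pi_def)
  qed
  obtain z where z: "z \<in> carrier (bar_cycles r G)" "x = bar_class r G z"
    using x by (rule group.homology_cases[OF assms(1)])
  have "chain_map (map f) z = chain_map (map f') z"
    by (rule chain_map_cong) (use z(1) f(2) in \<open>auto simp: bar_cycles_iff bar_chains_iff\<close>)
  with z show ?thesis
    by (simp add: homology_map_bar_class assms(1,2) f(1) f')
qed

lemma homology_map_id:
  assumes "group G" and f: "\<And>g. g \<in> carrier G \<Longrightarrow> f g = g" and x: "x \<in> carrier (homology r G)"
  shows "homology_map r G f x = x"
proof -
  interpret group G by fact
  have id: "(\<lambda>g. g) \<in> hom G G" by (simp add: hom_def)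
  obtain z where z: "z \<in> carrier (bar_cycles r G)" "x = bar_class r G z"
    using x by (rule homology_cases)
  have "homology_map r G (\<lambda>g. g) x = x"
    using z by (simp add: homology_map_bar_class assms(1) id chain_map_id)
  then show ?thesis
    using homology_map_cong[OF assms(1,1) id, of f x r] f x by simp
qed

lemma (in group) inner_hom:
  assumes a: "a \<in> carrier G"
  shows "(\<lambda>n. a \<otimes> n \<otimes> inv a) \<in> hom G G"
proof -
  have "inv a \<otimes> (a \<otimes> y) = y" if "y \<in> carrier G" for y
    using a that by (simp flip: m_assoc)
  then show ?thesis
    using a by (intro homI) (simp_all add: m_assoc)
qed

text \<open>Over a one-point set the constant \<open>inv a\<close> is a natural transformation from
  the identity to conjugation by \<open>a\<close>, since
  \<open>g (inv a) = inv a (a g inv a)\<close>; the prism is the resulting chain homotopy.\<close>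

lemma (in group) homology_map_inner:
  assumes a: "a \<in> carrier G" and x: "x \<in> carrier (homology r G)"
  shows "homology_map r G (\<lambda>n. a \<otimes> n \<otimes> inv a) x = x"
proof -
  let ?f = "\<lambda>n. a \<otimes> n \<otimes> inv a" and ?bd = "act_boundary (\<otimes>) (\<lambda>_ _. ())"
  have cancel: "inv a \<otimes> (a \<otimes> y) = y" if "y \<in> carrier G" for y
    using a that by (simp flip: m_assoc)
  note f_hom = inner_hom[OF a]
  obtain z where z: "z \<in> carrier (bar_cycles r G)" "x = bar_class r G z"
    using x by (rule homology_cases)
  let ?z = "chain_map (Pair ()) z" and ?h = "prism (\<lambda>_ _. ()) (\<lambda>_. inv a) ?f"
  have z': "?z \<in> act_chains (carrier G) r"
    using z by (intro Pair_bar_chains) (simp add: bar_cycles_iff)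
  have "?bd (?h ?z) + ?h (?bd ?z) = chain_map (\<lambda>(x, gs). ((), map ?f gs)) ?z - ?z"
    by (rule prism_homotopy[OF _ _ _ _ z'])
       (use a in \<open>simp_all add: m_assoc cancel\<close>)
  moreover have "?bd ?z = 0"
    using act_boundary_Pair[of "carrier G" "\<lambda>_ _. ()" "()" z G] z
    by (auto simp: bar_cycles_iff bar_chains_iff)
  ultimately have "chain_map snd (?bd (?h ?z)) = chain_map (map ?f) z - z"
    by (simp add: chain_map_diff chain_map_compose chain_map_id)
  then have "bar_boundary G (chain_map snd (?h ?z)) = chain_map (map ?f) z - z"
    using bar_boundary_snd[of G "?h ?z" "\<lambda>_ _. ()"] by simp
  then have "chain_map (map ?f) z - z = bar_boundary G (chain_map snd (?h ?z))" ..
  moreover have "chain_map snd (?h ?z) \<in> carrier (bar_chains (Suc r) G)"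
    by (intro snd_act_chains prism_in_chains z') (use a in auto)
  ultimately have "chain_map (map ?f) z - z \<in> bar_boundaries r G"
    unfolding bar_boundaries_def by (rule image_eqI)
  then show ?thesis
    using homology_map_bar_class[OF is_group is_group f_hom z(1)] z(2) by (simp add: bar_class_eq_iff)
qed

lemma (in group) int_pow_bar_class:
  assumes z: "z \<in> carrier (bar_cycles r G)"
  shows "bar_class r G z [^]\<^bsub>homology r G\<^esub> (n::int) = bar_class r G (frag_cmul n z)"
    and "frag_cmul n z \<in> carrier (bar_cycles r G)"
proof -
  interpret H: comm_group "homology r G" by (rule comm_group_homology)
  have cyc: "frag_cmul k z \<in> carrier (bar_cycles r G)" for k
    using z by (auto simp: bar_cycles_iff bar_chains_iff bar_boundary_cmul)
  then show "frag_cmul n z \<in> carrier (bar_cycles r G)" .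
  have nat: "bar_class r G z [^]\<^bsub>homology r G\<^esub> k = bar_class r G (frag_cmul (int k) z)" for k :: nat
  proof (induction k)
    case (Suc k)
    then show ?case
      using mult_bar_class[OF cyc z, of "int k"] frag_cmul_distrib[of "int k" 1 z]
      by (simp add: add.commute)
  qed (simp add: one_homology)
  show "bar_class r G z [^]\<^bsub>homology r G\<^esub> n = bar_class r G (frag_cmul n z)"
  proof (cases n)
    case (nonneg k)
    then show ?thesis using nat[of k] by (simp add: int_pow_int)
  next
    case (neg k)
    have "bar_class r G z [^]\<^bsub>homology r G\<^esub> n = inv\<^bsub>homology r G\<^esub> (bar_class r G z [^]\<^bsub>homology r G\<^esub> Suc k)"
      unfolding neg using H.int_pow_neg[OF bar_class_in_homology[OF z], of "int (Suc k)"]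
      by (simp only: int_pow_int)
    also have "\<dots> = inv\<^bsub>homology r G\<^esub> bar_class r G (frag_cmul (int (Suc k)) z)"
      by (simp only: nat)
    also have "\<dots> = bar_class r G (frag_cmul n z)"
    proof (rule H.inv_equality)
      show "bar_class r G (frag_cmul n z) \<otimes>\<^bsub>homology r G\<^esub> bar_class r G (frag_cmul (int (Suc k)) z) =
          \<one>\<^bsub>homology r G\<^esub>"
        unfolding mult_bar_class[OF cyc cyc] one_homology neg by (simp flip: frag_cmul_distrib)
    qed (use cyc bar_class_in_homology in auto)
    finally show ?thesis .
  qed
qed

section \<open>The action of the quotient of an extension on the homology of the kernel\<close>

locale abelian_extension =
  L: group L + Q: comm_group Q for L :: "('g, 'b) monoid_scheme" (structure) and Q :: "('q, 'c) monoid_scheme" +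
  fixes E :: "'g set" and d :: "'g \<Rightarrow> 'q"
  assumes subgroup_E: "subgroup E L"
    and d_hom: "d \<in> hom (L\<lparr>carrier := E\<rparr>) Q"
    and d_surj: "d ` E = carrier Q"
begin

text \<open>Kernel and total group are both carrier updates of the ambient group \<open>L\<close>;
  this is the shape in which the linear and affine groups are presented later.\<close>

abbreviation "N \<equiv> L\<lparr>carrier := {T \<in> E. d T = \<one>\<^bsub>Q\<^esub>}\<rparr>"

interpretation E: group "L\<lparr>carrier := E\<rparr>"
  by (rule L.subgroup_imp_group[OF subgroup_E])

interpretation dh: group_hom "L\<lparr>carrier := E\<rparr>" Q d
  by unfold_locales (rule d_hom)

lemma E_L: "T \<in> E \<Longrightarrow> T \<in> carrier L"
  using subgroup.mem_carrier[OF subgroup_E] .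

lemma inv_E: "T \<in> E \<Longrightarrow> inv\<^bsub>L\<lparr>carrier := E\<rparr>\<^esub> T = inv T"
  using L.m_inv_consistent[OF subgroup_E] .

lemma E_inv: "T \<in> E \<Longrightarrow> inv T \<in> E"
  using subgroup.m_inv_closed[OF subgroup_E] .

lemma E_mult: "T \<in> E \<Longrightarrow> T' \<in> E \<Longrightarrow> T \<otimes> T' \<in> E"
  using subgroup.m_closed[OF subgroup_E] .

lemma d_mult: "T \<in> E \<Longrightarrow> T' \<in> E \<Longrightarrow> d (T \<otimes> T') = d T \<otimes>\<^bsub>Q\<^esub> d T'"
  using dh.hom_mult by simp

lemma d_inv: "T \<in> E \<Longrightarrow> d (inv T) = inv\<^bsub>Q\<^esub> d T"
  using dh.hom_inv inv_E by simp

lemma d_closed: "T \<in> E \<Longrightarrow> d T \<in> carrier Q"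
  using dh.hom_closed by simp

lemma subgroup_N: "subgroup {T \<in> E. d T = \<one>\<^bsub>Q\<^esub>} L"
proof (rule L.subgroupI)
  show "{T \<in> E. d T = \<one>\<^bsub>Q\<^esub>} \<noteq> {}"
    using subgroup.one_closed[OF subgroup_E] dh.hom_one by auto
qed (auto simp: E_L E_inv E_mult d_inv d_mult)

lemma group_N: "group N"
  by (rule L.subgroup_imp_group[OF subgroup_N])

definition conjugation where "conjugation T n = T \<otimes> n \<otimes> inv T"

lemma conj_hom:
  assumes T: "T \<in> E" shows "conjugation T \<in> hom N N"
proof (rule homI)
  fix x assume x: "x \<in> carrier N"
  then have "d (T \<otimes> x \<otimes> inv T) = d T \<otimes>\<^bsub>Q\<^esub> inv\<^bsub>Q\<^esub> d T"
    using T by (simp add: d_mult E_mult E_inv d_inv d_closed)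
  then show "conjugation T x \<in> carrier N"
    using x T d_closed by (simp add: conjugation_def E_mult E_inv)
next
  fix x y assume "x \<in> carrier N" "y \<in> carrier N"
  then have xy: "x \<in> carrier L" "y \<in> carrier L" by (simp_all add: E_L)
  have "inv T \<otimes> (T \<otimes> z) = z" if "z \<in> carrier L" for z
    using T that by (simp add: E_L flip: L.m_assoc)
  then show "conjugation T (x \<otimes>\<^bsub>N\<^esub> y) = conjugation T x \<otimes>\<^bsub>N\<^esub> conjugation T y"
    using T xy by (simp add: conjugation_def L.m_assoc E_L)
qed

text \<open>Two lifts of the same element differ by an element of \<open>N\<close>, whose
  conjugation is trivial on homology; hence the union over all lifts in \<open>conj_action\<close>
  is over equal sets.\<close>

lemma conj_action_eq:
  assumes T: "T \<in> E" and x: "x \<in> carrier (homology r N)"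
  shows "conj_action r N (L\<lparr>carrier := E\<rparr>) d (d T) x = homology_map r N (conjugation T) x"
proof -
  interpret N: group N by (rule group_N)
  have "homology_map r N (\<lambda>n. T' \<otimes>\<^bsub>L\<lparr>carrier := E\<rparr>\<^esub> n \<otimes>\<^bsub>L\<lparr>carrier := E\<rparr>\<^esub> inv\<^bsub>L\<lparr>carrier := E\<rparr>\<^esub> T') x =
      homology_map r N (conjugation T) x" if T': "T' \<in> E" "d T' = d T" for T'
  proof -
    let ?a = "T' \<otimes> inv T"
    have a: "?a \<in> carrier N"
      using T T' by (simp add: E_mult E_inv d_mult d_inv d_closed)
    have inv_a: "inv\<^bsub>N\<^esub> ?a = inv ?a"
      using L.m_inv_consistent[OF subgroup_N, of ?a] a by simp
    have i: "(\<lambda>n. ?a \<otimes>\<^bsub>N\<^esub> n \<otimes>\<^bsub>N\<^esub> inv\<^bsub>N\<^esub> ?a) \<in> hom N N"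
      by (rule N.inner_hom[OF a])
    have "homology_map r N (conjugation T') x = homology_map r N (\<lambda>n. ?a \<otimes>\<^bsub>N\<^esub> conjugation T n \<otimes>\<^bsub>N\<^esub> inv\<^bsub>N\<^esub> ?a) x"
    proof (rule homology_map_cong[OF group_N group_N conj_hom[OF T'(1)] _ x])
      fix n assume "n \<in> carrier N"
      then have n: "n \<in> carrier L" by (simp add: E_L)
      have [simp]: "inv T \<otimes> (T \<otimes> z) = z" if "z \<in> carrier L" for z
        using T that by (simp add: E_L flip: L.m_assoc)
      have inv_a': "inv ?a = T \<otimes> inv T'"
        using T T' by (simp add: L.inv_mult_group E_L)
      show "conjugation T' n = ?a \<otimes>\<^bsub>N\<^esub> conjugation T n \<otimes>\<^bsub>N\<^esub> inv\<^bsub>N\<^esub> ?a"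
        unfolding inv_a inv_a' using n T T' by (simp add: conjugation_def L.m_assoc E_L)
    qed
    also have "\<dots> = homology_map r N (\<lambda>n. ?a \<otimes>\<^bsub>N\<^esub> n \<otimes>\<^bsub>N\<^esub> inv\<^bsub>N\<^esub> ?a) (homology_map r N (conjugation T) x)"
      by (rule homology_map_compose[OF group_N group_N group_N conj_hom[OF T] i x, symmetric])
    also have "\<dots> = homology_map r N (conjugation T) x"
      by (rule N.homology_map_inner[OF a])
        (rule hom_in_carrier[OF homology_map_hom[OF group_N group_N conj_hom[OF T]] x])
    finally show ?thesis
      unfolding inv_E[OF T'(1)] by (simp add: conjugation_def[abs_def])
  qed
  then show ?thesis
    unfolding conj_action_def using T by auto
qed

lemma conj_action_hom:
  assumes "a \<in> carrier Q"
  shows "conj_action r N (L\<lparr>carrier := E\<rparr>) d a \<in> hom (homology r N) (homology r N)"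
proof -
  obtain T where T: "T \<in> E" "a = d T" using assms d_surj by blast
  have h: "homology_map r N (conjugation T) \<in> hom (homology r N) (homology r N)"
    by (rule homology_map_hom[OF group_N group_N conj_hom[OF T(1)]])
  interpret N: group N by (rule group_N)
  interpret H: comm_group "homology r N" by (rule N.comm_group_homology)
  show ?thesis
    using h unfolding T(2) hom_def by (auto simp: conj_action_eq[OF T(1)])
qed

lemma conj_action_one:
  assumes "x \<in> carrier (homology r N)"
  shows "conj_action r N (L\<lparr>carrier := E\<rparr>) d \<one>\<^bsub>Q\<^esub> x = x"
proof -
  have one: "\<one> \<in> E" "d \<one> = \<one>\<^bsub>Q\<^esub>"
    using subgroup.one_closed[OF subgroup_E] dh.hom_one by auto
  have "conj_action r N (L\<lparr>carrier := E\<rparr>) d (d \<one>) x = homology_map r N (conjugation \<one>) x"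
    by (rule conj_action_eq[OF one(1) assms])
  also have "\<dots> = x"
    by (rule homology_map_id[OF group_N _ assms]) (simp add: conjugation_def E_L)
  finally show ?thesis using one by simp
qed

lemma conj_action_mult:
  assumes "a \<in> carrier Q" "b \<in> carrier Q" and x: "x \<in> carrier (homology r N)"
  shows "conj_action r N (L\<lparr>carrier := E\<rparr>) d (a \<otimes>\<^bsub>Q\<^esub> b) x =
    conj_action r N (L\<lparr>carrier := E\<rparr>) d a (conj_action r N (L\<lparr>carrier := E\<rparr>) d b x)"
proof -
  obtain T U where T: "T \<in> E" "a = d T" and U: "U \<in> E" "b = d U"
    using assms d_surj by blast
  have hU: "homology_map r N (conjugation U) x \<in> carrier (homology r N)"
    by (rule hom_in_carrier[OF homology_map_hom[OF group_N group_N conj_hom[OF U(1)]] x])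
  have "conj_action r N (L\<lparr>carrier := E\<rparr>) d (d (T \<otimes> U)) x = homology_map r N (conjugation (T \<otimes> U)) x"
    by (rule conj_action_eq[OF E_mult[OF T(1) U(1)] x])
  also have "\<dots> = homology_map r N (\<lambda>n. conjugation T (conjugation U n)) x"
    by (rule homology_map_cong[OF group_N group_N conj_hom[OF E_mult[OF T(1) U(1)]] _ x])
       (simp add: conjugation_def E_L T(1) U(1) L.m_assoc L.inv_mult_group)
  also have "\<dots> = homology_map r N (conjugation T) (homology_map r N (conjugation U) x)"
    by (rule homology_map_compose[OF group_N group_N group_N conj_hom[OF U(1)] conj_hom[OF T(1)] x, symmetric])
  finally show ?thesis
    by (simp add: T U d_mult conj_action_eq[OF T(1) hU] conj_action_eq[OF U(1) x])
qed

end

section \<open>Modules over a group ring\<close>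

locale group_action_module =
  M: comm_group M + Q: comm_group Q for M :: "('x, 'b) monoid_scheme" and Q :: "('q, 'c) monoid_scheme" +
  fixes act :: "'q \<Rightarrow> 'x \<Rightarrow> 'x"
  assumes act_hom: "a \<in> carrier Q \<Longrightarrow> act a \<in> hom M M"
    and act_one: "x \<in> carrier M \<Longrightarrow> act \<one>\<^bsub>Q\<^esub> x = x"
    and act_mult: "a \<in> carrier Q \<Longrightarrow> b \<in> carrier Q \<Longrightarrow> x \<in> carrier M \<Longrightarrow>
      act (a \<otimes>\<^bsub>Q\<^esub> b) x = act a (act b x)"
begin

abbreviation "R \<equiv> group_ring Q"
abbreviation "AM \<equiv> action_module M act"

lemma R_iff: "c \<in> carrier R \<longleftrightarrow> keys c \<subseteq> carrier Q"
  by (simp add: group_ring_def)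

lemma R_add: "c \<oplus>\<^bsub>R\<^esub> d = c + d" and R_zero: "\<zero>\<^bsub>R\<^esub> = 0" and R_one: "\<one>\<^bsub>R\<^esub> = frag_of \<one>\<^bsub>Q\<^esub>"
  and R_mult: "c \<otimes>\<^bsub>R\<^esub> d = frag_extend (\<lambda>g. frag_extend (\<lambda>h. frag_of (g \<otimes>\<^bsub>Q\<^esub> h)) d) c"
  by (simp_all add: group_ring_def)

lemma AM_simps: "carrier AM = carrier M" "x \<oplus>\<^bsub>AM\<^esub> y = x \<otimes>\<^bsub>M\<^esub> y" "\<zero>\<^bsub>AM\<^esub> = \<one>\<^bsub>M\<^esub>"
  by (simp_all add: action_module_def)

text \<open>The group ring is additively free on the group, so a law that is additive in
  \<open>c\<close> needs to be checked only for group elements.\<close>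

lemma R_induct [consumes 1, case_names zero of diff]:
  assumes "c \<in> carrier R" "P 0" "\<And>a. a \<in> carrier Q \<Longrightarrow> P (frag_of a)"
    "\<And>c d. c \<in> carrier R \<Longrightarrow> d \<in> carrier R \<Longrightarrow> P c \<Longrightarrow> P d \<Longrightarrow> P (c - d)"
  shows "P c"
  by (rule free_Abelian_group_induct[of c "carrier Q"]) (use assms in \<open>auto simp: R_iff\<close>)

lemma R_mult_of: "frag_of g \<otimes>\<^bsub>R\<^esub> frag_of h = frag_of (g \<otimes>\<^bsub>Q\<^esub> h)"
  by (simp add: R_mult)

lemma frag_extend_fun_diff:
  "frag_extend (\<lambda>x. f x - g x) c = frag_extend f c - frag_extend g c"
  unfolding frag_extend_def
  by (simp flip: sum_subtractf) (rule sum.cong, simp_all add: poly_mapping_eq_iff fun_eq_iff lookup_minus algebra_simps)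

lemma R_mult_diff_left: "(c - c') \<otimes>\<^bsub>R\<^esub> d = c \<otimes>\<^bsub>R\<^esub> d - c' \<otimes>\<^bsub>R\<^esub> d"
  and R_mult_diff_right: "c \<otimes>\<^bsub>R\<^esub> (d - d') = c \<otimes>\<^bsub>R\<^esub> d - c \<otimes>\<^bsub>R\<^esub> d'"
  by (simp_all add: R_mult frag_extend_diff frag_extend_fun_diff)

lemma R_mult_closed: "c \<in> carrier R \<Longrightarrow> d \<in> carrier R \<Longrightarrow> c \<otimes>\<^bsub>R\<^esub> d \<in> carrier R"
  unfolding R_iff R_mult
  by (intro keys_frag_extend_subset) (auto simp: keys_frag_of)

lemma R_mult_0: "0 \<otimes>\<^bsub>R\<^esub> d = 0" "d \<otimes>\<^bsub>R\<^esub> 0 = 0"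
  using R_mult_diff_left[of 0 0 d] R_mult_diff_right[of d 0 0] by simp_all

lemma R_mult_comm: "c \<in> carrier R \<Longrightarrow> d \<in> carrier R \<Longrightarrow> c \<otimes>\<^bsub>R\<^esub> d = d \<otimes>\<^bsub>R\<^esub> c"
proof (induction c rule: R_induct)
  case (of a)
  from of(2) show ?case
    by (induction d rule: R_induct) (use of(1) in \<open>auto simp: R_mult_0 R_mult_diff_left R_mult_diff_right R_mult_of Q.m_comm\<close>)
qed (simp_all add: R_mult_0 R_mult_diff_left R_mult_diff_right)

lemma R_mult_assoc:
  "c \<in> carrier R \<Longrightarrow> d \<in> carrier R \<Longrightarrow> e \<in> carrier R \<Longrightarrow> c \<otimes>\<^bsub>R\<^esub> d \<otimes>\<^bsub>R\<^esub> e = c \<otimes>\<^bsub>R\<^esub> (d \<otimes>\<^bsub>R\<^esub> e)"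
proof (induction c rule: R_induct)
  case (of a)
  note a = this(1)
  from of(2,3) show ?case
  proof (induction d rule: R_induct)
    case (of b)
    from of(2) show ?case
      by (induction e rule: R_induct)
         (use a of(1) in \<open>auto simp: R_mult_0 R_mult_diff_left R_mult_diff_right R_mult_of Q.m_assoc\<close>)
  qed (simp_all add: R_mult_0 R_mult_diff_left R_mult_diff_right)
qed (simp_all add: R_mult_0 R_mult_diff_left R_mult_diff_right)

lemma R_mult_one: "c \<in> carrier R \<Longrightarrow> \<one>\<^bsub>R\<^esub> \<otimes>\<^bsub>R\<^esub> c = c"
  by (induction c rule: R_induct) (auto simp: R_one R_mult_0 R_mult_diff_right R_mult_of)

lemma R_one_closed: "\<one>\<^bsub>R\<^esub> \<in> carrier R"
  by (simp add: R_iff R_one keys_frag_of)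

lemma R_mult_distrib: "(c + c') \<otimes>\<^bsub>R\<^esub> d = c \<otimes>\<^bsub>R\<^esub> d + c' \<otimes>\<^bsub>R\<^esub> d"
  by (simp add: R_mult frag_extend_add)

lemma cring_R: "cring R"
proof (rule cringI)
  show "abelian_group R"
  proof (rule abelian_groupI)
    show "\<exists>d\<in>carrier R. d \<oplus>\<^bsub>R\<^esub> c = \<zero>\<^bsub>R\<^esub>" if "c \<in> carrier R" for c
      using that by (intro bexI[of _ "- c"]) (auto simp: R_iff R_add R_zero)
  qed (auto simp: R_add R_zero R_iff add_ac intro: subsetD[OF keys_add_subset])
  show "comm_monoid R"
    by (rule comm_monoidI)
       (auto simp: R_mult_closed R_mult_assoc R_mult_one R_one_closed intro: R_mult_comm)
qed (simp add: R_add R_mult_distrib)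

lemma act_closed: "a \<in> carrier Q \<Longrightarrow> x \<in> carrier M \<Longrightarrow> act a x \<in> carrier M"
  using hom_in_carrier[OF act_hom] .

text \<open>The scalar action is a product over the support of \<open>c\<close>, and the supports of
  \<open>c\<close>, \<open>d\<close> and \<open>c + d\<close> differ. Padding with trivial factors
  brings them to a common index set.\<close>

lemma smult_superset:
  assumes "finite A" "keys c \<subseteq> A" "A \<subseteq> carrier Q" "x \<in> carrier M"
  shows "c \<odot>\<^bsub>AM\<^esub> x = (\<Otimes>\<^bsub>M\<^esub>a\<in>A. act a x [^]\<^bsub>M\<^esub> lookup c a)"
  unfolding action_module_def module.simps
  by (rule M.finprod_mono_neutral_cong_left)
     (use assms act_closed in \<open>auto simp: in_keys_iff\<close>)

lemma smult_closed: "c \<in> carrier R \<Longrightarrow> x \<in> carrier M \<Longrightarrow> c \<odot>\<^bsub>AM\<^esub> x \<in> carrier M"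
  using smult_superset[of "keys c" c x] act_closed
  by (auto simp: R_iff intro!: M.finprod_closed)

lemma smult_add:
  assumes "c \<in> carrier R" "d \<in> carrier R" "x \<in> carrier M"
  shows "(c + d) \<odot>\<^bsub>AM\<^esub> x = (c \<odot>\<^bsub>AM\<^esub> x) \<otimes>\<^bsub>M\<^esub> (d \<odot>\<^bsub>AM\<^esub> x)"
proof -
  let ?A = "keys c \<union> keys d"
  have A: "finite ?A" "keys (c + d) \<subseteq> ?A" "?A \<subseteq> carrier Q"
    using assms Poly_Mapping.keys_add[of c d] by (auto simp: R_iff)
  have "(c + d) \<odot>\<^bsub>AM\<^esub> x = (\<Otimes>\<^bsub>M\<^esub>a\<in>?A. act a x [^]\<^bsub>M\<^esub> lookup c a \<otimes>\<^bsub>M\<^esub> act a x [^]\<^bsub>M\<^esub> lookup d a)"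
    unfolding smult_superset[OF A assms(3)]
    by (rule M.finprod_cong) (use A(3) assms(3) act_closed in \<open>auto simp: lookup_add M.int_pow_mult simp_implies_def\<close>)
  also have "\<dots> = (c \<odot>\<^bsub>AM\<^esub> x) \<otimes>\<^bsub>M\<^esub> (d \<odot>\<^bsub>AM\<^esub> x)"
    using smult_superset[OF A(1) _ A(3) assms(3), of c] smult_superset[OF A(1) _ A(3) assms(3), of d]
    by (simp, subst M.finprod_multf) (use A(3) assms(3) act_closed in auto)
  finally show ?thesis .
qed

lemma smult_of: "a \<in> carrier Q \<Longrightarrow> x \<in> carrier M \<Longrightarrow> frag_of a \<odot>\<^bsub>AM\<^esub> x = act a x"
  using smult_superset[of "{a}" "frag_of a" x] by (simp add: act_closed keys_frag_of)

lemma smult_0: "x \<in> carrier M \<Longrightarrow> 0 \<odot>\<^bsub>AM\<^esub> x = \<one>\<^bsub>M\<^esub>"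
  by (simp add: action_module_def)

lemma R_diff: "c \<in> carrier R \<Longrightarrow> d \<in> carrier R \<Longrightarrow> c - d \<in> carrier R"
  by (simp add: R_iff keys_diff_subset)

lemma smult_diff:
  assumes "c \<in> carrier R" "d \<in> carrier R" "x \<in> carrier M"
  shows "(c - d) \<odot>\<^bsub>AM\<^esub> x = (c \<odot>\<^bsub>AM\<^esub> x) \<otimes>\<^bsub>M\<^esub> inv\<^bsub>M\<^esub> (d \<odot>\<^bsub>AM\<^esub> x)"
proof -
  have "c \<odot>\<^bsub>AM\<^esub> x = ((c - d) \<odot>\<^bsub>AM\<^esub> x) \<otimes>\<^bsub>M\<^esub> (d \<odot>\<^bsub>AM\<^esub> x)"
    using smult_add[OF R_diff[OF assms(1,2)] assms(2,3)] by simp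
  then show ?thesis
    using assms by (simp add: smult_closed R_diff M.inv_solve_right)
qed

lemma smult_hom:
  assumes "x \<in> carrier M" "y \<in> carrier M"
  shows "c \<in> carrier R \<Longrightarrow> c \<odot>\<^bsub>AM\<^esub> (x \<otimes>\<^bsub>M\<^esub> y) = (c \<odot>\<^bsub>AM\<^esub> x) \<otimes>\<^bsub>M\<^esub> (c \<odot>\<^bsub>AM\<^esub> y)"
proof (induction c rule: R_induct)
  case (of a)
  then show ?case using assms hom_mult[OF act_hom[OF of(1)] assms] by (simp add: smult_of)
next
  case (diff c d)
  then show ?case
    using assms by (simp add: smult_diff smult_closed M.inv_mult M.m_ac)
qed (use assms in \<open>simp add: smult_0\<close>)

lemma smult_act:
  assumes "a \<in> carrier Q" "x \<in> carrier M"
  shows "c \<in> carrier R \<Longrightarrow> act a (c \<odot>\<^bsub>AM\<^esub> x) = (frag_of a \<otimes>\<^bsub>R\<^esub> c) \<odot>\<^bsub>AM\<^esub> x"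
proof (induction c rule: R_induct)
  case zero
  show ?case using hom_one[OF act_hom[OF assms(1)] M.is_group M.is_group] assms by (simp add: smult_0 R_mult_0)
next
  case (of b)
  then show ?case using assms by (simp add: smult_of R_mult_of act_mult)
next
  case (diff c d)
  interpret h: group_hom M M "act a"
    by unfold_locales (rule act_hom[OF assms(1)])
  have "frag_of a \<in> carrier R" using assms by (simp add: R_iff)
  with diff show ?case
    using assms by (simp add: smult_diff smult_closed R_mult_diff_right R_mult_closed)
qed

lemma smult_assoc:
  assumes "d \<in> carrier R" "x \<in> carrier M"
  shows "c \<in> carrier R \<Longrightarrow> (c \<otimes>\<^bsub>R\<^esub> d) \<odot>\<^bsub>AM\<^esub> x = c \<odot>\<^bsub>AM\<^esub> (d \<odot>\<^bsub>AM\<^esub> x)"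
proof (induction c rule: R_induct)
  case (of a)
  then show ?case using assms by (simp add: smult_act smult_of smult_closed)
qed (use assms in \<open>auto simp: smult_0 smult_closed R_mult_0 R_mult_diff_left smult_diff R_mult_closed\<close>)

lemma module_AM: "module R AM"
proof (rule moduleI)
  show "abelian_group AM"
  proof (rule abelian_groupI)
    show "\<exists>y\<in>carrier AM. y \<oplus>\<^bsub>AM\<^esub> x = \<zero>\<^bsub>AM\<^esub>" if "x \<in> carrier AM" for x
      using that by (intro bexI[of _ "inv\<^bsub>M\<^esub> x"]) (simp_all add: AM_simps)
  qed (auto simp: AM_simps M.m_assoc intro: M.m_comm)
  show "\<one>\<^bsub>R\<^esub> \<odot>\<^bsub>AM\<^esub> x = x" if "x \<in> carrier AM" for x
    using that smult_of[of "\<one>\<^bsub>Q\<^esub>" x] act_one[of x] by (simp add: AM_simps R_one)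
qed (simp_all add: cring_R AM_simps R_add smult_closed smult_add smult_hom smult_assoc)

end

lemma (in abelian_extension) group_action_module:
  "group_action_module (homology r N) Q (conj_action r N (L\<lparr>carrier := E\<rparr>) d)"
proof -
  interpret H: comm_group "homology r N"
    by (rule group.comm_group_homology[OF group_N])
  show ?thesis
    by unfold_locales (simp_all add: conj_action_hom conj_action_one conj_action_mult)
qed

section \<open>Localization at an element that acts as a projection\<close>

lemma UN_const: "A \<noteq> {} \<Longrightarrow> (\<And>z. z \<in> A \<Longrightarrow> f z = c) \<Longrightarrow> (\<Union>z\<in>A. f z) = c"
  by auto

text \<open>
  If \<open>s\<close> acts on \<open>M\<close> as the projection \<open>i \<circ> \<pi>\<close>, then \<open>(x, n)\<close> and \<open>(y, k)\<close> represent the same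
  fraction if and only if \<open>\<pi> x = \<pi> y\<close>.
\<close>

lemma module_iso_localization:
  assumes M0: "module R M0" and M: "module R M" and s: "s \<in> carrier R"
    and i: "i \<in> hom (add_monoid M0) (add_monoid M)"
    and \<pi>: "\<pi> \<in> hom (add_monoid M) (add_monoid M0)"
    and i_lin: "\<And>c x. c \<in> carrier R \<Longrightarrow> x \<in> carrier M0 \<Longrightarrow> i (c \<odot>\<^bsub>M0\<^esub> x) = c \<odot>\<^bsub>M\<^esub> i x"
    and \<pi>_lin: "\<And>c x. c \<in> carrier R \<Longrightarrow> x \<in> carrier M \<Longrightarrow> \<pi> (c \<odot>\<^bsub>M\<^esub> x) = c \<odot>\<^bsub>M0\<^esub> \<pi> x"
    and \<pi>_i: "\<And>x. x \<in> carrier M0 \<Longrightarrow> \<pi> (i x) = x"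
    and s_eq: "\<And>x. x \<in> carrier M \<Longrightarrow> s \<odot>\<^bsub>M\<^esub> x = i (\<pi> x)"
  shows "module_iso R M0 (localization R s M) (\<lambda>x. to_localization R s M (i x))"
proof -
  interpret R: cring R using module.axioms(1)[OF M] .
  interpret M0: module R M0 by fact
  interpret M: module R M by fact
  have i_closed: "i x \<in> carrier M" if "x \<in> carrier M0" for x
    using hom_in_carrier[OF i] that by simp
  have \<pi>_closed: "\<pi> x \<in> carrier M0" if "x \<in> carrier M" for x
    using hom_in_carrier[OF \<pi>] that by simp
  have i_add: "i (x \<oplus>\<^bsub>M0\<^esub> y) = i x \<oplus>\<^bsub>M\<^esub> i y" if "x \<in> carrier M0" "y \<in> carrier M0" for x y
    using hom_mult[OF i] that by simp
  have \<pi>_add: "\<pi> (x \<oplus>\<^bsub>M\<^esub> y) = \<pi> x \<oplus>\<^bsub>M0\<^esub> \<pi> y" if "x \<in> carrier M" "y \<in> carrier M" for x y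
    using hom_mult[OF \<pi>] that by simp
  have \<pi>_zero: "\<pi> \<zero>\<^bsub>M\<^esub> = \<zero>\<^bsub>M0\<^esub>"
    using hom_one[OF \<pi>] M.a_group M0.a_group by simp
  \<comment> \<open>The composite \<open>i \<circ> \<pi>\<close> is idempotent because
    \<open>\<pi> \<circ> i\<close> is the identity, so every positive power of \<open>s\<close> acts
    as \<open>s\<close> does.\<close>
  have s_pow_Suc: "(s [^]\<^bsub>R\<^esub> Suc n) \<odot>\<^bsub>M\<^esub> x = i (\<pi> x)" if x: "x \<in> carrier M" for n :: nat and x
  proof (induction n)
    case (Suc n)
    have "(s [^]\<^bsub>R\<^esub> Suc (Suc n)) \<odot>\<^bsub>M\<^esub> x = (s [^]\<^bsub>R\<^esub> Suc n) \<odot>\<^bsub>M\<^esub> (s \<odot>\<^bsub>M\<^esub> x)"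
      using x s by (simp add: M.smult_assoc1 del: R.nat_pow_Suc add: R.nat_pow_Suc[of s "Suc n"])
    also have "\<dots> = s \<odot>\<^bsub>M\<^esub> ((s [^]\<^bsub>R\<^esub> Suc n) \<odot>\<^bsub>M\<^esub> x)"
      using x s by (simp add: R.m_comm flip: M.smult_assoc1)
    also have "\<dots> = i (\<pi> x)"
      unfolding Suc using x by (simp add: s_eq i_closed \<pi>_closed \<pi>_i)
    finally show ?case .
  qed (use x s s_eq in simp)
  have \<pi>_s_pow: "\<pi> ((s [^]\<^bsub>R\<^esub> n) \<odot>\<^bsub>M\<^esub> x) = \<pi> x" if "x \<in> carrier M" for n :: nat and x
  proof (cases n)
    case (Suc k)
    show ?thesis unfolding Suc s_pow_Suc[OF that] using that by (simp add: \<pi>_i \<pi>_closed)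
  qed (use that in simp)
  have rel: "((x, n), (y, k)) \<in> frac_rel R M s \<longleftrightarrow> x \<in> carrier M \<and> y \<in> carrier M \<and> \<pi> x = \<pi> y" for x y n k
  proof
    assume "((x, n), (y, k)) \<in> frac_rel R M s"
    then obtain l where xy: "x \<in> carrier M" "y \<in> carrier M"
      and l: "(s [^]\<^bsub>R\<^esub> (l + k)) \<odot>\<^bsub>M\<^esub> x = (s [^]\<^bsub>R\<^esub> (l + n)) \<odot>\<^bsub>M\<^esub> y"
      unfolding frac_rel_def by auto
    have "\<pi> x = \<pi> y"
      using arg_cong[OF l, of \<pi>] xy by (simp add: \<pi>_s_pow)
    with xy show "x \<in> carrier M \<and> y \<in> carrier M \<and> \<pi> x = \<pi> y" by blast
  next
    assume *: "x \<in> carrier M \<and> y \<in> carrier M \<and> \<pi> x = \<pi> y"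
    \<comment> \<open>Taking \<open>l = 1\<close> makes both exponents positive, also when a
      denominator is \<open>s\<close> to the power 0.\<close>
    then have "(s [^]\<^bsub>R\<^esub> (1 + k)) \<odot>\<^bsub>M\<^esub> x = (s [^]\<^bsub>R\<^esub> (1 + n)) \<odot>\<^bsub>M\<^esub> y"
      using s_pow_Suc by (simp only: plus_1_eq_Suc)
    with * show "((x, n), (y, k)) \<in> frac_rel R M s"
      unfolding frac_rel_def by blast
  qed
  \<comment> \<open>By \<open>rel\<close> a fraction is determined by \<open>\<pi>\<close> of its
    numerator, whatever the denominator. Hence \<open>cls\<close> parametrizes the fractions by
    \<open>M0\<close>, and the structure of the localization is read off from
    \<open>M0\<close>.\<close>
  define cls where "cls x = {(y, k :: nat). y \<in> carrier M \<and> \<pi> y = x}" for x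
  have image_eq: "frac_rel R M s `` {(x, n)} = cls (\<pi> x)" if "x \<in> carrier M" for x n
    unfolding cls_def Image_singleton using rel that by auto
  let ?L = "localization R s M"
  have carrier_L: "carrier ?L = cls ` carrier M0"
  proof
    show "carrier ?L \<subseteq> cls ` carrier M0"
      unfolding localization_def quotient_def by (auto simp: image_eq \<pi>_closed)
    show "cls ` carrier M0 \<subseteq> carrier ?L"
    proof
      fix U assume "U \<in> cls ` carrier M0"
      then obtain x where x: "x \<in> carrier M0" "U = cls x" by blast
      then have "U = frac_rel R M s `` {(i x, 0)}"
        by (simp add: image_eq i_closed \<pi>_i)
      then show "U \<in> carrier ?L"
        unfolding localization_def quotient_def using i_closed[OF x(1)] by auto
    qed
  qed
  have mem_cls: "(i x, 0) \<in> cls x" if "x \<in> carrier M0" for x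
    using that by (simp add: cls_def i_closed \<pi>_i)
  have zero_L: "\<zero>\<^bsub>?L\<^esub> = cls \<zero>\<^bsub>M0\<^esub>"
    by (simp add: localization_def image_eq \<pi>_zero)
  have add_L: "cls x \<oplus>\<^bsub>?L\<^esub> cls y = cls (x \<oplus>\<^bsub>M0\<^esub> y)" if xy: "x \<in> carrier M0" "y \<in> carrier M0" for x y
  proof -
    have "frac_rel R M s `` {((s [^]\<^bsub>R\<^esub> k) \<odot>\<^bsub>M\<^esub> v \<oplus>\<^bsub>M\<^esub> (s [^]\<^bsub>R\<^esub> n) \<odot>\<^bsub>M\<^esub> w, n + k)} = cls (x \<oplus>\<^bsub>M0\<^esub> y)"
      if "(v, n) \<in> cls x" "(w, k) \<in> cls y" for v n w k
    proof -
      have vw: "v \<in> carrier M" "\<pi> v = x" "w \<in> carrier M" "\<pi> w = y"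
        using that by (auto simp: cls_def)
      then have "(s [^]\<^bsub>R\<^esub> k) \<odot>\<^bsub>M\<^esub> v \<in> carrier M" "(s [^]\<^bsub>R\<^esub> n) \<odot>\<^bsub>M\<^esub> w \<in> carrier M"
        using s by auto
      then show ?thesis
        using vw by (simp add: image_eq \<pi>_add \<pi>_s_pow)
    qed
    then have inner: "(case p' of (w, k) \<Rightarrow> frac_rel R M s `` {((s [^]\<^bsub>R\<^esub> k) \<odot>\<^bsub>M\<^esub> fst p \<oplus>\<^bsub>M\<^esub> (s [^]\<^bsub>R\<^esub> snd p) \<odot>\<^bsub>M\<^esub> w, snd p + k)}) =
        cls (x \<oplus>\<^bsub>M0\<^esub> y)" if "p \<in> cls x" "p' \<in> cls y" for p p'
      using that by (cases p, cases p') simp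
    have ne: "cls x \<noteq> {}" "cls y \<noteq> {}"
      using mem_cls xy by auto
    show ?thesis
      unfolding localization_def ring_record_simps case_prod_unfold
      by (intro UN_const ne) (use inner in \<open>auto simp: case_prod_unfold\<close>)
  qed
  have smult_L: "c \<odot>\<^bsub>?L\<^esub> cls x = cls (c \<odot>\<^bsub>M0\<^esub> x)" if c: "c \<in> carrier R" "x \<in> carrier M0" for c x
  proof -
    have "frac_rel R M s `` {(c \<odot>\<^bsub>M\<^esub> v, n)} = cls (c \<odot>\<^bsub>M0\<^esub> x)" if "(v, n) \<in> cls x" for v n
      using that c by (auto simp: cls_def[of x] image_eq \<pi>_lin)
    then show ?thesis
      using mem_cls[OF c(2)] unfolding localization_def by auto
  qed
  have f_eq: "to_localization R s M (i x) = cls x" if "x \<in> carrier M0" for x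
    using that by (simp add: to_localization_def image_eq i_closed \<pi>_i)
  have inj: "inj_on cls (carrier M0)"
  proof (rule inj_onI)
    fix x y assume "x \<in> carrier M0" "y \<in> carrier M0" "cls x = cls y"
    then have "(i x, 0) \<in> cls y" using mem_cls by blast
    then show "x = y" using \<open>x \<in> carrier M0\<close> by (simp add: cls_def \<pi>_i)
  qed
  have "module R ?L"
  proof (rule moduleI)
    show "cring R" by (rule R.is_cring)
    show "abelian_group ?L"
    proof (rule abelian_groupI)
      show "\<exists>y\<in>carrier ?L. y \<oplus>\<^bsub>?L\<^esub> x = \<zero>\<^bsub>?L\<^esub>" if "x \<in> carrier ?L" for x
      proof -
        from that obtain v where v: "v \<in> carrier M0" "x = cls v" unfolding carrier_L by blast
        then show ?thesis
          by (intro bexI[of _ "cls (\<ominus>\<^bsub>M0\<^esub> v)"])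
             (simp_all add: carrier_L add_L zero_L M0.l_neg)
      qed
    qed (auto simp: carrier_L add_L zero_L M0.a_ac)
  qed (auto simp: carrier_L add_L smult_L M0.smult_l_distr M0.smult_r_distr M0.smult_assoc1)
  moreover have "(\<lambda>x. to_localization R s M (i x)) \<in> iso (add_monoid M0) (add_monoid ?L)"
    using inj by (auto simp: iso_def hom_def bij_betw_def f_eq add_L carrier_L inj_on_def)
  ultimately show ?thesis
    unfolding module_iso_def using M0 by (simp add: f_eq smult_L)
qed

section \<open>Matrices over a possibly trivial ring\<close>

lemma index_mult_mat_sum:
  fixes A :: "'a::semiring_0 mat"
  assumes "A \<in> carrier_mat n k" "B \<in> carrier_mat k l" "i < n" "j < l"
  shows "(A * B) $$ (i, j) = (\<Sum>h<k. A $$ (i, h) * B $$ (h, j))"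
  using assms by (auto simp: scalar_prod_def lessThan_atLeast0 intro!: sum.cong)

lemma left_one_mat:
  fixes A :: "'a::{ring,monoid_mult} mat"
  assumes "A \<in> carrier_mat n k"
  shows "1\<^sub>m n * A = A"
proof (rule eq_matI)
  fix i j assume "i < dim_row A" "j < dim_col A"
  then have ij: "i < n" "j < k" using assms by auto
  have "(1\<^sub>m n * A) $$ (i, j) = (\<Sum>h<n. 1\<^sub>m n $$ (i, h) * A $$ (h, j))"
    by (rule index_mult_mat_sum[OF one_carrier_mat assms ij])
  also have "\<dots> = (\<Sum>h<n. if h = i then A $$ (h, j) else 0)"
    by (rule sum.cong) (use ij in auto)
  finally show "(1\<^sub>m n * A) $$ (i, j) = A $$ (i, j)" using ij by simp
qed (use assms in auto)

lemma right_one_mat: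
  fixes A :: "'a::{ring,monoid_mult} mat"
  assumes "A \<in> carrier_mat n k"
  shows "A * 1\<^sub>m k = A"
proof (rule eq_matI)
  fix i j assume "i < dim_row A" "j < dim_col A"
  then have ij: "i < n" "j < k" using assms by auto
  have "(A * 1\<^sub>m k) $$ (i, j) = (\<Sum>h<k. A $$ (i, h) * 1\<^sub>m k $$ (h, j))"
    by (rule index_mult_mat_sum[OF assms one_carrier_mat ij])
  also have "\<dots> = (\<Sum>h<k. if h = j then A $$ (i, h) else 0)"
    by (rule sum.cong) (use ij in auto)
  finally show "(A * 1\<^sub>m k) $$ (i, j) = A $$ (i, j)" using ij by simp
qed (use assms in auto)

lemma one_mat_mult [simp]:
  fixes A :: "'a::{ring,monoid_mult} mat"
  shows "dim_row A = n \<Longrightarrow> 1\<^sub>m n * A = A" and "dim_col A = n \<Longrightarrow> A * 1\<^sub>m n = A"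
  using left_one_mat[of A n "dim_col A"] right_one_mat[of A "dim_row A" n] by auto

definition block_diag :: "'a::zero mat \<Rightarrow> 'a mat \<Rightarrow> 'a mat" where
  "block_diag A D = four_block_mat A (0\<^sub>m (dim_row A) (dim_col D)) (0\<^sub>m (dim_row D) (dim_col A)) D"

lemma block_diag_eq:
  "A \<in> carrier_mat n n \<Longrightarrow> D \<in> carrier_mat k k \<Longrightarrow>
    block_diag A D = four_block_mat A (0\<^sub>m n k) (0\<^sub>m k n) D"
  by (auto simp: block_diag_def)

lemma block_diag_one [simp]: "block_diag (1\<^sub>m n) (1\<^sub>m k) = 1\<^sub>m (n + k)"
  by (simp add: block_diag_def)

lemma mult_block_diag:
  fixes A A' D D' :: "'a::ring mat"
  assumes "A \<in> carrier_mat n n" "A' \<in> carrier_mat n n" "D \<in> carrier_mat k k" "D' \<in> carrier_mat k k"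
  shows "block_diag A D * block_diag A' D' = block_diag (A * A') (D * D')"
  using assms
  by (simp add: block_diag_eq[of _ n _ k], subst mult_four_block_mat[of _ n n _ k _ k _ _ n _ k])
     (auto simp: block_diag_eq[of _ n _ k])

lemma block_diag_carrier:
  "A \<in> carrier_mat n n \<Longrightarrow> D \<in> carrier_mat k k \<Longrightarrow> block_diag A D \<in> carrier_mat (n + k) (n + k)"
  by (simp add: block_diag_def)

section \<open>The groups \<open>GL\<close> and \<open>K\<^sub>1\<close>\<close>

lemma carrier_GL:
  "M \<in> carrier (GL n) \<longleftrightarrow> M \<in> carrier_mat n n \<and> (\<exists>N\<in>carrier_mat n n. N * M = 1\<^sub>m n \<and> M * N = 1\<^sub>m n)"
  by (auto simp: GL_def units_of_def Units_def)

lemma GL_mat: "M \<in> carrier (GL n) \<Longrightarrow> M \<in> carrier_mat n n"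
  by (simp add: carrier_GL)

lemma GL_I:
  "M \<in> carrier_mat n n \<Longrightarrow> N \<in> carrier_mat n n \<Longrightarrow> N * M = 1\<^sub>m n \<Longrightarrow> M * N = 1\<^sub>m n \<Longrightarrow> M \<in> carrier (GL n)"
  by (auto simp: carrier_GL)

lemma mult_GL [simp]: "mult (GL n) M N = M * N" and one_GL [simp]: "\<one>\<^bsub>GL n\<^esub> = 1\<^sub>m n"
  by (simp_all add: GL_def units_of_def)

lemma group_GL: "group (GL n :: 'a::{ring,monoid_mult} mat monoid)"
  unfolding GL_def
proof (rule monoid.units_group, rule monoidI)
qed (auto simp: left_one_mat right_one_mat)

lemma inv_GL:
  fixes M :: "'a::{ring,monoid_mult} mat"
  assumes "M \<in> carrier (GL n)"
  shows "inv\<^bsub>GL n\<^esub> M \<in> carrier_mat n n" "inv\<^bsub>GL n\<^esub> M * M = 1\<^sub>m n" "M * inv\<^bsub>GL n\<^esub> M = 1\<^sub>m n"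
proof -
  interpret group "GL n :: 'a mat monoid" by (rule group_GL)
  show "inv\<^bsub>GL n\<^esub> M \<in> carrier_mat n n" using inv_closed[OF assms] by (rule GL_mat)
  show "inv\<^bsub>GL n\<^esub> M * M = 1\<^sub>m n" "M * inv\<^bsub>GL n\<^esub> M = 1\<^sub>m n"
    using l_inv[OF assms] r_inv[OF assms] by simp_all
qed

lemma block_diag_GL:
  fixes A D :: "'a::{ring,monoid_mult} mat"
  assumes "A \<in> carrier (GL n)" "D \<in> carrier (GL k)"
  shows "block_diag A D \<in> carrier (GL (n + k))"
proof (rule GL_I)
  let ?B = "block_diag (inv\<^bsub>GL n\<^esub> A) (inv\<^bsub>GL k\<^esub> D)"
  note A = GL_mat[OF assms(1)] inv_GL[OF assms(1)] and D = GL_mat[OF assms(2)] inv_GL[OF assms(2)]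
  show "block_diag A D \<in> carrier_mat (n + k) (n + k)" "?B \<in> carrier_mat (n + k) (n + k)"
    using A(1,2) D(1,2) by (intro block_diag_carrier; simp)+
  show "?B * block_diag A D = 1\<^sub>m (n + k)" "block_diag A D * ?B = 1\<^sub>m (n + k)"
    unfolding mult_block_diag[OF A(2,1) D(2,1)] mult_block_diag[OF A(1,2) D(1,2)] A(3,4) D(3,4) by simp_all
qed

lemma stabilize_block_diag:
  assumes "A \<in> carrier_mat n n"
  shows "stabilize (block_diag A (1\<^sub>m k)) = stabilize A"
  using assms by (auto simp: stabilize_def fun_eq_iff block_diag_def)

text \<open>A row of index below \<open>n\<close> is supported in the first \<open>n\<close> columns
  and any other row on the diagonal, so the sum over the support in \<open>GL_stable\<close> becomes
  a sum over \<open>k < n\<close> or over a single index.\<close>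

lemma stabilize_mult:
  fixes M N :: "'a::{ring,monoid_mult} mat"
  assumes "M \<in> carrier_mat n n" "N \<in> carrier_mat n n"
  shows "stabilize M \<otimes>\<^bsub>GL_stable\<^esub> stabilize N = stabilize (M * N)"
proof (intro ext)
  fix i j
  have "(stabilize M \<otimes>\<^bsub>GL_stable\<^esub> stabilize N) i j =
      (\<Sum>k | stabilize M i k \<noteq> 0. stabilize M i k * stabilize N k j)"
    by (simp add: GL_stable_def)
  also have "\<dots> = stabilize (M * N) i j"
  proof (cases "i < n")
    case True
    have "(\<Sum>k | stabilize M i k \<noteq> 0. stabilize M i k * stabilize N k j) =
        (\<Sum>k<n. stabilize M i k * stabilize N k j)"
      using assms True by (intro sum.mono_neutral_left) (auto simp: stabilize_def split: if_splits)
    also have "\<dots> = (\<Sum>k<n. M $$ (i, k) * stabilize N k j)"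
      using assms True by (intro sum.cong) (auto simp: stabilize_def)
    also have "\<dots> = stabilize (M * N) i j"
    proof (cases "j < n")
      case True
      then show ?thesis
        using assms \<open>i < n\<close> index_mult_mat_sum[OF assms \<open>i < n\<close> True] by (simp add: stabilize_def)
    next
      case False
      then have "(\<Sum>k<n. M $$ (i, k) * stabilize N k j) = 0"
        using assms by (intro sum.neutral) (auto simp: stabilize_def)
      then show ?thesis using False True assms by (auto simp: stabilize_def)
    qed
    finally show ?thesis .
  next
    case False
    have "(\<Sum>k | stabilize M i k \<noteq> 0. stabilize M i k * stabilize N k j) =
        (\<Sum>k\<in>{i}. stabilize M i k * stabilize N k j)"
      using assms False by (intro sum.mono_neutral_left) (auto simp: stabilize_def split: if_splits)
    then show ?thesis using assms False by (auto simp: stabilize_def)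
  qed
  finally show "(stabilize M \<otimes>\<^bsub>GL_stable\<^esub> stabilize N) i j = stabilize (M * N) i j" .
qed

lemma one_GL_stable: "\<one>\<^bsub>GL_stable\<^esub> = stabilize (1\<^sub>m n)"
  by (auto simp: GL_stable_def stabilize_def fun_eq_iff)

lemma stabilize_in_GL_stable: "M \<in> carrier (GL n) \<Longrightarrow> stabilize M \<in> carrier GL_stable"
  by (auto simp: GL_stable_def)

text \<open>Finitely many stable matrices can thus be represented in one common size, where the
  group laws are those of \<open>GL n\<close>.\<close>

lemma GL_stable_large:
  fixes f :: "nat \<Rightarrow> nat \<Rightarrow> 'a::{ring,monoid_mult}"
  assumes "f \<in> carrier GL_stable"
  shows "\<exists>n0. \<forall>n\<ge>n0. \<exists>M\<in>carrier (GL n). f = stabilize M"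
proof -
  obtain n0 M where M: "M \<in> carrier (GL n0)" "f = stabilize M"
    using assms by (auto simp: GL_stable_def)
  have "\<exists>M'\<in>carrier (GL n). f = stabilize M'" if "n \<ge> n0" for n
  proof -
    have "1\<^sub>m (n - n0) \<in> carrier (GL (n - n0) :: 'a mat monoid)"
      by (rule GL_I[of _ _ "1\<^sub>m (n - n0)"]) (simp_all add: left_one_mat)
    from block_diag_GL[OF M(1) this] that
    have "block_diag M (1\<^sub>m (n - n0)) \<in> carrier (GL n)" by simp
    then show ?thesis
      using stabilize_block_diag[OF GL_mat[OF M(1)], of "n - n0"] M(2) by (intro bexI) simp_all
  qed
  then show ?thesis by blast
qed

lemma group_GL_stable: "group (GL_stable :: (nat \<Rightarrow> nat \<Rightarrow> 'a::{ring,monoid_mult}) monoid)"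
proof (rule groupI)
  fix f g :: "nat \<Rightarrow> nat \<Rightarrow> 'a"
  assume f: "f \<in> carrier GL_stable" and g: "g \<in> carrier GL_stable"
  obtain n1 n2 where n1: "\<forall>n\<ge>n1. \<exists>M\<in>carrier (GL n). f = stabilize M"
    and n2: "\<forall>n\<ge>n2. \<exists>M\<in>carrier (GL n). g = stabilize M"
    using GL_stable_large[OF f] GL_stable_large[OF g] by blast
  obtain M N where MN: "M \<in> carrier (GL (n1 + n2))" "f = stabilize M" "N \<in> carrier (GL (n1 + n2))" "g = stabilize N"
    using n1 n2 by (meson le_add1 le_add2)
  interpret group "GL (n1 + n2) :: 'a mat monoid" by (rule group_GL)
  show "f \<otimes>\<^bsub>GL_stable\<^esub> g \<in> carrier GL_stable"
    using m_closed[OF MN(1,3)] stabilize_in_GL_stable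
    by (simp add: MN stabilize_mult[OF MN(1,3)[THEN GL_mat]])
  fix h :: "nat \<Rightarrow> nat \<Rightarrow> 'a" assume h: "h \<in> carrier GL_stable"
  obtain n3 where n3: "\<forall>n\<ge>n3. \<exists>M\<in>carrier (GL n). h = stabilize M"
    using GL_stable_large[OF h] by blast
  let ?n = "n1 + n2 + n3"
  obtain M N P where M: "M \<in> carrier (GL ?n)" "f = stabilize M" and N: "N \<in> carrier (GL ?n)" "g = stabilize N"
    and P: "P \<in> carrier (GL ?n)" "h = stabilize P"
    using n1 n2 n3 by (meson le_add1 le_add2 le_trans)
  note mats = M(1)[THEN GL_mat] N(1)[THEN GL_mat] P(1)[THEN GL_mat]
  show "f \<otimes>\<^bsub>GL_stable\<^esub> g \<otimes>\<^bsub>GL_stable\<^esub> h = f \<otimes>\<^bsub>GL_stable\<^esub> (g \<otimes>\<^bsub>GL_stable\<^esub> h)"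
    unfolding M N P
    using mats by (simp add: stabilize_mult[of _ ?n])
next
  have "1\<^sub>m 0 \<in> carrier (GL 0 :: 'a mat monoid)"
    by (rule GL_I[of _ _ "1\<^sub>m 0"]) (simp_all add: left_one_mat)
  then show "\<one>\<^bsub>GL_stable\<^esub> \<in> carrier (GL_stable :: (nat \<Rightarrow> nat \<Rightarrow> 'a) monoid)"
    unfolding one_GL_stable[of 0] by (rule stabilize_in_GL_stable)
next
  fix f :: "nat \<Rightarrow> nat \<Rightarrow> 'a" assume "f \<in> carrier GL_stable"
  then obtain n M where M: "M \<in> carrier (GL n)" "f = stabilize M"
    by (auto simp: GL_stable_def)
  show "\<one>\<^bsub>GL_stable\<^esub> \<otimes>\<^bsub>GL_stable\<^esub> f = f"
    unfolding one_GL_stable[of n] M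
    using M(1)[THEN GL_mat] by (simp add: stabilize_mult[of _ n] left_one_mat)
  interpret group "GL n :: 'a mat monoid" by (rule group_GL)
  show "\<exists>g\<in>carrier GL_stable. g \<otimes>\<^bsub>GL_stable\<^esub> f = \<one>\<^bsub>GL_stable\<^esub>"
    using inv_GL[OF M(1)] M(1)[THEN GL_mat]
    by (intro bexI[OF _ stabilize_in_GL_stable[OF inv_closed[OF M(1)]]])
       (simp add: M(2) stabilize_mult[of _ n] one_GL_stable[of n])
qed

lemma comm_group_K1: "comm_group (K1 :: 'a::{ring,monoid_mult} K1_monoid)"
  unfolding K1_def by (rule group.derived_quot_is_comm_group[OF group_GL_stable])

lemma K1_det_hom: "K1_det \<in> hom (GL n) (K1 :: 'a::{ring,monoid_mult} K1_monoid)"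
proof -
  let ?D = "derived GL_stable (carrier (GL_stable :: (nat \<Rightarrow> nat \<Rightarrow> 'a) monoid))"
  interpret normal ?D "GL_stable :: (nat \<Rightarrow> nat \<Rightarrow> 'a) monoid"
    by (rule group.derived_self_is_normal[OF group_GL_stable])
  show ?thesis
  proof (rule homI)
    fix M N :: "'a mat" assume MN: "M \<in> carrier (GL n)" "N \<in> carrier (GL n)"
    show "K1_det M \<in> carrier K1"
      unfolding K1_def K1_det_def by (rule hom_in_carrier[OF r_coset_hom_Mod stabilize_in_GL_stable[OF MN(1)]])
    show "K1_det (M \<otimes>\<^bsub>GL n\<^esub> N) = K1_det M \<otimes>\<^bsub>K1\<^esub> K1_det N"
      using hom_mult[OF r_coset_hom_Mod stabilize_in_GL_stable stabilize_in_GL_stable, OF MN]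
      by (simp add: K1_def K1_det_def stabilize_mult[OF MN[THEN GL_mat]])
  qed
qed

lemma K1_det_mult:
  fixes M N :: "'a::{ring,monoid_mult} mat"
  shows "M \<in> carrier (GL n) \<Longrightarrow> N \<in> carrier (GL n) \<Longrightarrow> K1_det (M * N) = K1_det M \<otimes>\<^bsub>K1\<^esub> K1_det N"
  using hom_mult[OF K1_det_hom, of M n N] by simp

lemma K1_det_closed: "M \<in> carrier (GL n) \<Longrightarrow> K1_det M \<in> carrier K1"
  using hom_in_carrier[OF K1_det_hom] .

lemma one_in_GL: "1\<^sub>m n \<in> carrier (GL n :: 'a::{ring,monoid_mult} mat monoid)"
  using group.is_monoid[OF group_GL, of n, THEN monoid.one_closed] by simp

lemma K1_det_one: "K1_det (1\<^sub>m n :: 'a::{ring,monoid_mult} mat) = \<one>\<^bsub>K1\<^esub>"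
  using hom_one[OF K1_det_hom group_GL comm_group.axioms(2)[OF comm_group_K1], of n] by simp

lemma K1_det_block_diag_one:
  "A \<in> carrier_mat n n \<Longrightarrow> K1_det (block_diag A (1\<^sub>m k)) = K1_det A"
  unfolding K1_det_def by (simp add: stabilize_block_diag)

text \<open>Conjugating by the permutation matrix which exchanges the two blocks.\<close>

lemma K1_det_one_block_diag:
  fixes D :: "'a::{ring,monoid_mult} mat"
  assumes D: "D \<in> carrier (GL d)"
  shows "K1_det (block_diag (1\<^sub>m n) D) = K1_det D"
proof -
  interpret K: comm_group "K1 :: 'a K1_monoid" by (rule comm_group_K1)
  note Dm = GL_mat[OF D]
  define P :: "'a mat" where "P = four_block_mat (0\<^sub>m n d) (1\<^sub>m n) (1\<^sub>m d) (0\<^sub>m d n)"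
  define P' :: "'a mat" where "P' = four_block_mat (0\<^sub>m d n) (1\<^sub>m d) (1\<^sub>m n) (0\<^sub>m n d)"
  have P: "P \<in> carrier_mat (n + d) (n + d)" "P' \<in> carrier_mat (n + d) (n + d)"
    unfolding P_def P'_def carrier_mat_def by auto
  have "P' * P = 1\<^sub>m (d + n)"
    unfolding P_def P'_def
    by (subst mult_four_block_mat[of _ d n _ d _ n _ _ d _ n]) (auto simp: left_one_mat right_one_mat)
  moreover have "P * P' = 1\<^sub>m (n + d)"
    unfolding P_def P'_def
    by (subst mult_four_block_mat[of _ n d _ n _ d _ _ n _ d]) (auto simp: left_one_mat right_one_mat)
  ultimately have P_GL: "P \<in> carrier (GL (n + d))"
    using P by (intro GL_I[of _ _ P']) (simp_all add: add.commute)
  have B: "block_diag (1\<^sub>m n) D \<in> carrier (GL (n + d))"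
    using block_diag_GL[OF one_in_GL D] by simp
  have B': "block_diag D (1\<^sub>m n) \<in> carrier (GL (n + d))"
    using block_diag_GL[OF D one_in_GL, of n] by (simp add: add.commute)
  have "block_diag (1\<^sub>m n) D * P = four_block_mat (0\<^sub>m n d) (1\<^sub>m n) D (0\<^sub>m d n)"
    unfolding P_def block_diag_eq[OF one_carrier_mat Dm] block_diag_eq[OF Dm one_carrier_mat] using Dm
    by (subst mult_four_block_mat[of _ n n _ d _ d _ _ d _ n]) (auto simp: left_one_mat right_one_mat)
  moreover have "P * block_diag D (1\<^sub>m n) = four_block_mat (0\<^sub>m n d) (1\<^sub>m n) D (0\<^sub>m d n)"
    unfolding P_def block_diag_eq[OF one_carrier_mat Dm] block_diag_eq[OF Dm one_carrier_mat] using Dm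
    by (subst mult_four_block_mat[of _ n d _ n _ d _ _ d _ n]) (auto simp: left_one_mat right_one_mat)
  ultimately have "K1_det (block_diag (1\<^sub>m n) D) \<otimes>\<^bsub>K1\<^esub> K1_det P = K1_det P \<otimes>\<^bsub>K1\<^esub> K1_det (block_diag D (1\<^sub>m n))"
    by (simp flip: K1_det_mult[OF B P_GL] K1_det_mult[OF P_GL B'])
  then have "K1_det (block_diag (1\<^sub>m n) D) = K1_det (block_diag D (1\<^sub>m n))"
    using K1_det_closed[OF B] K1_det_closed[OF B'] K1_det_closed[OF P_GL]
    by (simp add: K.m_comm[of _ "K1_det P"] K.Units_eq)
  then show ?thesis by (simp add: K1_det_block_diag_one[OF Dm])
qed

lemma K1_det_block_diag:
  fixes A D :: "'a::{ring,monoid_mult} mat"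
  assumes A: "A \<in> carrier (GL n)" and D: "D \<in> carrier (GL d)"
  shows "K1_det (block_diag A D) = K1_det A \<otimes>\<^bsub>K1\<^esub> K1_det D"
proof -
  note Am = GL_mat[OF A] and Dm = GL_mat[OF D]
  have "block_diag A D = block_diag A (1\<^sub>m d) * block_diag (1\<^sub>m n) D"
    using mult_block_diag[OF Am one_carrier_mat one_carrier_mat Dm] Am Dm
    by (simp add: left_one_mat right_one_mat)
  moreover have "block_diag A (1\<^sub>m d) \<in> carrier (GL (n + d))" "block_diag (1\<^sub>m n) D \<in> carrier (GL (n + d))"
    using block_diag_GL[OF A one_in_GL, of d] block_diag_GL[OF one_in_GL D, of n] by simp_all
  ultimately show ?thesis
    using K1_det_mult[of "block_diag A (1\<^sub>m d)" "n + d" "block_diag (1\<^sub>m n) D"]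
      K1_det_block_diag_one[OF Am] K1_det_one_block_diag[OF D] by simp
qed

section \<open>Scalar matrices and their classes\<close>

definition scalar_mat :: "nat \<Rightarrow> 'a::zero \<Rightarrow> 'a mat" where
  "scalar_mat n u = mat n n (\<lambda>(i, j). if i = j then u else 0)"

lemma scalar_mat_carrier [simp]: "scalar_mat n u \<in> carrier_mat n n"
  by (simp add: scalar_mat_def)

lemma scalar_mat_mult:
  fixes u :: "'a::{ring,monoid_mult}"
  assumes "A \<in> carrier_mat n k"
  shows "scalar_mat n u * A = mat n k (\<lambda>(i, j). u * A $$ (i, j))"
proof (rule eq_matI)
  fix i j assume "i < dim_row (mat n k (\<lambda>(i, j). u * A $$ (i, j)))" "j < dim_col (mat n k (\<lambda>(i, j). u * A $$ (i, j)))"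
  then have ij: "i < n" "j < k" by auto
  have "(scalar_mat n u * A) $$ (i, j) = (\<Sum>h<n. scalar_mat n u $$ (i, h) * A $$ (h, j))"
    by (rule index_mult_mat_sum[OF scalar_mat_carrier assms ij])
  also have "\<dots> = (\<Sum>h<n. if h = i then u * A $$ (h, j) else 0)"
    by (rule sum.cong) (use ij in \<open>auto simp: scalar_mat_def\<close>)
  finally show "(scalar_mat n u * A) $$ (i, j) = mat n k (\<lambda>(i, j). u * A $$ (i, j)) $$ (i, j)"
    using ij by simp
qed (use assms in \<open>auto simp: scalar_mat_def\<close>)

lemma mult_scalar_mat:
  fixes u :: "'a::{ring,monoid_mult}"
  assumes "A \<in> carrier_mat n k"
  shows "A * scalar_mat k u = mat n k (\<lambda>(i, j). A $$ (i, j) * u)"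
proof (rule eq_matI)
  fix i j assume "i < dim_row (mat n k (\<lambda>(i, j). A $$ (i, j) * u))" "j < dim_col (mat n k (\<lambda>(i, j). A $$ (i, j) * u))"
  then have ij: "i < n" "j < k" by auto
  have "(A * scalar_mat k u) $$ (i, j) = (\<Sum>h<k. A $$ (i, h) * scalar_mat k u $$ (h, j))"
    by (rule index_mult_mat_sum[OF assms scalar_mat_carrier ij])
  also have "\<dots> = (\<Sum>h<k. if h = j then A $$ (i, h) * u else 0)"
    by (rule sum.cong) (use ij in \<open>auto simp: scalar_mat_def\<close>)
  finally show "(A * scalar_mat k u) $$ (i, j) = mat n k (\<lambda>(i, j). A $$ (i, j) * u) $$ (i, j)"
    using ij by simp
qed (use assms in \<open>auto simp: scalar_mat_def\<close>)

lemma scalar_mat_scalar_mat: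
  fixes u v :: "'a::{ring,monoid_mult}"
  shows "scalar_mat n u * scalar_mat n v = scalar_mat n (u * v)"
  unfolding scalar_mat_mult[OF scalar_mat_carrier] by (auto simp: scalar_mat_def)

lemma scalar_mat_one: "scalar_mat n 1 = (1\<^sub>m n :: 'a::{ring,monoid_mult} mat)"
  by (auto simp: scalar_mat_def)

lemma scalar_mat_GL:
  fixes u v :: "'a::{ring,monoid_mult}"
  assumes "u * v = 1" "v * u = 1"
  shows "scalar_mat n u \<in> carrier (GL n)"
  by (rule GL_I[of _ _ "scalar_mat n v"]) (simp_all add: scalar_mat_scalar_mat assms scalar_mat_one)

lemma K1_scalar_scalar_mat: "K1_scalar u = K1_det (scalar_mat 1 u)"
proof -
  have "mat 1 1 (\<lambda>_. u) = scalar_mat 1 u" by (auto simp: scalar_mat_def)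
  then show ?thesis by (simp add: K1_scalar_def)
qed

lemma K1_scalar_mult:
  fixes u v :: "'a::{ring,monoid_mult}"
  assumes "u * u' = 1" "u' * u = 1" "v * v' = 1" "v' * v = 1"
  shows "K1_scalar (u * v) = K1_scalar u \<otimes>\<^bsub>K1\<^esub> K1_scalar v"
  unfolding K1_scalar_scalar_mat scalar_mat_scalar_mat[symmetric]
  by (rule K1_det_mult) (use scalar_mat_GL assms in blast)+

text \<open>Each diagonal entry contributes one factor. Divisibility of \<open>t\<close> by
  \<open>q\<close> enters through this exponent: a \<open>t\<close>-th power then has a scalar lift
  of size \<open>q\<close>.\<close>

lemma K1_det_scalar_mat:
  fixes u v :: "'a::{ring,monoid_mult}"
  assumes uv: "u * v = 1" "v * u = 1"
  shows "K1_det (scalar_mat n u) = K1_scalar (u ^ n)"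
proof (induction n)
  case 0
  have "stabilize (scalar_mat 0 u) = stabilize (1\<^sub>m 1)"
    by (auto simp: stabilize_def scalar_mat_def fun_eq_iff)
  then show ?case
    by (simp add: K1_scalar_scalar_mat scalar_mat_one) (simp add: K1_det_def)
next
  case (Suc n)
  have pow: "u ^ n * v ^ n = 1" "v ^ n * u ^ n = 1" for n
  proof (induction n)
    case (Suc n)
    {
      case 1
      have "u ^ Suc n * v ^ Suc n = u * (u ^ n * v ^ n) * v"
        by (simp only: power_Suc power_Suc2[of v] mult.assoc)
           (metis power_commutes power_Suc2)
      then show ?case using Suc uv by simp
    next
      case 2
      have "v ^ Suc n * u ^ Suc n = v * (v ^ n * u ^ n) * u"
        by (simp only: power_Suc power_Suc2[of u] mult.assoc)
           (metis power_commutes power_Suc2)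
      then show ?case using Suc uv by simp
    }
  qed simp_all
  have "scalar_mat (Suc n) u = block_diag (scalar_mat n u) (scalar_mat 1 u)"
    unfolding block_diag_eq[OF scalar_mat_carrier scalar_mat_carrier]
    by (rule eq_matI) (auto simp: scalar_mat_def)
  then have "K1_det (scalar_mat (Suc n) u) = K1_det (scalar_mat n u) \<otimes>\<^bsub>K1\<^esub> K1_det (scalar_mat 1 u)"
    using K1_det_block_diag[OF scalar_mat_GL[OF uv, of n] scalar_mat_GL[OF uv, of 1]] by simp
  also have "\<dots> = K1_scalar (u ^ n * u)"
    unfolding Suc K1_scalar_mult[OF pow uv] K1_scalar_scalar_mat[of u] ..
  finally show ?case by (simp add: power_Suc2 del: power_Suc)
qed

section \<open>Affine groups\<close>

definition aff :: "nat \<Rightarrow> nat \<Rightarrow> 'a::{zero,one} mat \<Rightarrow> 'a mat \<Rightarrow> 'a mat" where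
  "aff p q T N = four_block_mat T (0\<^sub>m q p) N (1\<^sub>m p)"

lemma aff_carrier: "T \<in> carrier_mat q q \<Longrightarrow> aff p q T N \<in> carrier_mat (q + p) (q + p)"
  by (simp add: aff_def)

lemma aff_mult:
  fixes T T' N N' :: "'a::{ring,monoid_mult} mat"
  assumes "T \<in> carrier_mat q q" "T' \<in> carrier_mat q q" "N \<in> carrier_mat p q" "N' \<in> carrier_mat p q"
  shows "aff p q T N * aff p q T' N' = aff p q (T * T') (N * T' + N')"
  unfolding aff_def using assms
  by (subst mult_four_block_mat[of _ q q _ p _ p _ _ q _ p]) auto

lemma aff_one: "aff p q (1\<^sub>m q) (0\<^sub>m p q) = 1\<^sub>m (q + p)"
  by (simp add: aff_def)

lemma right_uminus_mat:
  fixes A :: "'a::ring mat"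
  shows "A \<in> carrier_mat n k \<Longrightarrow> A + - A = 0\<^sub>m n k"
  by (rule eq_matI) auto

lemma aff_GL:
  fixes T N :: "'a::{ring,monoid_mult} mat"
  assumes T: "T \<in> carrier (GL q)" and N: "N \<in> carrier_mat p q"
  shows "aff p q T N \<in> carrier (GL (q + p))"
    and "inv\<^bsub>GL (q + p)\<^esub> (aff p q T N) = aff p q (inv\<^bsub>GL q\<^esub> T) (- (N * inv\<^bsub>GL q\<^esub> T))"
proof -
  interpret group "GL (q + p) :: 'a mat monoid" by (rule group_GL)
  let ?I = "inv\<^bsub>GL q\<^esub> T"
  note I = inv_GL[OF T] and Tm = GL_mat[OF T]
  have N': "- (N * ?I) \<in> carrier_mat p q" using N I by simp
  have "- (N * ?I) * T = - (N * ?I * T)" using N Tm I(1) by simp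
  also have "N * ?I * T = N" using N Tm I by (simp add: assoc_mult_mat[of _ p q _ q _ q])
  finally have l: "aff p q ?I (- (N * ?I)) * aff p q T N = 1\<^sub>m (q + p)"
    using N I aff_mult[OF I(1) Tm N' N] by (simp add: aff_one)
  have r: "aff p q T N * aff p q ?I (- (N * ?I)) = 1\<^sub>m (q + p)"
    unfolding aff_mult[OF Tm I(1) N N'] I(3)
    using N I(1) by (simp add: aff_one[symmetric] right_uminus_mat[of _ p q])
  show in_GL: "aff p q T N \<in> carrier (GL (q + p))"
    by (rule GL_I[OF aff_carrier[OF Tm] aff_carrier[OF I(1)] l r])
  have "aff p q ?I (- (N * ?I)) \<in> carrier (GL (q + p))"
    by (rule GL_I[OF aff_carrier[OF I(1)] aff_carrier[OF Tm] r l])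
  then show "inv\<^bsub>GL (q + p)\<^esub> (aff p q T N) = aff p q ?I (- (N * ?I))"
    using inv_equality[OF _ in_GL] l by simp
qed

text \<open>
  With \<open>E = [0, 0; N, 0]\<close> and \<open>F = [1, 0; 0, 0]\<close> we have \<open>EF = E\<close> and \<open>FE = 0\<close>, hence \<open>1 + E\<close> becomes
  the commutator of \<open>[1, E; 0, 1]\<close> and \<open>[1, 0; F, 1]\<close> in twice the size.
\<close>

lemma K1_det_unipotent:
  fixes E F :: "'a::{ring,monoid_mult} mat"
  assumes E: "E \<in> carrier_mat n n" and F: "F \<in> carrier_mat n n" and EF: "E * F = E" and FE: "F * E = 0\<^sub>m n n"
    and GL: "1\<^sub>m n + E \<in> carrier (GL n)"
  shows "K1_det (1\<^sub>m n + E) = \<one>\<^bsub>K1\<^esub>"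
proof -
  interpret K: comm_group "K1 :: 'a K1_monoid" by (rule comm_group_K1)
  define a where "a E = four_block_mat (1\<^sub>m n) E (0\<^sub>m n n) (1\<^sub>m n)" for E :: "'a mat"
  define b where "b F = four_block_mat (1\<^sub>m n) (0\<^sub>m n n) F (1\<^sub>m n)" for F :: "'a mat"
  define c where "c = block_diag (1\<^sub>m n + E) (1\<^sub>m n)"
  have c: "c \<in> carrier (GL (n + n))"
    unfolding c_def by (rule block_diag_GL[OF GL one_in_GL])
  have car: "a X \<in> carrier_mat (n + n) (n + n)" "b X \<in> carrier_mat (n + n) (n + n)" if "X \<in> carrier_mat n n" for X
    using that by (simp_all add: a_def b_def)
  have aa: "a X * a Y = a (X + Y)" "b X * b Y = b (X + Y)" if "X \<in> carrier_mat n n" "Y \<in> carrier_mat n n" for X Y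
    using that unfolding a_def b_def
    by (subst mult_four_block_mat[of _ n n _ n _ n _ _ n _ n]; auto simp: comm_add_mat)+
  have a0: "a (0\<^sub>m n n) = 1\<^sub>m (n + n)" "b (0\<^sub>m n n) = 1\<^sub>m (n + n)"
    by (simp_all add: a_def b_def)
  have ab: "a X \<in> carrier (GL (n + n))" "b X \<in> carrier (GL (n + n))" if X: "X \<in> carrier_mat n n" for X
  proof -
    have nX: "- X \<in> carrier_mat n n" "- X + X = 0\<^sub>m n n" "X + - X = 0\<^sub>m n n"
      using X by (auto simp: right_uminus_mat)
    show "a X \<in> carrier (GL (n + n))"
      by (rule GL_I[OF car(1)[OF X] car(1)[OF nX(1)]]) (simp_all add: aa X nX a0)
    show "b X \<in> carrier (GL (n + n))"
      by (rule GL_I[OF car(2)[OF X] car(2)[OF nX(1)]]) (simp_all add: aa X nX a0)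
  qed
  have EE: "E * E = 0\<^sub>m n n"
  proof -
    have "E * E = E * F * E" by (simp add: EF)
    also have "\<dots> = E * (F * E)" using E F by (simp add: assoc_mult_mat[of _ n n _ n _ n])
    finally show ?thesis using E by (simp add: FE)
  qed
  have ab_eq: "a E * b F = four_block_mat (1\<^sub>m n + E) E F (1\<^sub>m n)"
    unfolding a_def b_def using E F EF
    by (subst mult_four_block_mat[of _ n n _ n _ n _ _ n _ n]) auto
  have ba_eq: "b F * a E = four_block_mat (1\<^sub>m n) E F (1\<^sub>m n)"
    unfolding a_def b_def using E F FE
    by (subst mult_four_block_mat[of _ n n _ n _ n _ _ n _ n]) auto
  have E1: "1\<^sub>m n + E \<in> carrier_mat n n" "(1\<^sub>m n + E) * E = E"
    using E EE by (simp_all add: add_mult_distrib_mat[of _ n n _ _ n])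
  \<comment> \<open>Together with \<open>ab_eq\<close> this exhibits \<open>c\<close> as the
    commutator of \<open>a E\<close> and \<open>b F\<close>, so its class in the commutative group
    \<open>K1\<close> is trivial.\<close>
  have "c * (b F * a E) = four_block_mat (1\<^sub>m n + E) E F (1\<^sub>m n)"
    unfolding ba_eq c_def block_diag_eq[OF E1(1) one_carrier_mat] using E F E1
    by (subst mult_four_block_mat[of _ n n _ n _ n _ _ n _ n]) auto
  then have "K1_det (a E * b F) = K1_det (c * (b F * a E))"
    by (simp add: ab_eq)
  moreover have "b F * a E \<in> carrier (GL (n + n))"
    using monoid.m_closed[OF group.is_monoid[OF group_GL] ab(2)[OF F] ab(1)[OF E]] by simp
  ultimately have "K1_det (a E) \<otimes>\<^bsub>K1\<^esub> K1_det (b F) = K1_det c \<otimes>\<^bsub>K1\<^esub> (K1_det (b F) \<otimes>\<^bsub>K1\<^esub> K1_det (a E))"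
    by (simp add: K1_det_mult[OF ab(1)[OF E] ab(2)[OF F]] K1_det_mult[OF ab(2)[OF F] ab(1)[OF E]] K1_det_mult[OF c])
  then have "K1_det c = \<one>\<^bsub>K1\<^esub>"
    using K1_det_closed[OF c] K1_det_closed[OF ab(1)[OF E]] K1_det_closed[OF ab(2)[OF F]]
    by (simp add: K.m_comm[of "K1_det (a E)"])
  then show ?thesis
    unfolding c_def K1_det_block_diag_one[OF GL_mat[OF GL]] .
qed

text \<open>An affine matrix is \<open>block_diag T (1\<^sub>m p)\<close> times a unipotent matrix,
  and the unipotent factor has trivial class by \<open>K1_det_unipotent\<close>.\<close>

lemma K1_det_aff:
  fixes T N :: "'a::{ring,monoid_mult} mat"
  assumes T: "T \<in> carrier (GL q)" and N: "N \<in> carrier_mat p q"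
  shows "K1_det (aff p q T N) = K1_det T"
proof -
  interpret K: comm_group "K1 :: 'a K1_monoid" by (rule comm_group_K1)
  note Tm = GL_mat[OF T]
  define E F :: "'a mat" where "E = four_block_mat (0\<^sub>m q q) (0\<^sub>m q p) N (0\<^sub>m p p)"
    and "F = four_block_mat (1\<^sub>m q) (0\<^sub>m q p) (0\<^sub>m p q) (0\<^sub>m p p)"
  have one_E: "1\<^sub>m (q + p) + E = aff p q (1\<^sub>m q) N"
    unfolding E_def aff_def by (rule eq_matI) (use N in auto)
  have U: "aff p q (1\<^sub>m q) N \<in> carrier (GL (q + p))"
    by (rule aff_GL(1)[OF one_in_GL N])
  have "K1_det (1\<^sub>m (q + p) + E) = \<one>\<^bsub>K1\<^esub>"
  proof (rule K1_det_unipotent)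
    show "E \<in> carrier_mat (q + p) (q + p)" "F \<in> carrier_mat (q + p) (q + p)"
      by (simp_all add: E_def F_def)
    show "E * F = E" "F * E = 0\<^sub>m (q + p) (q + p)"
      unfolding E_def F_def using N
      by (subst mult_four_block_mat[of _ q q _ p _ p _ _ q _ p]; auto)+
    show "1\<^sub>m (q + p) + E \<in> carrier (GL (q + p))"
      unfolding one_E by (rule U)
  qed
  moreover have "aff p q T (0\<^sub>m p q) * aff p q (1\<^sub>m q) N = aff p q T N"
    using aff_mult[OF Tm one_carrier_mat _ N, of "0\<^sub>m p q"] Tm N by simp
  moreover have "aff p q T (0\<^sub>m p q) = block_diag T (1\<^sub>m p)"
    unfolding aff_def block_diag_eq[OF Tm one_carrier_mat] ..
  ultimately show ?thesis
    using K1_det_mult[OF aff_GL(1)[OF T zero_carrier_mat] U] K1_det_block_diag_one[OF Tm, of p]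
      K1_det_closed[OF T]
    by (simp add: one_E)
qed

subsection \<open>Central units\<close>

lemma center_carrier: "z \<in> carrier center_ring \<longleftrightarrow> (\<forall>a. z * a = a * z)"
  by (simp add: center_ring_def)

lemma center_commute: "z \<in> carrier center_ring \<Longrightarrow> z * a = a * z"
  by (simp only: center_carrier)

lemma mult_center [simp]: "x \<otimes>\<^bsub>center_ring\<^esub> y = x * y" and one_center [simp]: "\<one>\<^bsub>center_ring\<^esub> = 1"
  by (simp_all add: center_ring_def)

lemma Units_center:
  "z \<in> Units center_ring \<longleftrightarrow> z \<in> carrier center_ring \<and> (\<exists>w\<in>carrier center_ring. w * z = 1 \<and> z * w = 1)"
  by (auto simp: Units_def simp del: center_carrier)

lemma monoid_center_ring: "monoid (center_ring :: 'a::{ring,monoid_mult} ring)"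
proof (rule monoidI)
  fix x y :: 'a assume xy: "x \<in> carrier center_ring" "y \<in> carrier center_ring"
  have "x * y * a = a * (x * y)" for a
  proof -
    have "x * y * a = x * a * y" by (simp only: center_commute[OF xy(2)] mult.assoc)
    also have "\<dots> = a * (x * y)" by (simp only: center_commute[OF xy(1)] mult.assoc)
    finally show ?thesis .
  qed
  then show "x \<otimes>\<^bsub>center_ring\<^esub> y \<in> carrier center_ring" by (simp only: center_carrier mult_center) simp
qed (simp_all add: center_carrier[of 1] mult.assoc)

lemma center_power:
  fixes z :: "'a::{ring,monoid_mult}"
  assumes "z \<in> carrier center_ring" shows "z ^ n \<in> carrier center_ring"
proof (induction n)
  case (Suc n)
  then show ?case
    using monoid.m_closed[OF monoid_center_ring assms Suc.IH] by simp
qed (simp add: center_carrier)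

lemma center_power_inverse:
  fixes u v :: "'a::{ring,monoid_mult}"
  assumes "u \<in> carrier center_ring" "u * v = 1"
  shows "u ^ n * v ^ n = 1"
proof -
  show ?thesis
  proof (induction n)
    case (Suc n)
    have "u ^ Suc n * v ^ Suc n = u ^ n * (u * v ^ n) * v"
      by (simp only: power_Suc2 mult.assoc)
    also have "u * v ^ n = v ^ n * u"
      by (rule center_commute[OF assms(1)])
    also have "u ^ n * (v ^ n * u) * v = (u ^ n * v ^ n) * (u * v)"
      by (simp only: mult.assoc)
    finally show ?case using Suc assms(2) by simp
  qed simp
qed

lemma K1_scalar_Units_mult:
  fixes u v :: "'a::{ring,monoid_mult}"
  assumes "u \<in> Units center_ring" "v \<in> Units center_ring"
  shows "K1_scalar (u * v) = K1_scalar u \<otimes>\<^bsub>K1\<^esub> K1_scalar v"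
  using assms K1_scalar_mult unfolding Units_center by blast

lemma K1_scalar_one: "K1_scalar (1 :: 'a::{ring,monoid_mult}) = \<one>\<^bsub>K1\<^esub>"
  unfolding K1_scalar_scalar_mat scalar_mat_one by (rule K1_det_one)

lemma carrier_bar_units: "carrier bar_units = K1_scalar ` Units center_ring"
  and mult_bar_units [simp]: "mult bar_units = mult K1"
  and one_bar_units [simp]: "\<one>\<^bsub>bar_units\<^esub> = \<one>\<^bsub>K1\<^esub>"
  by (simp_all add: bar_units_def)

lemma K1_scalar_closed: "u \<in> Units center_ring \<Longrightarrow> K1_scalar (u :: 'a::{ring,monoid_mult}) \<in> carrier K1"
  unfolding Units_center K1_scalar_scalar_mat using scalar_mat_GL K1_det_closed by blast

lemma subgroup_bar_units:
  "subgroup (carrier bar_units) (K1 :: 'a::{ring,monoid_mult} K1_monoid)"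
proof -
  interpret K: comm_group "K1 :: 'a K1_monoid" by (rule comm_group_K1)
  interpret C: monoid "center_ring :: 'a ring" by (rule monoid_center_ring)
  have mult_C: "x \<otimes>\<^bsub>center_ring\<^esub> y = x * y" and one_C: "\<one>\<^bsub>center_ring\<^esub> = 1" for x y :: 'a
    by (simp_all add: center_ring_def)
  show ?thesis
    unfolding carrier_bar_units
  proof (rule K.subgroupI)
    show "K1_scalar ` Units center_ring \<subseteq> carrier (K1 :: 'a K1_monoid)"
      using K1_scalar_closed by blast
    show "K1_scalar ` Units (center_ring :: 'a ring) \<noteq> {}"
      using C.Units_one_closed by blast
  next
    fix a :: "(nat \<Rightarrow> nat \<Rightarrow> 'a) set" assume "a \<in> K1_scalar ` Units center_ring"
    then obtain z where z: "z \<in> Units center_ring" "a = K1_scalar z" by blast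
    let ?w = "inv\<^bsub>center_ring\<^esub> z"
    have w: "?w \<in> Units center_ring" "?w * z = 1"
      using z C.Units_inv_Units C.Units_l_inv by (auto simp: mult_C one_C)
    have "K1_scalar ?w \<otimes>\<^bsub>K1\<^esub> a = \<one>\<^bsub>K1\<^esub>"
      using K1_scalar_Units_mult[OF w(1) z(1)] by (simp add: w K1_scalar_one z)
    then have "inv\<^bsub>K1\<^esub> a = K1_scalar ?w"
      using z w K1_scalar_closed by (intro K.inv_equality) auto
    then show "inv\<^bsub>K1\<^esub> a \<in> K1_scalar ` Units center_ring" using w by blast
    fix b :: "(nat \<Rightarrow> nat \<Rightarrow> 'a) set" assume "b \<in> K1_scalar ` Units center_ring"
    then obtain y where y: "y \<in> Units center_ring" "b = K1_scalar y" by blast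
    then have "z * y \<in> Units center_ring"
      using C.Units_m_closed[OF z(1) y(1)] by (simp add: mult_C)
    then show "a \<otimes>\<^bsub>K1\<^esub> b \<in> K1_scalar ` Units center_ring"
      using K1_scalar_Units_mult[OF z(1) y(1)] z y by auto
  qed
qed

lemma comm_group_bar_units:
  "comm_group (bar_units :: 'a::{ring,monoid_mult} K1_monoid)"
  using comm_group.comm_group_subgroup[OF comm_group_K1 subgroup_bar_units]
  by (simp add: bar_units_def)

lemma one_in_bar_units: "\<one>\<^bsub>K1\<^esub> \<in> carrier (bar_units :: 'a::{ring,monoid_mult} K1_monoid)"
  by (rule subgroup.one_closed[OF subgroup_bar_units])

section \<open>The linear and affine groups as extensions of the group of central classes\<close>

lemma subgroup_G_grp: "subgroup (carrier (G_grp q)) (GL q :: 'a::{ring,monoid_mult} mat monoid)"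
proof -
  interpret group "GL q :: 'a mat monoid" by (rule group_GL)
  interpret K: comm_group "K1 :: 'a K1_monoid" by (rule comm_group_K1)
  interpret h: group_hom "GL q" "K1 :: 'a K1_monoid" K1_det
    by unfold_locales (rule K1_det_hom)
  have B: "subgroup (carrier bar_units) (K1 :: 'a K1_monoid)"
    by (rule subgroup_bar_units)
  show ?thesis
    unfolding G_grp_def
  proof (rule subgroupI)
    have "(1\<^sub>m q :: 'a mat) \<in> {T \<in> carrier (GL q). K1_det T \<in> carrier bar_units}"
      by (simp add: one_in_GL K1_det_one one_in_bar_units)
    then show "carrier (GL q\<lparr>carrier := {T \<in> carrier (GL q :: 'a mat monoid). K1_det T \<in> carrier bar_units}\<rparr>) \<noteq> {}"
      by auto
  qed (use subgroup.m_inv_closed[OF B] subgroup.m_closed[OF B] h.hom_mult m_closed in auto)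
qed

lemma G_grp_eq: "G_grp q = (GL q)\<lparr>carrier := carrier (G_grp q)\<rparr>"
  by (simp add: G_grp_def)

text \<open>The shape of the kernel \<open>N\<close> in \<open>abelian_extension\<close>. Passing
  from \<open>GL q\<close> to \<open>G_grp q\<close> keeps the kernel because the trivial class lies
  in \<open>bar_units\<close>.\<close>

lemma SG_grp_eq:
  "SG_grp q = (GL q :: 'a::{ring,monoid_mult} mat monoid)\<lparr>carrier := {T \<in> carrier (G_grp q). K1_det T = \<one>\<^bsub>bar_units\<^esub>}\<rparr>"
  using one_in_bar_units
  by (auto simp: SG_grp_def G_grp_def kernel_def intro!: arg_cong[of _ _ "\<lambda>X. GL q\<lparr>carrier := X\<rparr>"])

text \<open>A central unit in the first diagonal place lifts its own class; \<open>q \<ge> 1\<close>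
  provides that place.\<close>

lemma G_grp_representative:
  assumes "q \<ge> 1" "a \<in> carrier bar_units"
  shows "\<exists>T\<in>carrier (G_grp q :: 'a::{ring,monoid_mult} mat monoid). K1_det T = a"
proof -
  obtain z :: 'a where z: "z \<in> Units center_ring" "a = K1_scalar z"
    using assms(2) by (auto simp: carrier_bar_units)
  then obtain w where w: "z * w = 1" "w * z = 1" by (auto simp: Units_center)
  let ?T = "block_diag (scalar_mat 1 z) (1\<^sub>m (q - 1))"
  have "?T \<in> carrier (GL q)"
    using block_diag_GL[OF scalar_mat_GL[OF w, of 1] one_in_GL, of "q - 1"] assms(1) by simp
  moreover have "K1_det ?T = a"
    using K1_det_block_diag_one[OF scalar_mat_carrier] by (simp add: z K1_scalar_scalar_mat)
  ultimately show ?thesis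
    using assms(2) by (intro bexI[of _ ?T]) (simp_all add: G_grp_def)
qed

lemma abelian_extension_G:
  assumes "q \<ge> 1"
  shows "abelian_extension (GL q :: 'a::{ring,monoid_mult} mat monoid) bar_units (carrier (G_grp q)) K1_det"
proof -
  interpret group "GL q :: 'a mat monoid" by (rule group_GL)
  interpret Q: comm_group "bar_units :: 'a K1_monoid" by (rule comm_group_bar_units)
  show ?thesis
  proof (intro abelian_extension.intro abelian_extension_axioms.intro)
    show "K1_det \<in> hom (GL q\<lparr>carrier := carrier (G_grp q)\<rparr>) (bar_units :: 'a K1_monoid)"
      by (rule homI) (auto simp: G_grp_def K1_det_mult)
    show "K1_det ` carrier (G_grp q) = carrier (bar_units :: 'a K1_monoid)"
      using G_grp_representative[OF assms] by (force simp: G_grp_def)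
  qed (rule subgroup_G_grp is_group Q.comm_group_axioms)+
qed

lemma carrier_Aff_grp:
  "carrier (Aff_grp p q H) = {aff p q T N | T N. T \<in> carrier H \<and> N \<in> carrier_mat p q}"
  by (simp add: Aff_grp_def aff_def)

lemma subgroup_Aff_grp:
  fixes H :: "'a::{ring,monoid_mult} mat monoid"
  assumes H: "subgroup (carrier H) (GL q)"
  shows "subgroup (carrier (Aff_grp p q H)) (GL (q + p))"
proof -
  interpret group "GL (q + p) :: 'a mat monoid" by (rule group_GL)
  note in_GL = subgroup.mem_carrier[OF H]
  show ?thesis
  proof (rule subgroupI)
    show "carrier (Aff_grp p q H) \<subseteq> carrier (GL (q + p))"
      by (auto simp: carrier_Aff_grp intro: aff_GL(1) in_GL)
    show "carrier (Aff_grp p q H) \<noteq> {}"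
      using subgroup.one_closed[OF H] zero_carrier_mat by (auto simp: carrier_Aff_grp)
  next
    fix a assume "a \<in> carrier (Aff_grp p q H)"
    then obtain T N where TN: "a = aff p q T N" "T \<in> carrier H" "N \<in> carrier_mat p q"
      by (auto simp: carrier_Aff_grp)
    have "- (N * inv\<^bsub>GL q\<^esub> T) \<in> carrier_mat p q"
      using TN(3) inv_GL(1)[OF in_GL[OF TN(2)]] by simp
    then show "inv\<^bsub>GL (q + p)\<^esub> a \<in> carrier (Aff_grp p q H)"
      unfolding TN(1) aff_GL(2)[OF in_GL[OF TN(2)] TN(3)] carrier_Aff_grp
      using subgroup.m_inv_closed[OF H TN(2)] by blast
    fix b assume "b \<in> carrier (Aff_grp p q H)"
    then obtain T' N' where TN': "b = aff p q T' N'" "T' \<in> carrier H" "N' \<in> carrier_mat p q"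
      by (auto simp: carrier_Aff_grp)
    note m = GL_mat[OF in_GL[OF TN(2)]] GL_mat[OF in_GL[OF TN'(2)]]
    have "N * T' + N' \<in> carrier_mat p q" using TN(3) TN'(3) m by simp
    moreover have "T * T' \<in> carrier H" using subgroup.m_closed[OF H TN(2) TN'(2)] by simp
    ultimately show "a \<otimes>\<^bsub>GL (q + p)\<^esub> b \<in> carrier (Aff_grp p q H)"
      unfolding TN(1) TN'(1) mult_GL aff_mult[OF m TN(3) TN'(3)] carrier_Aff_grp by blast
  qed
qed

lemma in_G_grp_GL: "T \<in> carrier (G_grp q) \<Longrightarrow> T \<in> carrier (GL q)"
  by (simp add: G_grp_def)

lemma in_SG_grp: "T \<in> carrier (SG_grp q) \<longleftrightarrow> T \<in> carrier (GL q) \<and> K1_det T = \<one>\<^bsub>K1\<^esub>"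
  by (simp add: SG_grp_def kernel_def)

lemma SG_subset_G:
  "carrier (SG_grp q) = {T \<in> carrier (G_grp q :: 'a::{ring,monoid_mult} mat monoid). K1_det T = \<one>\<^bsub>bar_units\<^esub>}"
  by (subst SG_grp_eq) simp

text \<open>The translation part does not change the class, by \<open>K1_det_aff\<close>, so the
  condition on an affine matrix is the condition on its linear part. Again this is the kernel in the
  shape of \<open>abelian_extension\<close>.\<close>

lemma AffSG_grp_eq:
  "AffSG_grp p q = (GL (q + p) :: 'a::{ring,monoid_mult} mat monoid)
     \<lparr>carrier := {U \<in> carrier (AffG_grp p q). K1_det U = \<one>\<^bsub>bar_units\<^esub>}\<rparr>"
proof -
  have "carrier (AffSG_grp p q) = {U \<in> carrier (AffG_grp p q :: 'a mat monoid). K1_det U = \<one>\<^bsub>bar_units\<^esub>}"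
  proof (intro equalityI subsetI)
    fix U :: "'a mat" assume "U \<in> carrier (AffSG_grp p q)"
    then obtain T N where U: "U = aff p q T N" "T \<in> carrier (SG_grp q)" "N \<in> carrier_mat p q"
      unfolding AffSG_grp_def carrier_Aff_grp by blast
    then have T: "T \<in> carrier (G_grp q)" "K1_det T = \<one>\<^bsub>bar_units\<^esub>"
      unfolding SG_subset_G by blast+
    then have "K1_det U = \<one>\<^bsub>bar_units\<^esub>"
      unfolding U(1) using K1_det_aff[OF in_G_grp_GL U(3)] by simp
    moreover have "U \<in> carrier (AffG_grp p q)"
      unfolding AffG_grp_def carrier_Aff_grp using U T by blast
    ultimately show "U \<in> {U \<in> carrier (AffG_grp p q). K1_det U = \<one>\<^bsub>bar_units\<^esub>}" by blast
  next
    fix U :: "'a mat" assume "U \<in> {U \<in> carrier (AffG_grp p q). K1_det U = \<one>\<^bsub>bar_units\<^esub>}"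
    then obtain T N where U: "U = aff p q T N" "T \<in> carrier (G_grp q)" "N \<in> carrier_mat p q"
      and "K1_det U = \<one>\<^bsub>bar_units\<^esub>"
      unfolding AffG_grp_def carrier_Aff_grp by blast
    then have "T \<in> carrier (SG_grp q)"
      unfolding SG_subset_G using K1_det_aff[OF in_G_grp_GL[OF U(2)] U(3)] by simp
    then show "U \<in> carrier (AffSG_grp p q)"
      unfolding AffSG_grp_def carrier_Aff_grp using U by blast
  qed
  moreover have "AffSG_grp p q = (GL (q + p) :: 'a mat monoid)\<lparr>carrier := carrier (AffSG_grp p q)\<rparr>"
    by (simp add: AffSG_grp_def Aff_grp_def)
  ultimately show ?thesis by (rule subst)
qed

lemma AffG_grp_eq: "AffG_grp p q = (GL (q + p))\<lparr>carrier := carrier (AffG_grp p q)\<rparr>"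
  by (simp add: AffG_grp_def Aff_grp_def)

lemma abelian_extension_AffG:
  assumes "q \<ge> 1"
  shows "abelian_extension (GL (q + p) :: 'a::{ring,monoid_mult} mat monoid) bar_units (carrier (AffG_grp p q)) K1_det"
proof -
  interpret group "GL (q + p) :: 'a mat monoid" by (rule group_GL)
  interpret Q: comm_group "bar_units :: 'a K1_monoid" by (rule comm_group_bar_units)
  have det: "K1_det U \<in> carrier bar_units" "U \<in> carrier (GL (q + p))"
    if U: "U \<in> carrier (AffG_grp p q)" for U :: "'a mat"
  proof -
    obtain T N where TN: "U = aff p q T N" "T \<in> carrier (G_grp q)" "N \<in> carrier_mat p q"
      using U unfolding AffG_grp_def carrier_Aff_grp by blast
    show "K1_det U \<in> carrier bar_units"
      unfolding TN(1) K1_det_aff[OF in_G_grp_GL[OF TN(2)] TN(3)] using TN(2) by (simp add: G_grp_def)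
    show "U \<in> carrier (GL (q + p))"
      unfolding TN(1) by (rule aff_GL(1)[OF in_G_grp_GL[OF TN(2)] TN(3)])
  qed
  show ?thesis
  proof (intro abelian_extension.intro abelian_extension_axioms.intro)
    show "subgroup (carrier (AffG_grp p q)) (GL (q + p) :: 'a mat monoid)"
      unfolding AffG_grp_def by (rule subgroup_Aff_grp[OF subgroup_G_grp])
    show "K1_det \<in> hom (GL (q + p)\<lparr>carrier := carrier (AffG_grp p q)\<rparr>) (bar_units :: 'a K1_monoid)"
      by (rule homI) (simp_all add: det K1_det_mult[OF det(2) det(2)])
    have "\<exists>U\<in>carrier (AffG_grp p q :: 'a mat monoid). K1_det U = a" if a: "a \<in> carrier bar_units" for a
    proof -
      obtain T :: "'a mat" where T: "T \<in> carrier (G_grp q)" "K1_det T = a"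
        using G_grp_representative[OF assms a] by blast
      have "aff p q T (0\<^sub>m p q) \<in> carrier (AffG_grp p q)"
        using T(1) zero_carrier_mat by (force simp: AffG_grp_def carrier_Aff_grp)
      then show ?thesis using K1_det_aff[OF in_G_grp_GL[OF T(1)] zero_carrier_mat, of p] T(2) by blast
    qed
    then show "K1_det ` carrier (AffG_grp p q) = carrier (bar_units :: 'a K1_monoid)"
      using det by force
  qed (rule is_group Q.comm_group_axioms)+
qed

section \<open>Scaling the translations is a polynomial operation\<close>

definition linear_part :: "nat \<Rightarrow> 'a mat \<Rightarrow> 'a mat" where
  "linear_part q U = mat q q (\<lambda>(i, j). U $$ (i, j))"

definition translation_part :: "nat \<Rightarrow> nat \<Rightarrow> 'a mat \<Rightarrow> 'a mat" where
  "translation_part p q U = mat p q (\<lambda>(i, j). U $$ (q + i, j))"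

text \<open>The operation \<open>\<psi>\<^sub>u\<close> of the overview for an arbitrary ring
  element \<open>u\<close>; sums of the scalars, including 0, need not be units.\<close>

definition scale_translation :: "nat \<Rightarrow> nat \<Rightarrow> 'a::{ring,monoid_mult} \<Rightarrow> 'a mat \<Rightarrow> 'a mat" where
  "scale_translation p q u U = aff p q (linear_part q U) (scalar_mat p u * translation_part p q U)"

lemma linear_part_aff: "T \<in> carrier_mat q q \<Longrightarrow> linear_part q (aff p q T N) = T"
  by (rule eq_matI) (auto simp: linear_part_def aff_def)

lemma translation_part_aff:
  "T \<in> carrier_mat q q \<Longrightarrow> N \<in> carrier_mat p q \<Longrightarrow> translation_part p q (aff p q T N) = N"
  by (rule eq_matI) (auto simp: translation_part_def aff_def)

lemma scale_translation_aff:
  "T \<in> carrier_mat q q \<Longrightarrow> N \<in> carrier_mat p q \<Longrightarrow>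
    scale_translation p q u (aff p q T N) = aff p q T (scalar_mat p u * N)"
  by (simp add: scale_translation_def linear_part_aff translation_part_aff)

lemma subgroup_SG_grp: "subgroup (carrier (SG_grp q)) (GL q :: 'a::{ring,monoid_mult} mat monoid)"
proof -
  interpret K: comm_group "K1 :: 'a K1_monoid" by (rule comm_group_K1)
  interpret h: group_hom "GL q" "K1 :: 'a K1_monoid" K1_det
    by (intro group_hom.intro group_hom_axioms.intro group_GL K.is_group K1_det_hom)
  show ?thesis
    using h.subgroup_kernel by (simp add: SG_grp_def)
qed

lemma group_SG_grp: "group (SG_grp q :: 'a::{ring,monoid_mult} mat monoid)"
  using group.subgroup_imp_group[OF group_GL subgroup_SG_grp] by (simp add: SG_grp_def)

lemma SG_mat: "T \<in> carrier (SG_grp q) \<Longrightarrow> T \<in> carrier_mat q q"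
  by (simp add: in_SG_grp GL_mat)

lemma mult_SG [simp]: "mult (SG_grp q) = (*)" and one_SG [simp]: "\<one>\<^bsub>SG_grp q\<^esub> = 1\<^sub>m q"
  by (simp_all add: SG_grp_def fun_eq_iff)

lemma mult_AffSG [simp]: "mult (AffSG_grp p q) = (*)"
  by (simp add: AffSG_grp_def Aff_grp_def fun_eq_iff)

lemma in_AffSG:
  "U \<in> carrier (AffSG_grp p q) \<longleftrightarrow> (\<exists>T N. U = aff p q T N \<and> T \<in> carrier (SG_grp q) \<and> N \<in> carrier_mat p q)"
  by (simp add: AffSG_grp_def carrier_Aff_grp)

lemma group_AffSG: "group (AffSG_grp p q :: 'a::{ring,monoid_mult} mat monoid)"
  using group.subgroup_imp_group[OF group_GL subgroup_Aff_grp[OF subgroup_SG_grp]]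
  by (simp add: AffSG_grp_def Aff_grp_def)

lemma AffSG_homI:
  fixes f :: "'a::{ring,monoid_mult} mat \<Rightarrow> 'b"
  assumes "\<And>T N. T \<in> carrier (SG_grp q) \<Longrightarrow> N \<in> carrier_mat p q \<Longrightarrow> f (aff p q T N) \<in> carrier H"
    and "\<And>T N T' N'. T \<in> carrier (SG_grp q) \<Longrightarrow> N \<in> carrier_mat p q \<Longrightarrow> T' \<in> carrier (SG_grp q) \<Longrightarrow>
      N' \<in> carrier_mat p q \<Longrightarrow>
      f (aff p q (T * T') (N * T' + N')) = f (aff p q T N) \<otimes>\<^bsub>H\<^esub> f (aff p q T' N')"
  shows "f \<in> hom (AffSG_grp p q) H"
proof (rule homI)
  fix U assume "U \<in> carrier (AffSG_grp p q :: 'a mat monoid)"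
  then obtain T N where U: "U = aff p q T N" "T \<in> carrier (SG_grp q)" "N \<in> carrier_mat p q"
    unfolding in_AffSG by blast
  show "f U \<in> carrier H" unfolding U(1) by (rule assms(1)[OF U(2,3)])
  fix U' assume "U' \<in> carrier (AffSG_grp p q :: 'a mat monoid)"
  then obtain T' N' where U': "U' = aff p q T' N'" "T' \<in> carrier (SG_grp q)" "N' \<in> carrier_mat p q"
    unfolding in_AffSG by blast
  show "f (U \<otimes>\<^bsub>AffSG_grp p q\<^esub> U') = f U \<otimes>\<^bsub>H\<^esub> f U'"
    unfolding U(1) U'(1) mult_AffSG aff_mult[OF SG_mat[OF U(2)] SG_mat[OF U'(2)] U(3) U'(3)]
    by (rule assms(2)[OF U(2,3) U'(2,3)])
qed

lemma SG_mult_closed: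
  "T \<in> carrier (SG_grp q) \<Longrightarrow> T' \<in> carrier (SG_grp q) \<Longrightarrow> (T * T' :: 'a::{ring,monoid_mult} mat) \<in> carrier (SG_grp q)"
  using monoid.m_closed[OF group.is_monoid[OF group_SG_grp], of T q T'] by simp

lemma linear_part_hom: "linear_part q \<in> hom (AffSG_grp p q) (SG_grp q :: 'a::{ring,monoid_mult} mat monoid)"
  by (rule AffSG_homI) (simp_all add: linear_part_aff SG_mat SG_mult_closed)

lemma SG_to_Aff_eq: "SG_to_Aff p q M = aff p q M (0\<^sub>m p q)"
  by (simp add: SG_to_Aff_def aff_def)

lemma SG_to_Aff_hom: "SG_to_Aff p q \<in> hom (SG_grp q) (AffSG_grp p q :: 'a::{ring,monoid_mult} mat monoid)"
proof (rule homI)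
  fix T T' :: "'a mat" assume T: "T \<in> carrier (SG_grp q)" "T' \<in> carrier (SG_grp q)"
  show "SG_to_Aff p q T \<in> carrier (AffSG_grp p q)"
    unfolding SG_to_Aff_eq in_AffSG using T(1) zero_carrier_mat by blast
  show "SG_to_Aff p q (T \<otimes>\<^bsub>SG_grp q\<^esub> T') = SG_to_Aff p q T \<otimes>\<^bsub>AffSG_grp p q\<^esub> SG_to_Aff p q T'"
    unfolding SG_to_Aff_eq mult_AffSG mult_SG
      aff_mult[OF SG_mat[OF T(1)] SG_mat[OF T(2)] zero_carrier_mat zero_carrier_mat]
    using SG_mat[OF T(2)] by simp
qed

text \<open>The module in \<open>semidirect\<close> is a whole type, so translations become
  functions on all pairs of indices. Columns from \<open>q\<close> on are left alone so that the
  identity matrix acts trivially on every such function.\<close>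

definition matrix_act ::
    "nat \<Rightarrow> ('i \<Rightarrow> nat \<times> nat \<Rightarrow> 'a::{ring,monoid_mult}) \<Rightarrow> 'a mat \<Rightarrow> ('i \<Rightarrow> nat \<times> nat \<Rightarrow> 'a)" where
  "matrix_act q v T = (\<lambda>i (a, b). if b < q then \<Sum>c<q. v i (a, c) * T $$ (c, b) else v i (a, b))"

definition coordinate :: "'i \<Rightarrow> ('i \<Rightarrow> nat \<times> nat \<Rightarrow> 'a::zero) \<Rightarrow> ('i \<Rightarrow> nat \<times> nat \<Rightarrow> 'a)" where
  "coordinate j v = (\<lambda>i. if i = j then v i else 0)"

lemma semidirect_matrix_act:
  "semidirect (SG_grp q :: 'a::{ring,monoid_mult} mat monoid) (matrix_act q) (coordinate :: 'i \<Rightarrow> _)"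
proof (rule semidirect.intro)
  show "monoid (SG_grp q :: 'a mat monoid)" by (rule group.is_monoid[OF group_SG_grp])
  fix T T' :: "'a mat" and v w :: "'i \<Rightarrow> nat \<times> nat \<Rightarrow> 'a" and i j :: 'i
  assume T: "T \<in> carrier (SG_grp q)"
  show "matrix_act q (v + w) T = matrix_act q v T + matrix_act q w T"
    by (auto simp: matrix_act_def fun_eq_iff distrib_right sum.distrib)
  show "coordinate i (matrix_act q v T) = matrix_act q (coordinate i v) T"
    by (auto simp: coordinate_def matrix_act_def fun_eq_iff)
  assume T': "T' \<in> carrier (SG_grp q)"
  have "(\<Sum>c<q. v i (a, c) * (T * T') $$ (c, b)) = (\<Sum>d<q. (\<Sum>c<q. v i (a, c) * T $$ (c, d)) * T' $$ (d, b))"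
    if "b < q" for i a b
  proof -
    have "(\<Sum>c<q. v i (a, c) * (T * T') $$ (c, b)) = (\<Sum>c<q. \<Sum>d<q. v i (a, c) * (T $$ (c, d) * T' $$ (d, b)))"
      by (rule sum.cong)
         (use index_mult_mat_sum[OF SG_mat[OF T] SG_mat[OF T']] that in \<open>auto simp: sum_distrib_left\<close>)
    also have "\<dots> = (\<Sum>d<q. (\<Sum>c<q. v i (a, c) * T $$ (c, d)) * T' $$ (d, b))"
      by (subst sum.swap) (simp add: sum_distrib_right mult.assoc)
    finally show ?thesis .
  qed
  then show "matrix_act q v (T \<otimes>\<^bsub>SG_grp q\<^esub> T') = matrix_act q (matrix_act q v T) T'"
    by (auto simp: matrix_act_def fun_eq_iff)
next
  fix v w :: "'i \<Rightarrow> nat \<times> nat \<Rightarrow> 'a" and i j :: 'i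
  have "(\<Sum>c<q. v i (a, c) * 1\<^sub>m q $$ (c, b)) = v i (a, b)" if "b < q" for i a b
  proof -
    have "(\<Sum>c<q. v i (a, c) * 1\<^sub>m q $$ (c, b)) = (\<Sum>c<q. if c = b then v i (a, c) else 0)"
      by (rule sum.cong) (use that in auto)
    then show ?thesis using that by simp
  qed
  then show "matrix_act q v \<one>\<^bsub>SG_grp q\<^esub> = v"
    by (auto simp: matrix_act_def fun_eq_iff)
  show "coordinate i (v + w) = coordinate i v + coordinate i w"
    by (auto simp: coordinate_def fun_eq_iff)
  show "coordinate i (coordinate j v) = (if i = j then coordinate j v else 0)"
    by (auto simp: coordinate_def fun_eq_iff)
qed

definition spread ::
    "nat \<Rightarrow> nat \<Rightarrow> 'i set \<Rightarrow> ('i \<Rightarrow> 'a::{ring,monoid_mult}) \<Rightarrow> 'a mat \<Rightarrow> 'a mat \<times> ('i \<Rightarrow> nat \<times> nat \<Rightarrow> 'a)" where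
  "spread p q B X U = (linear_part q U,
     \<lambda>i (a, b). if i \<in> B \<and> a < p \<and> b < q then X i * translation_part p q U $$ (a, b) else 0)"

definition collect ::
    "nat \<Rightarrow> nat \<Rightarrow> 'i set \<Rightarrow> 'a::{ring,monoid_mult} mat \<times> ('i \<Rightarrow> nat \<times> nat \<Rightarrow> 'a) \<Rightarrow> 'a mat" where
  "collect p q B g = aff p q (fst g) (mat p q (\<lambda>(a, b). \<Sum>i\<in>B. snd g i (a, b)))"

text \<open>\<open>spread\<close> sends \<open>N\<close> to the family of the \<open>X i\<close>
  multiples of \<open>N\<close>, one in each copy of the translation module, and
  \<open>collect\<close> adds the copies. Killing the copies in \<open>J\<close> in between leaves
  the scalar \<open>\<Sum>i\<in>B - J. X i\<close>, so this chain is the image under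
  \<open>collect\<close> of a cross effect.\<close>

lemma scale_translation_cross_effect:
  fixes X :: "'i \<Rightarrow> 'a::{ring,monoid_mult}"
  assumes B: "finite B" "r < card B" and z: "z \<in> carrier (bar_cycles r (AffSG_grp p q))"
  shows "(\<Sum>J\<in>Pow B. frag_cmul ((-1) ^ card J) (chain_map (map (scale_translation p q (\<Sum>i\<in>B - J. X i))) z))
    \<in> bar_boundaries r (AffSG_grp p q)"
proof -
  interpret sd: semidirect "SG_grp q :: 'a mat monoid" "matrix_act q" "coordinate :: 'i \<Rightarrow> _"
    by (rule semidirect_matrix_act)
  let ?P = sd.semidirect_product
  have mult_P: "g \<otimes>\<^bsub>?P\<^esub> h = (fst g * fst h, matrix_act q (snd g) (fst h) + snd h)" for g h
    using sd.mult_def'[of g h] by simp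
  have spread_aff: "spread p q B X (aff p q T N) =
      (T, \<lambda>i (a, b). if i \<in> B \<and> a < p \<and> b < q then X i * N $$ (a, b) else 0)"
    if "T \<in> carrier_mat q q" "N \<in> carrier_mat p q" for T N
    unfolding spread_def linear_part_aff[OF that(1)] translation_part_aff[OF that] ..
  \<comment> \<open>Scaling on the left commutes with the action of the linear part on the
    right.\<close>
  have spread_hom: "spread p q B X \<in> hom (AffSG_grp p q) ?P"
  proof (rule AffSG_homI)
    fix T N assume "T \<in> carrier (SG_grp q :: 'a mat monoid)" "(N :: 'a mat) \<in> carrier_mat p q"
    then show "spread p q B X (aff p q T N) \<in> carrier ?P"
      by (simp add: spread_aff SG_mat sd.C_iff)
  next
    fix T N T' N' :: "'a mat"
    assume T: "T \<in> carrier (SG_grp q)" "T' \<in> carrier (SG_grp q)"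
      and N: "N \<in> carrier_mat p q" "N' \<in> carrier_mat p q"
    note Tm = T[THEN SG_mat]
    have NT: "N * T' + N' \<in> carrier_mat p q" using Tm N by simp
    have ent: "X i * (N * T' + N') $$ (a, b) = (\<Sum>c<q. X i * N $$ (a, c) * T' $$ (c, b)) + X i * N' $$ (a, b)"
      if "a < p" "b < q" for i a b
      using that N Tm index_mult_mat_sum[OF N(1) Tm(2), of a b]
      by (simp add: distrib_left sum_distrib_left mult.assoc)
    show "spread p q B X (aff p q (T * T') (N * T' + N')) =
        spread p q B X (aff p q T N) \<otimes>\<^bsub>?P\<^esub> spread p q B X (aff p q T' N')"
      unfolding mult_P spread_aff[OF Tm(1) N(1)] spread_aff[OF Tm(2) N(2)]
        spread_aff[OF mult_carrier_mat[OF Tm] NT]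
      by (auto simp: fun_eq_iff matrix_act_def ent simp del: index_add_mat index_mult_mat)
  qed
  have collect_hom: "collect p q B \<in> hom ?P (AffSG_grp p q)"
  proof (rule homI)
    fix g h :: "'a mat \<times> ('i \<Rightarrow> nat \<times> nat \<Rightarrow> 'a)" assume "g \<in> carrier ?P"
    then have g: "fst g \<in> carrier (SG_grp q)" by (simp add: sd.C_iff)
    then show "collect p q B g \<in> carrier (AffSG_grp p q)"
      unfolding collect_def in_AffSG by (auto intro: mat_carrier)
    assume "h \<in> carrier ?P"
    then have h: "fst h \<in> carrier (SG_grp q)" by (simp add: sd.C_iff)
    let ?N = "\<lambda>v. mat p q (\<lambda>(a, b). \<Sum>i\<in>B. v i (a, b))"
    have "?N (matrix_act q (snd g) (fst h) + snd h) = ?N (snd g) * fst h + ?N (snd h)"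
    proof (rule eq_matI)
      fix a b assume "a < dim_row (?N (snd g) * fst h + ?N (snd h))" "b < dim_col (?N (snd g) * fst h + ?N (snd h))"
      then have ab: "a < p" "b < q" by auto
      have "(?N (snd g) * fst h) $$ (a, b) = (\<Sum>c<q. (\<Sum>i\<in>B. snd g i (a, c)) * fst h $$ (c, b))"
        using index_mult_mat_sum[OF mat_carrier SG_mat[OF h] ab, of "\<lambda>(a, b). \<Sum>i\<in>B. snd g i (a, b)"] ab
        by simp
      also have "\<dots> = (\<Sum>i\<in>B. \<Sum>c<q. snd g i (a, c) * fst h $$ (c, b))"
        by (simp add: sum_distrib_right) (rule sum.swap)
      finally show "?N (matrix_act q (snd g) (fst h) + snd h) $$ (a, b) =
          (?N (snd g) * fst h + ?N (snd h)) $$ (a, b)"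
        using ab SG_mat[OF h] by (simp add: matrix_act_def sum.distrib del: index_mult_mat(1))
    qed (use SG_mat[OF h] in auto)
    then show "collect p q B (g \<otimes>\<^bsub>?P\<^esub> h) = collect p q B g \<otimes>\<^bsub>AffSG_grp p q\<^esub> collect p q B h"
      unfolding collect_def mult_P mult_AffSG fst_conv snd_conv
      using aff_mult[OF SG_mat[OF g] SG_mat[OF h]] by simp
  qed
  have collect_spread: "collect p q B (sd.kill_group J (spread p q B X U)) = scale_translation p q (\<Sum>i\<in>B - J. X i) U"
    if J: "J \<subseteq> B" and U: "U \<in> carrier (AffSG_grp p q)" for J U
  proof -
    obtain T N where TN: "U = aff p q T N" "T \<in> carrier (SG_grp q)" "N \<in> carrier_mat p q"
      using U unfolding in_AffSG by blast
    have "finite J" using J B(1) finite_subset by blast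
    then have kill: "sd.kill J v = (\<lambda>i. if i \<in> J then 0 else v i)" for v :: "'i \<Rightarrow> nat \<times> nat \<Rightarrow> 'a"
    proof -
      have "(\<Sum>j\<in>J. coordinate j v) i = (if i \<in> J then v i else 0)" for i
      proof -
        have "(\<Sum>j\<in>J. coordinate j v) i = (\<Sum>j\<in>J. coordinate j v i)"
          by (induction J rule: infinite_finite_induct) simp_all
        also have "\<dots> = (\<Sum>j\<in>J. if i = j then v i else 0)"
          by (simp add: coordinate_def)
        finally show ?thesis using \<open>finite J\<close> by simp
      qed
      then show ?thesis by (auto simp: sd.kill_def sd.Pis_def fun_eq_iff)
    qed
    have "mat p q (\<lambda>(a, b). \<Sum>i\<in>B. (if i \<in> J then 0 else
        (\<lambda>(a, b). if i \<in> B \<and> a < p \<and> b < q then X i * N $$ (a, b) else 0)) (a, b)) =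
      scalar_mat p (\<Sum>i\<in>B - J. X i) * N"
    proof (rule eq_matI)
      fix a b assume "a < dim_row (scalar_mat p (\<Sum>i\<in>B - J. X i) * N)" "b < dim_col (scalar_mat p (\<Sum>i\<in>B - J. X i) * N)"
      then have ab: "a < p" "b < q" using TN(3) by (auto simp: scalar_mat_def)
      have "(\<Sum>i\<in>B. (if i \<in> J then 0 else
          (\<lambda>(a, b). if i \<in> B \<and> a < p \<and> b < q then X i * N $$ (a, b) else 0)) (a, b)) =
          (\<Sum>i\<in>B - J. X i * N $$ (a, b))"
        by (rule sum.mono_neutral_cong_right) (use B(1) ab in auto)
      then show "mat p q (\<lambda>(a, b). \<Sum>i\<in>B. (if i \<in> J then 0 else
          (\<lambda>(a, b). if i \<in> B \<and> a < p \<and> b < q then X i * N $$ (a, b) else 0)) (a, b)) $$ (a, b) =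
          (scalar_mat p (\<Sum>i\<in>B - J. X i) * N) $$ (a, b)"
        using ab unfolding scalar_mat_mult[OF TN(3)] by (simp add: sum_distrib_right)
    qed (use TN(3) in \<open>auto simp: scalar_mat_def\<close>)
    then show ?thesis
      unfolding TN(1) spread_aff[OF SG_mat[OF TN(2)] TN(3)] scale_translation_aff[OF SG_mat[OF TN(2)] TN(3)]
      by (simp add: collect_def sd.kill_group_def kill)
  qed
  have keys_z: "\<And>gs. gs \<in> keys z \<Longrightarrow> set gs \<subseteq> carrier (AffSG_grp p q)"
    using z by (auto simp: bar_cycles_iff bar_chains_iff)
  have "chain_map (map (collect p q B))
      (\<Sum>J\<in>Pow B. frag_cmul ((-1) ^ card J) (chain_map (map (sd.kill_group J)) (chain_map (map (spread p q B X)) z)))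
    \<in> bar_boundaries r (AffSG_grp p q)"
    by (intro bar_boundaries_map[OF collect_hom] sd.cross_effect_vanishes B bar_cycles_map[OF spread_hom z])
  moreover have "chain_map (map (collect p q B))
      (\<Sum>J\<in>Pow B. frag_cmul ((-1) ^ card J) (chain_map (map (sd.kill_group J)) (chain_map (map (spread p q B X)) z))) =
    (\<Sum>J\<in>Pow B. frag_cmul ((-1) ^ card J) (chain_map (map (scale_translation p q (\<Sum>i\<in>B - J. X i))) z))"
    unfolding chain_map_sum
  proof (rule sum.cong[OF refl])
    fix J assume J: "J \<in> Pow B"
    have "chain_map (map (collect p q B)) (chain_map (map (sd.kill_group J)) (chain_map (map (spread p q B X)) z)) =
        chain_map (map (scale_translation p q (\<Sum>i\<in>B - J. X i))) z"
      unfolding chain_map_compose map_map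
      by (rule chain_map_cong) (use J keys_z collect_spread in \<open>auto simp: subset_iff\<close>)
    then show "chain_map (map (collect p q B)) (frag_cmul ((-1) ^ card J)
          (chain_map (map (sd.kill_group J)) (chain_map (map (spread p q B X)) z))) =
        frag_cmul ((-1) ^ card J) (chain_map (map (scale_translation p q (\<Sum>i\<in>B - J. X i))) z)"
      by (simp add: chain_map_cmul)
  qed
  ultimately show ?thesis by simp
qed

section \<open>Inclusion and exclusion: from sets of words to sets of letters\<close>

definition deviation :: "('i set \<Rightarrow> ('x \<Rightarrow>\<^sub>0 int)) \<Rightarrow> 'i set \<Rightarrow> ('x \<Rightarrow>\<^sub>0 int)" where
  "deviation f B = (\<Sum>J\<in>Pow B. frag_cmul ((-1) ^ card J) (f (B - J)))"

lemma deviation_insert: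
  assumes "finite B" "a \<notin> B"
  shows "deviation f (insert a B) = deviation (\<lambda>D. f (insert a D)) B - deviation f B"
proof -
  have "frag_cmul ((-1) ^ card (insert a J)) (f (insert a B - insert a J)) = - frag_cmul ((-1) ^ card J) (f (B - J))"
    if "J \<in> Pow B" for J
  proof -
    have "finite J" "a \<notin> J" "insert a B - insert a J = B - J"
      using that assms finite_subset by auto
    then show ?thesis by simp
  qed
  then have "(\<Sum>J\<in>Pow B. frag_cmul ((-1) ^ card (insert a J)) (f (insert a B - insert a J))) = - deviation f B"
    by (simp add: deviation_def flip: sum_negf del: minus_frag_cmul)
  moreover have "(\<Sum>J\<in>Pow B. frag_cmul ((-1) ^ card J) (f (insert a B - J))) = deviation (\<lambda>D. f (insert a D)) B"
    unfolding deviation_def by (rule sum.cong) (use assms in \<open>auto simp: insert_Diff_if\<close>)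
  ultimately show ?thesis
    unfolding deviation_def[of f "insert a B"] sum_Pow_insert[OF assms] by simp
qed

text \<open>Moebius inversion over subsets. By \<open>deviation_insert\<close> the terms containing
  \<open>a\<close> absorb those without it and leave the sum for the function
  \<open>\<lambda>D. f (insert a D)\<close>.\<close>

lemma sum_deviation: "finite A \<Longrightarrow> (\<Sum>B\<in>Pow A. deviation f B) = f A"
proof (induction A arbitrary: f rule: finite_induct)
  case (insert a A)
  have "(\<Sum>B\<in>Pow A. deviation f (insert a B)) = (\<Sum>B\<in>Pow A. deviation (\<lambda>D. f (insert a D)) B - deviation f B)"
    by (rule sum.cong) (use insert finite_subset in \<open>auto intro!: deviation_insert\<close>)
  then show ?case
    using insert by (simp add: sum_Pow_insert sum_subtractf)
qed (simp add: deviation_def)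

text \<open>Toggling an element of \<open>M - I\<close> pairs the supersets of \<open>I\<close> with
  opposite signs.\<close>

lemma alternating_sum_supersets:
  assumes "finite M" "I \<subseteq> M" "I \<noteq> M"
  shows "(\<Sum>J\<in>Pow M. if I \<subseteq> J then frag_cmul ((-1) ^ card J) x else 0) = 0"
proof -
  obtain a where a: "a \<in> M" "a \<notin> I" using assms by blast
  define M' where "M' = M - {a}"
  have M: "M = insert a M'" "finite M'" "a \<notin> M'" using a assms by (auto simp: M'_def)
  have "(if I \<subseteq> insert a J then frag_cmul ((-1) ^ card (insert a J)) x else 0) =
      - (if I \<subseteq> J then frag_cmul ((-1) ^ card J) x else 0)" if "J \<in> Pow M'" for J
  proof -
    have "finite J" "a \<notin> J" using that M finite_subset by auto
    then show ?thesis using a by (auto simp: subset_insert)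
  qed
  then show ?thesis
    unfolding M(1) using M by (simp add: sum_Pow_insert sum_negf)
qed

text \<open>Keeping the words as lists records the order of the factors and counts equal products
  separately.\<close>

lemma sum_prod_list:
  fixes X :: "'i \<Rightarrow> 'a::{ring,monoid_mult}"
  assumes "finite J"
  shows "(\<Sum>xs | length xs = l \<and> set xs \<subseteq> J. prod_list (map X xs)) = (\<Sum>j\<in>J. X j) ^ l"
proof (induction l)
  case (Suc l)
  let ?W = "\<lambda>l. {xs. length xs = l \<and> set xs \<subseteq> J}"
  have "?W (Suc l) = (\<lambda>(j, xs). j # xs) ` (J \<times> ?W l)"
    by (auto simp: length_Suc_conv image_iff)
  then have "(\<Sum>xs\<in>?W (Suc l). prod_list (map X xs)) = (\<Sum>(j, xs)\<in>J \<times> ?W l. X j * prod_list (map X xs))"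
    by (simp add: sum.reindex inj_on_def case_prod_unfold)
  also have "\<dots> = (\<Sum>j\<in>J. X j) * (\<Sum>xs\<in>?W l. prod_list (map X xs))"
    by (simp add: sum_product sum.cartesian_product)
  finally show ?case using Suc by simp
qed (simp add: Collect_conv_if cong: conj_cong)

text \<open>
  The deviations vanish on sets of more than \<open>r\<close> words of length \<open>l\<close>, and at most \<open>r\<close> such words
  cannot involve all elements of \<open>M\<close>.
\<close>

lemma alternating_scale_translation:
  fixes X :: "'i \<Rightarrow> 'a::{ring,monoid_mult}"
  assumes M: "finite M" "r * l < card M" and z: "z \<in> carrier (bar_cycles r (AffSG_grp p q))"
  shows "(\<Sum>J\<in>Pow M. frag_cmul ((-1) ^ card J) (chain_map (map (scale_translation p q ((\<Sum>j\<in>J. X j) ^ l))) z))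
    \<in> bar_boundaries r (AffSG_grp p q)"
proof -
  interpret group "AffSG_grp p q :: 'a mat monoid" by (rule group_AffSG)
  \<comment> \<open>The power of a sum over \<open>J\<close> is a plain sum over the set of words
    \<open>W J\<close>. In terms of words the scalar is additive, and so the cross effect bound
    applies to sets of words.\<close>
  define W where "W J = {xs. length xs = l \<and> set xs \<subseteq> J}" for J :: "'i set"
  define f where "f D = chain_map (map (scale_translation p q (\<Sum>xs\<in>D. prod_list (map X xs)))) z" for D
  have fin_W: "finite (W J)" if "J \<subseteq> M" for J
    using finite_lists_length_eq[OF finite_subset[OF that M(1)], of l] by (simp add: W_def conj_commute)
  have dev: "deviation f B \<in> bar_boundaries r (AffSG_grp p q)" if "B \<subseteq> W M" "r < card B" for B
    unfolding deviation_def f_def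
    by (rule scale_translation_cross_effect[OF _ that(2) z]) (use fin_W[of M] that(1) finite_subset in auto)
  have f_W: "f (W J) = chain_map (map (scale_translation p q ((\<Sum>j\<in>J. X j) ^ l))) z" if "J \<subseteq> M" for J
    unfolding f_def W_def by (simp only: sum_prod_list[OF finite_subset[OF that M(1)]])
  \<comment> \<open>A set of words over \<open>M\<close> consists of words over \<open>J\<close>
    exactly when all its letters lie in \<open>J\<close>; this isolates the dependence on
    \<open>J\<close> in one inclusion.\<close>
  have expand: "f (W J) = (\<Sum>B\<in>Pow (W M). if \<Union>(set ` B) \<subseteq> J then deviation f B else 0)" if J: "J \<subseteq> M" for J
  proof -
    have "f (W J) = (\<Sum>B\<in>Pow (W J). deviation f B)"
      by (rule sum_deviation[OF fin_W[OF J], symmetric])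
    also have "\<dots> = (\<Sum>B\<in>Pow (W M). if \<Union>(set ` B) \<subseteq> J then deviation f B else 0)"
      by (rule sum.mono_neutral_cong_left) (use fin_W[of M] J in \<open>auto simp: W_def\<close>)
    finally show ?thesis .
  qed
  have "(\<Sum>J\<in>Pow M. frag_cmul ((-1) ^ card J) (f (W J))) =
      (\<Sum>J\<in>Pow M. \<Sum>B\<in>Pow (W M). if \<Union>(set ` B) \<subseteq> J then frag_cmul ((-1) ^ card J) (deviation f B) else 0)"
    by (rule sum.cong) (auto simp: expand frag_cmul_sum intro!: sum.cong)
  also have "\<dots> = (\<Sum>B\<in>Pow (W M). \<Sum>J\<in>Pow M. if \<Union>(set ` B) \<subseteq> J then frag_cmul ((-1) ^ card J) (deviation f B) else 0)"
    by (rule sum.swap)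
  finally have "(\<Sum>J\<in>Pow M. frag_cmul ((-1) ^ card J) (f (W J))) =
    (\<Sum>B\<in>Pow (W M). \<Sum>J\<in>Pow M. if \<Union>(set ` B) \<subseteq> J then frag_cmul ((-1) ^ card J) (deviation f B) else 0)" .
  moreover have "\<dots> \<in> bar_boundaries r (AffSG_grp p q)"
  proof (rule bar_boundaries_sum)
    fix B assume "B \<in> Pow (W M)"
    then have B: "B \<subseteq> W M" "finite B" using fin_W[of M] finite_subset by auto
    have sub: "\<Union>(set ` B) \<subseteq> M" using B(1) by (auto simp: W_def)
    show "(\<Sum>J\<in>Pow M. if \<Union>(set ` B) \<subseteq> J then frag_cmul ((-1) ^ card J) (deviation f B) else 0)
        \<in> bar_boundaries r (AffSG_grp p q)"
    proof (cases "\<Union>(set ` B) = M")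
      \<comment> \<open>For a fixed \<open>B\<close> only the sign depends on \<open>J\<close>, and
        the signs over all \<open>J\<close> above a proper subset of \<open>M\<close> add up to
        zero.\<close>
      case False
      then show ?thesis
        using alternating_sum_supersets[OF M(1) sub False, of "deviation f B"] bar_boundaries_0 by simp
    next
      case True
      have "card M \<le> (\<Sum>xs\<in>B. card (set xs))"
        unfolding True[symmetric] by (rule card_UN_le[OF B(2)])
      also have "\<dots> \<le> (\<Sum>xs\<in>B. l)"
        by (rule sum_mono) (use B(1) card_length in \<open>force simp: W_def\<close>)
      finally have "card M \<le> card B * l" by simp
      with M(2) have "r * l < card B * l" by (rule less_le_trans)
      then have "r < card B" by simp
      then show ?thesis
        by (intro bar_boundaries_sum) (use dev[OF B(1)] bar_boundaries_0 bar_boundaries_cmul in auto)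
    qed
  qed
  moreover have "(\<Sum>J\<in>Pow M. frag_cmul ((-1) ^ card J) (f (W J))) =
      (\<Sum>J\<in>Pow M. frag_cmul ((-1) ^ card J) (chain_map (map (scale_translation p q ((\<Sum>j\<in>J. X j) ^ l))) z))"
    by (rule sum.cong) (simp_all add: f_W)
  ultimately show ?thesis by simp
qed

section \<open>The element \<open>s\<close> and the main theorem\<close>

text \<open>Each variable in \<open>J\<close> occurs with coefficient 1. A zero denominator would
  make the fraction \<open>Fract 1 (Xsum J)\<close> zero instead of an inverse.\<close>

lemma Xsum_nonzero:
  assumes "finite J" "J \<noteq> {}"
  shows "Xsum J \<noteq> 0"
proof -
  obtain j where j: "j \<in> J" using assms by blast
  let ?e = "Poly_Mapping.single j (1::nat)"
  have "lookup (Xsum J) ?e = (\<Sum>i\<in>J. lookup (Xvar i) ?e)"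
    by (simp add: Xsum_def lookup_sum)
  also have "\<dots> = (\<Sum>i\<in>J. if i = j then 1 else 0)"
  proof (rule sum.cong[OF refl])
    fix i
    have "Poly_Mapping.single i (1::nat) = ?e \<longleftrightarrow> i = j"
      by (metis lookup_single_eq lookup_single_not_eq one_neq_zero)
    then show "lookup (Xvar i) ?e = (if i = j then 1 else 0)"
      by (auto simp: Xvar_def lookup_single when_def)
  qed
  also have "\<dots> = 1" using assms(1) j by simp
  finally show ?thesis by auto
qed

lemma finite_nonempty_subsets: "finite (nonempty_subsets m)"
  by (simp add: nonempty_subsets_def)

lemma Xsum_int_polys: "J \<subseteq> {1..m} \<Longrightarrow> Xsum J \<in> int_polys m"
proof -
  assume J: "J \<subseteq> {1..m}"
  have "keys (Xsum J) \<subseteq> (\<Union>j\<in>J. keys (Xvar j))"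
    unfolding Xsum_def by (rule keys_sum)
  also have "\<dots> \<subseteq> (\<lambda>j. Poly_Mapping.single j 1) ` J"
    by (auto simp: Xvar_def)
  finally have keys: "keys (Xsum J) \<subseteq> (\<lambda>j. Poly_Mapping.single j 1) ` J" .
  have "keys e \<subseteq> {1..m}" if e: "e \<in> keys (Xsum J)" for e
  proof -
    obtain j where j: "j \<in> J" "e = Poly_Mapping.single j 1" using e keys by blast
    then have "keys e \<subseteq> {j}" by simp
    then show ?thesis using J j(1) by blast
  qed
  then show ?thesis by (simp add: int_polys_def)
qed

lemma one_int_polys: "1 \<in> int_polys m"
  by (simp add: int_polys_def)

lemma one_Sigma_products: "1 \<in> Sigma_products m"
  unfolding Sigma_products_def by (auto intro!: exI[of _ "\<lambda>_. 0"])

lemma Xsum_power_Sigma_products: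
  assumes "J \<in> nonempty_subsets m" shows "Xsum J ^ n \<in> Sigma_products m"
proof -
  have "(\<Prod>K\<in>nonempty_subsets m. Xsum K ^ (if K = J then n else 0)) =
      (\<Prod>K\<in>nonempty_subsets m. if K = J then Xsum K ^ n else 1)"
    by (rule prod.cong) auto
  also have "\<dots> = Xsum J ^ n"
    using assms finite_nonempty_subsets by simp
  finally have "Xsum J ^ n = (\<Prod>K\<in>nonempty_subsets m. Xsum K ^ (if K = J then n else 0))" ..
  then show ?thesis
    unfolding Sigma_products_def by (intro CollectI exI[of _ "\<lambda>K. if K = J then n else 0"]) simp
qed

lemma Fract_Xsum_in_Rm: "J \<subseteq> {1..m} \<Longrightarrow> Fract (Xsum J) 1 \<in> carrier (Rm m)"
  using Xsum_int_polys[of J m] one_Sigma_products[of m] by (simp add: Rm_def) blast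

lemma Fract_inverse_in_Rm: "J \<in> nonempty_subsets m \<Longrightarrow> Fract 1 (Xsum J ^ n) \<in> carrier (Rm m)"
  using Xsum_power_Sigma_products[of J m n] one_int_polys[of m] by (simp add: Rm_def) blast

lemma mult_Rm: "x \<otimes>\<^bsub>Rm m\<^esub> y = x * y" and add_Rm: "x \<oplus>\<^bsub>Rm m\<^esub> y = x + y" and one_Rm: "\<one>\<^bsub>Rm m\<^esub> = 1"
  by (simp_all add: Rm_def)

lemma add_center: "x \<oplus>\<^bsub>center_ring\<^esub> y = x + y"
  by (simp add: center_ring_def)

section \<open>Images of the sums of variables in the center of the algebra\<close>

context
  fixes m :: nat and \<phi> :: "int_mpoly fract \<Rightarrow> 'a::{ring,monoid_mult}"
  assumes \<phi>: "\<phi> \<in> ring_hom (Rm m) center_ring"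
begin

lemma \<phi>_mult: "x \<in> carrier (Rm m) \<Longrightarrow> y \<in> carrier (Rm m) \<Longrightarrow> \<phi> (x * y) = \<phi> x * \<phi> y"
  using ring_hom_mult[OF \<phi>] by (simp add: mult_Rm)

lemma \<phi>_add: "x \<in> carrier (Rm m) \<Longrightarrow> y \<in> carrier (Rm m) \<Longrightarrow> \<phi> (x + y) = \<phi> x + \<phi> y"
  using ring_hom_add[OF \<phi>] by (simp add: add_Rm add_center)

lemma \<phi>_one: "\<phi> 1 = 1"
  using ring_hom_one[OF \<phi>] by (simp add: one_Rm)

lemma \<phi>_Xsum:
  assumes "J \<subseteq> {1..m}"
  shows "\<phi> (Fract (Xsum J) 1) = (\<Sum>j\<in>J. \<phi> (Fract (Xvar j) 1))"
proof -
  have "finite J" using assms finite_subset by blast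
  then show ?thesis using assms
  proof (induction J rule: finite_induct)
    case empty
    have "Fract 0 1 \<in> carrier (Rm m)"
      using Fract_Xsum_in_Rm[of "{}" m] by (simp add: Xsum_def)
    from \<phi>_add[OF this this] show ?case
      by (simp add: Xsum_def)
  next
    case (insert j J)
    have "Xsum {j} = Xvar j" by (simp add: Xsum_def)
    then have "Fract (Xvar j) 1 \<in> carrier (Rm m)" "Fract (Xsum J) 1 \<in> carrier (Rm m)"
      using insert.prems Fract_Xsum_in_Rm[of "{j}" m] Fract_Xsum_in_Rm[of J m] by auto
    from \<phi>_add[OF this] have "\<phi> (Fract (Xsum (insert j J)) 1) = \<phi> (Fract (Xvar j) 1) + \<phi> (Fract (Xsum J) 1)"
      using insert.hyps by (simp add: Xsum_def)
    then show ?case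
      using insert by simp
  qed
qed

lemma \<phi>_Xsum_inverse:
  assumes J: "J \<in> nonempty_subsets m"
  shows "\<phi> (Fract (Xsum J) 1) * \<phi> (Fract 1 (Xsum J)) = 1"
    and "\<phi> (Fract 1 (Xsum J ^ n)) = \<phi> (Fract 1 (Xsum J)) ^ n"
    and "\<phi> (Fract (Xsum J) 1) \<in> carrier center_ring" "\<phi> (Fract 1 (Xsum J)) \<in> carrier center_ring"
proof -
  have sub: "J \<subseteq> {1..m}" "finite J" "J \<noteq> {}"
    using J finite_subset by (auto simp: nonempty_subsets_def)
  have X: "Xsum J \<noteq> 0" using Xsum_nonzero sub by blast
  note in_Rm = Fract_Xsum_in_Rm[OF sub(1)] Fract_inverse_in_Rm[OF J, of 1, simplified]
  have "Fract (Xsum J) 1 * Fract 1 (Xsum J) = (1 :: int_mpoly fract)"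
    using X by (simp add: One_fract_def eq_fract)
  then show "\<phi> (Fract (Xsum J) 1) * \<phi> (Fract 1 (Xsum J)) = 1"
    using \<phi>_mult[OF in_Rm] \<phi>_one by simp
  show "\<phi> (Fract 1 (Xsum J ^ n)) = \<phi> (Fract 1 (Xsum J)) ^ n"
  proof (induction n)
    case (Suc n)
    have "Fract 1 (Xsum J ^ Suc n) = Fract 1 (Xsum J) * (Fract 1 (Xsum J ^ n) :: int_mpoly fract)"
      by simp
    then show ?case
      using \<phi>_mult[OF in_Rm(2) Fract_inverse_in_Rm[OF J, of n]] Suc by simp
  qed (simp add: \<phi>_one flip: One_fract_def)
  show "\<phi> (Fract (Xsum J) 1) \<in> carrier center_ring" "\<phi> (Fract 1 (Xsum J)) \<in> carrier center_ring"
    using ring_hom_closed[OF \<phi>] in_Rm by auto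
qed

text \<open>The map \<open>\<phi>\<close> is multiplicative only on \<open>Rm m\<close>, so negative
  powers are first rewritten as \<open>Fract 1 (Xsum J ^ t)\<close>, which lies there.\<close>

lemma s_image_eq:
  "s_image \<phi> m (- int t) = (\<Sum>J\<in>nonempty_subsets m.
     frag_cmul (- ((-1) ^ card J)) (frag_of (K1_scalar (\<phi> (Fract 1 (Xsum J)) ^ t))))"
proof -
  have pow: "Fract (Xsum J) 1 powi (- int t) = Fract 1 (Xsum J ^ t)" for J
  proof -
    have "inverse (Fract (Xsum J) 1) = Fract 1 (Xsum J)" by simp
    moreover have "Fract 1 (Xsum J) ^ t = Fract 1 (Xsum J ^ t)"
      by (induction t) (simp_all add: One_fract_def)
    ultimately show ?thesis by (simp add: power_int_minus flip: power_inverse)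
  qed
  have "s_image \<phi> m (- int t) = - (\<Sum>J\<in>nonempty_subsets m.
     frag_cmul ((-1) ^ card J) (frag_of (K1_scalar (\<phi> (Fract 1 (Xsum J ^ t))))))"
    unfolding s_image_def s_elem_def pow
    by (simp add: frag_extend_minus frag_extend_sum[OF finite_nonempty_subsets] frag_extend_cmul comp_def)
  also have "\<dots> = (\<Sum>J\<in>nonempty_subsets m.
     frag_cmul (- ((-1) ^ card J)) (frag_of (K1_scalar (\<phi> (Fract 1 (Xsum J)) ^ t))))"
    unfolding sum_negf[symmetric] by (rule sum.cong) (simp_all add: \<phi>_Xsum_inverse(2))
  finally show ?thesis .
qed

end

text \<open>Both sides are additive in \<open>c\<close>, so equivariance under group elements
  suffices.\<close>

lemma group_action_module_linear:
  assumes "group_action_module M Q act" "group_action_module M' Q act'"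
    and h: "h \<in> hom M M'" and equiv: "\<And>a x. a \<in> carrier Q \<Longrightarrow> x \<in> carrier M \<Longrightarrow> h (act a x) = act' a (h x)"
    and c: "c \<in> carrier (group_ring Q)" and x: "x \<in> carrier M"
  shows "h (c \<odot>\<^bsub>action_module M act\<^esub> x) = c \<odot>\<^bsub>action_module M' act'\<^esub> h x"
proof -
  interpret A: group_action_module M Q act by fact
  interpret B: group_action_module M' Q act' by fact
  interpret h: group_hom M M' h
    by (intro group_hom.intro group_hom_axioms.intro A.M.is_group B.M.is_group h)
  from c show ?thesis
    by (induction c rule: A.R_induct)
       (use x equiv in \<open>simp_all add: A.smult_0 B.smult_0 A.smult_of B.smult_of A.smult_diff B.smult_diff A.smult_closed B.smult_closed\<close>)
qed

lemma (in group_action_module) smult_cmul_of: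
  "a \<in> carrier Q \<Longrightarrow> x \<in> carrier M \<Longrightarrow> frag_cmul n (frag_of a) \<odot>\<^bsub>AM\<^esub> x = act a x [^]\<^bsub>M\<^esub> n"
  using smult_superset[of "{a}" "frag_cmul n (frag_of a)" x] keys_cmul[of n "frag_of a"]
  by (simp del: keys_cmul_iff add: act_closed keys_frag_of)

text \<open>Moves the action of a group ring element from classes to chains, where the alternating
  sums were estimated. The memberships in the strengthened claim allow the induction over
  \<open>I\<close>.\<close>

lemma smult_bar_class:
  assumes G: "group G" and "group_action_module (homology r G) Q act"
    and z: "z \<in> carrier (bar_cycles r G)"
    and w: "\<And>i. i \<in> I \<Longrightarrow> a i \<in> carrier Q" "\<And>i. i \<in> I \<Longrightarrow> w i \<in> carrier (bar_cycles r G)"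
      "\<And>i. i \<in> I \<Longrightarrow> act (a i) (bar_class r G z) = bar_class r G (w i)"
    and I: "finite I"
  shows "(\<Sum>i\<in>I. frag_cmul (n i) (frag_of (a i))) \<odot>\<^bsub>action_module (homology r G) act\<^esub> bar_class r G z =
      bar_class r G (\<Sum>i\<in>I. frag_cmul (n i) (w i))"
proof -
  interpret group G by fact
  interpret A: group_action_module "homology r G" Q act by fact
  interpret Z: comm_group "bar_cycles r G" by (rule comm_group_bar_cycles)
  note cz = bar_class_in_homology[OF z]
  have "(\<Sum>i\<in>I. frag_cmul (n i) (frag_of (a i))) \<in> carrier A.R \<and>
    (\<Sum>i\<in>I. frag_cmul (n i) (w i)) \<in> carrier (bar_cycles r G) \<and>
    (\<Sum>i\<in>I. frag_cmul (n i) (frag_of (a i))) \<odot>\<^bsub>A.AM\<^esub> bar_class r G z = bar_class r G (\<Sum>i\<in>I. frag_cmul (n i) (w i))"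
    using I w
  proof (induction I rule: finite_induct)
    case empty
    then show ?case
      using A.smult_0[OF cz] Z.one_closed by (simp add: A.R_iff one_homology)
  next
    case (insert i I)
    have 1: "frag_cmul (n i) (frag_of (a i)) \<in> carrier A.R"
      using insert.prems(1)[of i] keys_cmul[of "n i" "frag_of (a i)"] by (auto simp: A.R_iff keys_frag_of)
    have IH: "(\<Sum>i\<in>I. frag_cmul (n i) (frag_of (a i))) \<in> carrier A.R"
      "(\<Sum>i\<in>I. frag_cmul (n i) (w i)) \<in> carrier (bar_cycles r G)"
      "(\<Sum>i\<in>I. frag_cmul (n i) (frag_of (a i))) \<odot>\<^bsub>A.AM\<^esub> bar_class r G z = bar_class r G (\<Sum>i\<in>I. frag_cmul (n i) (w i))"
      using insert by auto
    have wi: "w i \<in> carrier (bar_cycles r G)" "frag_cmul (n i) (w i) \<in> carrier (bar_cycles r G)"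
      using insert.prems(2)[of i] int_pow_bar_class(2) by auto
    have "frag_cmul (n i) (frag_of (a i)) \<odot>\<^bsub>A.AM\<^esub> bar_class r G z = bar_class r G (frag_cmul (n i) (w i))"
      using insert.prems A.smult_cmul_of[OF _ cz, of "a i" "n i"] int_pow_bar_class(1)[OF wi(1)] by simp
    then show ?case
      using insert.hyps 1 IH wi(2) A.smult_add[OF 1 IH(1) cz] mult_bar_class[OF wi(2) IH(2)]
        Z.m_closed[OF wi(2) IH(2)] keys_add_subset[of _ "carrier Q"]
      by (simp add: A.R_iff)
  qed
  then show ?thesis by blast
qed

section \<open>Scalar lifts of classes of central units and their conjugation\<close>

lemma scalar_mat_in_G_grp:
  fixes v w :: "'a::{ring,monoid_mult}"
  assumes "v \<in> carrier center_ring" "w \<in> carrier center_ring" "v * w = 1"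
  shows "scalar_mat q v \<in> carrier (G_grp q)" and "K1_det (scalar_mat q v) = K1_scalar (v ^ q)"
    and "K1_scalar (v ^ n) \<in> carrier bar_units"
proof -
  have wv: "w * v = 1" using center_commute[OF assms(1), of w] assms(3) by simp
  have "v ^ k \<in> Units center_ring" for k
    unfolding Units_center
    using center_power[OF assms(1)] center_power[OF assms(2)] center_power_inverse[OF assms(1,3)]
      center_power_inverse[OF assms(2) wv] by blast
  then show scal: "K1_scalar (v ^ n) \<in> carrier bar_units" for n
    unfolding carrier_bar_units by blast
  show det: "K1_det (scalar_mat q v) = K1_scalar (v ^ q)"
    by (rule K1_det_scalar_mat[OF assms(3) wv])
  show "scalar_mat q v \<in> carrier (G_grp q)"
    using scalar_mat_GL[OF assms(3) wv] scal by (simp add: G_grp_def det)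
qed

text \<open>The linear block commutes with the central scalar, while the translation block only
  meets the inverse scalar \<open>w\<close> on its right; centrality moves it to the left.\<close>

lemma conj_scalar_aff:
  fixes v w :: "'a::{ring,monoid_mult}"
  assumes vw: "v \<in> carrier center_ring" "w \<in> carrier center_ring" "v * w = 1"
    and T: "T \<in> carrier_mat q q" and N: "N \<in> carrier_mat p q"
  shows "aff p q (scalar_mat q v) (0\<^sub>m p q) * aff p q T N * inv\<^bsub>GL (q + p)\<^esub> (aff p q (scalar_mat q v) (0\<^sub>m p q)) =
    aff p q T (scalar_mat p w * N)"
proof -
  interpret group "GL q :: 'a mat monoid" by (rule group_GL)
  have wv: "w * v = 1" using center_commute[OF vw(1), of w] vw(3) by simp
  have "inv\<^bsub>GL q\<^esub> (scalar_mat q v) = scalar_mat q w"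
    by (rule inv_equality) (simp_all add: scalar_mat_GL[OF wv vw(3)] scalar_mat_GL[OF vw(3) wv] scalar_mat_scalar_mat wv scalar_mat_one)
  then have inv: "inv\<^bsub>GL (q + p)\<^esub> (aff p q (scalar_mat q v) (0\<^sub>m p q)) = aff p q (scalar_mat q w) (0\<^sub>m p q)"
    unfolding aff_GL(2)[OF scalar_mat_GL[OF vw(3) wv] zero_carrier_mat]
    by (simp add: aff_def scalar_mat_def) (auto intro!: arg_cong[of _ _ "\<lambda>X. four_block_mat _ _ X _"] eq_matI)
  have vT: "scalar_mat q v * T \<in> carrier_mat q q" and N': "0\<^sub>m p q * T + N \<in> carrier_mat p q"
    using T N mult_carrier_mat[OF scalar_mat_carrier T] by auto
  have "scalar_mat q v * T * scalar_mat q w = T"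
  proof (rule eq_matI)
    fix i j assume "i < dim_row T" "j < dim_col T"
    then have ij: "i < q" "j < q" using T by auto
    have "v * T $$ (i, j) * w = T $$ (i, j) * (v * w)"
      by (simp only: center_commute[OF vw(1)] mult.assoc)
    then show "(scalar_mat q v * T * scalar_mat q w) $$ (i, j) = T $$ (i, j)"
      unfolding mult_scalar_mat[OF vT] using ij T vw(3) by (simp add: scalar_mat_mult[OF T])
  qed (use T in \<open>auto simp: scalar_mat_def\<close>)
  moreover have "(0\<^sub>m p q * T + N) * scalar_mat q w + 0\<^sub>m p q = scalar_mat p w * N"
  proof -
    have "0\<^sub>m p q * T + N = N" using T N by simp
    then show ?thesis
      unfolding mult_scalar_mat[OF N'] using N
      by (auto simp: scalar_mat_mult[OF N] center_commute[OF vw(2)] intro!: eq_matI)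
  qed
  ultimately show ?thesis
    unfolding inv aff_mult[OF scalar_mat_carrier T zero_carrier_mat N] aff_mult[OF vT scalar_mat_carrier N' zero_carrier_mat]
    by simp
qed

theorem theorem2p4:
  fixes m t q p r :: nat
    and \<phi> :: "int_mpoly fract \<Rightarrow> 'a::{ring,monoid_mult}"
  assumes "m \<ge> 1"
    and "\<phi> \<in> ring_hom (Rm m) center_ring"
    and "t \<ge> 1" and "q \<ge> 1" and "q dvd t"
    and "r * t < m * q"
  shows "module_iso (group_ring bar_units)
           (H_SG r q :: 'a homology_module)
           (localization (group_ring bar_units) (s_image \<phi> m (- int t)) (H_AffSG r p q))
           (\<lambda>x. to_localization (group_ring bar_units) (s_image \<phi> m (- int t)) (H_AffSG r p q)
                  (homology_map r (AffSG_grp p q) (SG_to_Aff p q) x))"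
proof -
  let ?SG = "SG_grp q :: 'a mat monoid" and ?Aff = "AffSG_grp p q :: 'a mat monoid"
  let ?actG = "conj_action r ?SG (G_grp q) K1_det" and ?actA = "conj_action r ?Aff (AffG_grp p q) K1_det"
  let ?i = "homology_map r ?Aff (SG_to_Aff p q)" and ?\<pi> = "homology_map r ?SG (linear_part q)"
  obtain l where t: "t = l * q" using assms(5) by (metis dvdE mult.commute)
  \<comment> \<open>The bound is the hypothesis divided by \<open>q\<close>;
    \<open>l \<ge> 1\<close> is needed for the empty set, whose term must have the scalar
    \<open>0 ^ l = 0\<close>.\<close>
  have l: "l \<ge> 1" "r * l < m"
    using assms(3,4,6) by (auto simp: t simp flip: mult.assoc intro!: Suc_leI Nat.gr0I)
  interpret G: abelian_extension "GL q :: 'a mat monoid" bar_units "carrier (G_grp q)" K1_det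
    by (rule abelian_extension_G[OF assms(4)])
  interpret A: abelian_extension "GL (q + p) :: 'a mat monoid" bar_units "carrier (AffG_grp p q)" K1_det
    by (rule abelian_extension_AffG[OF assms(4)])
  note NG = SG_grp_eq[of q, where 'a = 'a, symmetric] and EG = G_grp_eq[of q, symmetric]
    and NA = AffSG_grp_eq[of p q, where 'a = 'a, symmetric] and EA = AffG_grp_eq[of p q, symmetric]
  have modG: "group_action_module (homology r ?SG) bar_units ?actG"
    using G.group_action_module[of r] unfolding NG EG .
  have modA: "group_action_module (homology r ?Aff) bar_units ?actA"
    using A.group_action_module[of r] unfolding NA EA .
  have actG: "?actG (K1_det T) x = homology_map r ?SG (\<lambda>n. T * n * inv\<^bsub>GL q\<^esub> T) x"
    if "T \<in> carrier (G_grp q)" "x \<in> carrier (homology r ?SG)" for T x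
    using G.conj_action_eq[of T x r] that unfolding NG EG by (simp add: G.conjugation_def[abs_def])
  have actA: "?actA (K1_det T) x = homology_map r ?Aff (\<lambda>n. T * n * inv\<^bsub>GL (q + p)\<^esub> T) x"
    if "T \<in> carrier (AffG_grp p q)" "x \<in> carrier (homology r ?Aff)" for T x
    using A.conj_action_eq[of T x r] that unfolding NA EA by (simp add: A.conjugation_def[abs_def])
  have conjG: "(\<lambda>n. T * n * inv\<^bsub>GL q\<^esub> T) \<in> hom ?SG ?SG" if "T \<in> carrier (G_grp q)" for T
    using G.conj_hom[OF that] unfolding NG by (simp add: G.conjugation_def[abs_def])
  have conjA: "(\<lambda>n. T * n * inv\<^bsub>GL (q + p)\<^esub> T) \<in> hom ?Aff ?Aff" if "T \<in> carrier (AffG_grp p q)" for T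
    using A.conj_hom[OF that] unfolding NA by (simp add: A.conjugation_def[abs_def])
  have gS: "group ?SG" and gA: "group ?Aff" by (rule group_SG_grp group_AffSG)+
  interpret Aff: group ?Aff by (rule gA)
  have i_hom: "?i \<in> hom (homology r ?SG) (homology r ?Aff)"
    and \<pi>_hom: "?\<pi> \<in> hom (homology r ?Aff) (homology r ?SG)"
    by (intro homology_map_hom gS gA SG_to_Aff_hom linear_part_hom)+
  \<comment> \<open>Padding by the identity lifts the same class to the affine group, so the actions
    on the two homology groups are compared through matching lifts.\<close>
  have lift: "aff p q T (0\<^sub>m p q) \<in> carrier (AffG_grp p q)" "K1_det (aff p q T (0\<^sub>m p q)) = K1_det T"
    if "T \<in> carrier (G_grp q)" for T :: "'a mat"
    unfolding AffG_grp_def carrier_Aff_grp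
    using that zero_carrier_mat K1_det_aff[OF in_G_grp_GL[OF that] zero_carrier_mat] by blast+
  have conj_aff: "aff p q T (0\<^sub>m p q) * aff p q U N * inv\<^bsub>GL (q + p)\<^esub> (aff p q T (0\<^sub>m p q)) =
      aff p q (T * U * inv\<^bsub>GL q\<^esub> T) (N * inv\<^bsub>GL q\<^esub> T)"
    if T: "T \<in> carrier (G_grp q)" and U: "U \<in> carrier_mat q q" and N: "N \<in> carrier_mat p q" for T U N :: "'a mat"
  proof -
    note TG = in_G_grp_GL[OF T]
    note Tm = GL_mat[OF TG] inv_GL(1)[OF TG]
    have "- (0\<^sub>m p q * inv\<^bsub>GL q\<^esub> T) = 0\<^sub>m p q" using Tm by (auto intro!: eq_matI)
    then show ?thesis
      unfolding aff_GL(2)[OF TG zero_carrier_mat] using Tm U N by (simp add: aff_mult)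
  qed
  have i_equiv: "?i (?actG a x) = ?actA a (?i x)"
    if a: "a \<in> carrier bar_units" and x: "x \<in> carrier (homology r ?SG)" for a x
  proof -
    obtain T where T: "T \<in> carrier (G_grp q)" "K1_det T = a"
      using G_grp_representative[OF assms(4) a] by blast
    let ?T = "aff p q T (0\<^sub>m p q)"
    have "?i (?actG a x) = homology_map r ?Aff (\<lambda>n. SG_to_Aff p q (T * n * inv\<^bsub>GL q\<^esub> T)) x"
      unfolding T(2)[symmetric] actG[OF T(1) x]
      by (rule homology_map_compose[OF gS gS gA conjG[OF T(1)] SG_to_Aff_hom x])
    also have "\<dots> = homology_map r ?Aff (\<lambda>n. ?T * SG_to_Aff p q n * inv\<^bsub>GL (q + p)\<^esub> ?T) x"
    proof (rule homology_map_cong[OF gS gA _ _ x])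
      show "(\<lambda>n. SG_to_Aff p q (T * n * inv\<^bsub>GL q\<^esub> T)) \<in> hom ?SG ?Aff"
        by (rule hom_compose[OF conjG[OF T(1)] SG_to_Aff_hom, unfolded comp_def])
      fix n assume n: "n \<in> carrier ?SG"
      show "SG_to_Aff p q (T * n * inv\<^bsub>GL q\<^esub> T) = ?T * SG_to_Aff p q n * inv\<^bsub>GL (q + p)\<^esub> ?T"
        unfolding SG_to_Aff_eq conj_aff[OF T(1) SG_mat[OF n] zero_carrier_mat]
        using inv_GL(1)[OF in_G_grp_GL[OF T(1)]] by simp
    qed
    also have "\<dots> = homology_map r ?Aff (\<lambda>n. ?T * n * inv\<^bsub>GL (q + p)\<^esub> ?T) (?i x)"
      by (rule homology_map_compose[OF gS gA gA SG_to_Aff_hom conjA[OF lift(1)[OF T(1)]] x, symmetric])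
    also have "\<dots> = ?actA a (?i x)"
      using actA[OF lift(1)[OF T(1)] hom_in_carrier[OF i_hom x]] lift(2)[OF T(1)] T(2) by simp
    finally show ?thesis .
  qed
  have \<pi>_equiv: "?\<pi> (?actA a x) = ?actG a (?\<pi> x)"
    if a: "a \<in> carrier bar_units" and x: "x \<in> carrier (homology r ?Aff)" for a x
  proof -
    obtain T where T: "T \<in> carrier (G_grp q)" "K1_det T = a"
      using G_grp_representative[OF assms(4) a] by blast
    let ?T = "aff p q T (0\<^sub>m p q)"
    note cA = conjA[OF lift(1)[OF T(1)]]
    have "?\<pi> (?actA a x) = homology_map r ?SG (\<lambda>n. linear_part q (?T * n * inv\<^bsub>GL (q + p)\<^esub> ?T)) x"
      using actA[OF lift(1)[OF T(1)] x] lift(2)[OF T(1)] T(2)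
        homology_map_compose[OF gA gA gS cA linear_part_hom x] by simp
    also have "\<dots> = homology_map r ?SG (\<lambda>n. T * linear_part q n * inv\<^bsub>GL q\<^esub> T) x"
    proof (rule homology_map_cong[OF gA gS _ _ x])
      show "(\<lambda>n. linear_part q (?T * n * inv\<^bsub>GL (q + p)\<^esub> ?T)) \<in> hom ?Aff ?SG"
        by (rule hom_compose[OF cA linear_part_hom, unfolded comp_def])
      fix n assume "n \<in> carrier ?Aff"
      then obtain U N where n: "n = aff p q U N" "U \<in> carrier ?SG" "N \<in> carrier_mat p q"
        unfolding in_AffSG by blast
      have "T * U * inv\<^bsub>GL q\<^esub> T \<in> carrier_mat q q"
        using GL_mat[OF in_G_grp_GL[OF T(1)]] inv_GL(1)[OF in_G_grp_GL[OF T(1)]] SG_mat[OF n(2)] by simp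
      then show "linear_part q (?T * n * inv\<^bsub>GL (q + p)\<^esub> ?T) = T * linear_part q n * inv\<^bsub>GL q\<^esub> T"
        unfolding n(1) conj_aff[OF T(1) SG_mat[OF n(2)] n(3)] linear_part_aff[OF SG_mat[OF n(2)]]
        by (rule linear_part_aff)
    qed
    also have "\<dots> = homology_map r ?SG (\<lambda>n. T * n * inv\<^bsub>GL q\<^esub> T) (?\<pi> x)"
      by (rule homology_map_compose[OF gA gS gS linear_part_hom conjG[OF T(1)] x, symmetric])
    also have "\<dots> = ?actG a (?\<pi> x)"
      using actG[OF T(1) hom_in_carrier[OF \<pi>_hom x]] T(2) by simp
    finally show ?thesis .
  qed
  define s where "s = (s_image \<phi> m (- int t) :: 'a K1_ring_elem)"
  define u where "u J = \<phi> (Fract (Xsum J) 1)" for J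
  define v where "v J = \<phi> (Fract 1 (Xsum J))" for J
  have uv: "u J \<in> carrier center_ring" "v J \<in> carrier center_ring" "v J * u J = 1"
    if "J \<in> nonempty_subsets m" for J
    using \<phi>_Xsum_inverse(1,3,4)[OF assms(2) that] center_commute[of "v J" "u J"] by (auto simp: u_def v_def)
  have uv_l: "u J ^ l \<in> carrier center_ring" "v J ^ l \<in> carrier center_ring" "v J ^ l * u J ^ l = 1"
    if "J \<in> nonempty_subsets m" for J
    using uv[OF that] center_power center_power_inverse by auto
  have s: "s = (\<Sum>J\<in>nonempty_subsets m. frag_cmul (- ((-1) ^ card J)) (frag_of (K1_scalar (v J ^ t))))"
    unfolding s_def v_def by (rule s_image_eq[OF assms(2)])
  have bu: "K1_scalar (v J ^ t) \<in> carrier bar_units" if "J \<in> nonempty_subsets m" for J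
    by (rule scalar_mat_in_G_grp(3)[OF uv(2,1,3)[OF that]])
  have s_R: "s \<in> carrier (group_ring bar_units)"
  proof -
    have "keys s \<subseteq> (\<Union>J\<in>nonempty_subsets m. keys (frag_cmul (- ((-1) ^ card J)) (frag_of (K1_scalar (v J ^ t)))))"
      unfolding s by (rule keys_sum)
    also have "\<dots> \<subseteq> carrier bar_units"
      using bu by (auto simp: keys_frag_of)
    finally show ?thesis by (simp add: group_ring_def)
  qed
  have s_smult: "s \<odot>\<^bsub>H_AffSG r p q\<^esub> x = ?i (?\<pi> x)" if x: "x \<in> carrier (homology r ?Aff)" for x
  proof -
    obtain z where z: "z \<in> carrier (bar_cycles r ?Aff)" "x = bar_class r ?Aff z"
      using x by (rule Aff.homology_cases)
    let ?\<psi> = "scale_translation p q"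
    have \<psi>_hom: "?\<psi> c \<in> hom ?Aff ?Aff" for c
    proof (rule AffSG_homI)
      fix T N T' N' :: "'a mat"
      assume T: "T \<in> carrier ?SG" and N: "N \<in> carrier_mat p q"
      have cN: "scalar_mat p c * N \<in> carrier_mat p q" by (rule mult_carrier_mat[OF scalar_mat_carrier N])
      show "?\<psi> c (aff p q T N) \<in> carrier ?Aff"
        unfolding scale_translation_aff[OF SG_mat[OF T] N] in_AffSG using T cN by blast
      assume T': "T' \<in> carrier ?SG" and N': "N' \<in> carrier_mat p q"
      note Tm = SG_mat[OF T] SG_mat[OF T']
      have cN': "scalar_mat p c * N' \<in> carrier_mat p q" by (rule mult_carrier_mat[OF scalar_mat_carrier N'])
      have "scalar_mat p c * (N * T' + N') = scalar_mat p c * N * T' + scalar_mat p c * N'"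
        using N N' Tm by (simp add: mult_add_distrib_mat[of _ p p _ q] assoc_mult_mat[of _ p p _ q _ q])
      moreover have "N * T' + N' \<in> carrier_mat p q" using N N' Tm by simp
      ultimately show "?\<psi> c (aff p q (T * T') (N * T' + N')) = ?\<psi> c (aff p q T N) \<otimes>\<^bsub>?Aff\<^esub> ?\<psi> c (aff p q T' N')"
        using N N' Tm cN cN' by (simp add: scale_translation_aff aff_mult)
    qed
    have act_\<psi>: "?actA (K1_scalar (v J ^ t)) (bar_class r ?Aff z) =
        bar_class r ?Aff (chain_map (map (?\<psi> (u J ^ l))) z)" if J: "J \<in> nonempty_subsets m" for J
    proof -
      \<comment> \<open>The class of this scalar matrix is that of its \<open>q\<close>-th power
        \<open>v J ^ t\<close>, a group element occurring in \<open>s\<close>. Conjugation by it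
        multiplies translations by the inverse \<open>u J ^ l\<close>.\<close>
      let ?T = "scalar_mat q (v J ^ l)"
      note c = uv_l(2,1,3)[OF J]
      have T: "?T \<in> carrier (G_grp q)" "K1_det ?T = K1_scalar (v J ^ t)"
        using scalar_mat_in_G_grp(1,2)[OF c, of q] by (simp_all add: t power_mult)
      have "?actA (K1_scalar (v J ^ t)) x =
          homology_map r ?Aff (\<lambda>n. aff p q ?T (0\<^sub>m p q) * n * inv\<^bsub>GL (q + p)\<^esub> (aff p q ?T (0\<^sub>m p q))) x"
        using actA[OF lift(1)[OF T(1)] x] lift(2)[OF T(1)] T(2) by simp
      also have "\<dots> = homology_map r ?Aff (?\<psi> (u J ^ l)) x"
      proof (rule homology_map_cong[OF gA gA conjA[OF lift(1)[OF T(1)]] _ x])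
        fix n assume "n \<in> carrier ?Aff"
        then obtain U N where n: "n = aff p q U N" "U \<in> carrier ?SG" "N \<in> carrier_mat p q"
          unfolding in_AffSG by blast
        show "aff p q ?T (0\<^sub>m p q) * n * inv\<^bsub>GL (q + p)\<^esub> (aff p q ?T (0\<^sub>m p q)) = ?\<psi> (u J ^ l) n"
          unfolding n(1) scale_translation_aff[OF SG_mat[OF n(2)] n(3)]
          by (rule conj_scalar_aff[OF c SG_mat[OF n(2)] n(3)])
      qed
      finally show ?thesis
        unfolding z(2) homology_map_bar_class[OF gA gA \<psi>_hom z(1)] .
    qed
    have \<psi>_cycle: "chain_map (map (?\<psi> c)) z \<in> carrier (bar_cycles r ?Aff)" for c
      by (rule bar_cycles_map[OF \<psi>_hom z(1)])
    have sx: "s \<odot>\<^bsub>H_AffSG r p q\<^esub> x = bar_class r ?Aff (\<Sum>J\<in>nonempty_subsets m.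
        frag_cmul (- ((-1) ^ card J)) (chain_map (map (?\<psi> (u J ^ l))) z))"
      unfolding s z(2) H_AffSG_def
      by (rule smult_bar_class[OF gA modA z(1) bu \<psi>_cycle act_\<psi> finite_nonempty_subsets])
    have "?i (?\<pi> x) = homology_map r ?Aff (\<lambda>n. SG_to_Aff p q (linear_part q n)) x"
      by (rule homology_map_compose[OF gA gS gA linear_part_hom SG_to_Aff_hom x])
    also have "\<dots> = homology_map r ?Aff (?\<psi> 0) x"
    proof (rule homology_map_cong[OF gA gA \<psi>_hom _ x, symmetric])
      fix n assume "n \<in> carrier ?Aff"
      then obtain U N where n: "n = aff p q U N" "U \<in> carrier ?SG" "N \<in> carrier_mat p q"
        unfolding in_AffSG by blast
      have "scalar_mat p 0 * N = 0\<^sub>m p q"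
        unfolding scalar_mat_mult[OF n(3)] by auto
      then show "?\<psi> 0 n = SG_to_Aff p q (linear_part q n)"
        unfolding n(1) scale_translation_aff[OF SG_mat[OF n(2)] n(3)] linear_part_aff[OF SG_mat[OF n(2)]] SG_to_Aff_eq
        by simp
    qed
    also have "\<dots> = bar_class r ?Aff (chain_map (map (?\<psi> 0)) z)"
      unfolding z(2) by (rule homology_map_bar_class[OF gA gA \<psi>_hom z(1)])
    finally have ix: "?i (?\<pi> x) = bar_class r ?Aff (chain_map (map (?\<psi> 0)) z)" .
    have Pow_eq: "Pow {1..m} = insert {} (nonempty_subsets m)" "{} \<notin> nonempty_subsets m"
      by (auto simp: nonempty_subsets_def)
    have "(\<Sum>J\<in>Pow {1..m}. frag_cmul ((-1) ^ card J)
        (chain_map (map (?\<psi> ((\<Sum>j\<in>J. \<phi> (Fract (Xvar j) 1)) ^ l))) z)) \<in> bar_boundaries r ?Aff"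
      by (rule alternating_scale_translation[OF _ _ z(1)]) (use l in simp_all)
    also have "(\<Sum>J\<in>Pow {1..m}. frag_cmul ((-1) ^ card J)
        (chain_map (map (?\<psi> ((\<Sum>j\<in>J. \<phi> (Fract (Xvar j) 1)) ^ l))) z)) =
      chain_map (map (?\<psi> 0)) z + (\<Sum>J\<in>nonempty_subsets m. frag_cmul ((-1) ^ card J) (chain_map (map (?\<psi> (u J ^ l))) z))"
    proof -
      have "(\<Sum>j\<in>J. \<phi> (Fract (Xvar j) 1)) = u J" if "J \<in> nonempty_subsets m" for J
        unfolding u_def using \<phi>_Xsum[OF assms(2), of J] that by (simp add: nonempty_subsets_def)
      \<comment> \<open>The scalar of the empty set is an empty sum raised to the power
        \<open>l\<close>; for \<open>l = 0\<close> it would be 1.\<close>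
      moreover have "(0 :: 'a) ^ l = 0" using l(1) by (cases l) simp_all
      ultimately show ?thesis
        unfolding Pow_eq(1) using Pow_eq(2) finite_nonempty_subsets by simp
    qed
    \<comment> \<open>The minus sign in the definition of \<open>s\<close> is absorbed here: the
      term of the empty set and the chain representing the action of \<open>s\<close> now have
      opposite signs, hence are homologous.\<close>
    also have "\<dots> = chain_map (map (?\<psi> 0)) z - (\<Sum>J\<in>nonempty_subsets m.
        frag_cmul (- ((-1) ^ card J)) (chain_map (map (?\<psi> (u J ^ l))) z))"
      by (simp add: sum_negf flip: minus_frag_cmul)
    finally have "- (chain_map (map (?\<psi> 0)) z - (\<Sum>J\<in>nonempty_subsets m.
        frag_cmul (- ((-1) ^ card J)) (chain_map (map (?\<psi> (u J ^ l))) z))) \<in> bar_boundaries r ?Aff"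
      by (rule Aff.bar_boundaries_minus)
    then show ?thesis
      unfolding sx ix Aff.bar_class_eq_iff by (simp only: minus_diff_eq)
  qed
  have hom_eq: "hom (add_monoid (action_module M a)) (add_monoid (action_module M' b)) = hom M M'"
    for M :: "('y, 'b) monoid_scheme" and M' :: "('z, 'c) monoid_scheme"
      and a :: "'q \<Rightarrow> 'y \<Rightarrow> 'y" and b :: "'w \<Rightarrow> 'z \<Rightarrow> 'z"
    by (simp add: hom_def action_module_def)
  have carr: "carrier (action_module M a) = carrier M" for M :: "('y, 'b) monoid_scheme" and a :: "'q \<Rightarrow> 'y \<Rightarrow> 'y"
    by (simp add: action_module_def)
  show ?thesis
    unfolding s_def[symmetric]
  proof (rule module_iso_localization[where \<pi> = ?\<pi>])
    show "module (group_ring bar_units) (H_SG r q :: 'a homology_module)"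
      unfolding H_SG_def by (rule group_action_module.module_AM[OF modG])
    show "module (group_ring bar_units) (H_AffSG r p q :: 'a homology_module)"
      unfolding H_AffSG_def by (rule group_action_module.module_AM[OF modA])
    show "s \<in> carrier (group_ring bar_units)" by (rule s_R)
    show "?i \<in> hom (add_monoid (H_SG r q)) (add_monoid (H_AffSG r p q))"
      unfolding H_SG_def H_AffSG_def hom_eq by (rule i_hom)
    show "?\<pi> \<in> hom (add_monoid (H_AffSG r p q)) (add_monoid (H_SG r q))"
      unfolding H_SG_def H_AffSG_def hom_eq by (rule \<pi>_hom)
  next
    fix c :: "'a K1_ring_elem" and x
    assume c: "c \<in> carrier (group_ring bar_units)" and "x \<in> carrier (H_SG r q :: 'a homology_module)"
    then have x: "x \<in> carrier (homology r ?SG)" by (simp add: H_SG_def carr)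
    show "?i (c \<odot>\<^bsub>H_SG r q\<^esub> x) = c \<odot>\<^bsub>H_AffSG r p q\<^esub> ?i x"
      unfolding H_SG_def H_AffSG_def by (rule group_action_module_linear[OF modG modA i_hom _ c x]) (rule i_equiv)
  next
    fix c :: "'a K1_ring_elem" and x
    assume c: "c \<in> carrier (group_ring bar_units)" and "x \<in> carrier (H_AffSG r p q :: 'a homology_module)"
    then have x: "x \<in> carrier (homology r ?Aff)" by (simp add: H_AffSG_def carr)
    show "?\<pi> (c \<odot>\<^bsub>H_AffSG r p q\<^esub> x) = c \<odot>\<^bsub>H_SG r q\<^esub> ?\<pi> x"
      unfolding H_SG_def H_AffSG_def by (rule group_action_module_linear[OF modA modG \<pi>_hom _ c x]) (rule \<pi>_equiv)
  next
    fix x assume "x \<in> carrier (H_SG r q :: 'a homology_module)"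
    then have x: "x \<in> carrier (homology r ?SG)" by (simp add: H_SG_def carr)
    have "?\<pi> (?i x) = homology_map r ?SG (\<lambda>n. linear_part q (SG_to_Aff p q n)) x"
      by (rule homology_map_compose[OF gS gA gS SG_to_Aff_hom linear_part_hom x])
    also have "\<dots> = x"
      by (rule homology_map_id[OF gS _ x]) (simp add: SG_to_Aff_eq linear_part_aff SG_mat)
    finally show "?\<pi> (?i x) = x" .
  next
    fix x assume "x \<in> carrier (H_AffSG r p q :: 'a homology_module)"
    then show "s \<odot>\<^bsub>H_AffSG r p q\<^esub> x = ?i (?\<pi> x)"
      by (intro s_smult) (simp add: H_AffSG_def carr)
  qed
qed

end
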